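(* Let $\mathcal{A}$ be an abelian category with enough projectives. For any $F\in\mathrm{fp}(\mathcal{A}^{\mathrm{op}},\mathrm{Ab})$, the following are equivalent. 1. $F\in\mathrm{fp}_!(\mathcal{A}^{\mathrm{op}},\mathrm{Ab})$. 2. $F\cong\mathrm{L}_0(Y)A$ for some $A\in\mathcal{A}$. 3. There is an exact sequence $0\to K\xrightarrow{k}P_1\xrightarrow{d}P_0$ in $\mathcal{A}$ which gives a projective presentation $$0\to\mathrm{Hom}_{\mathcal{A}}(-,K)\xrightarrow{k_*}\mathrm{Hom}_{\mathcal{A}}(-,P_1)\xrightarrow{d_*}\mathrm{Hom}_{\mathcal{A}}(-,P_0)\to F\to 0$$ of $F$ such that $P_0$ and $P_1$ are projective.
   Context: A functor $F:\mathcal{A}^{\mathrm{op}}\to\mathrm{Ab}$ is finitely presented if there is an exact sequence $\mathrm{Hom}_{\mathcal{A}}(-,B)\to\mathrm{Hom}_{\mathcal{A}}(-,C)\to F\to 0$ with $B,C\in\mathcal{A}$; $\mathrm{fp}(\mathcal{A}^{\mathrm{op}},\mathrm{Ab})$ is the (abelian) category of such functors, whose projectives are the representables. $\mathrm{fp}_0(\mathcal{A}^{\mathrm{op}},\mathrm{Ab})$ is the full subcategory of those $F$ with $FP=0$ for every projective $P\in\mathcal{A}$ (equivalently, the kernel of the exact left adjoint $w$ of the Yoneda embedding $Y:\mathcal{A}\to\mathrm{fp}(\mathcal{A}^{\mathrm{op}},\mathrm{Ab})$). $(-)^0:\mathrm{fp}(\mathcal{A}^{\mathrm{op}},\mathrm{Ab})\to\mathrm{fp}_0(\mathcal{A}^{\mathrm{op}},\mathrm{Ab})$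 is the left adjoint of the inclusion, and $\mathrm{L}_1((-)^0)$ is its first left derived functor. $\mathrm{L}_0(Y):\mathcal{A}\to\mathrm{fp}(\mathcal{A}^{\mathrm{op}},\mathrm{Ab})$ is the unique right exact functor agreeing with $Y$ on projectives of $\mathcal{A}$. By definition, $$\mathrm{fp}_!(\mathcal{A}^{\mathrm{op}},\mathrm{Ab})=\{F\in\mathrm{fp}(\mathcal{A}^{\mathrm{op}},\mathrm{Ab}):F^0=0\text{ and }\mathrm{L}_1((-)^0)(F)=0\}.$$ *)

theory Defs
  imports "HOL-Algebra.Elementary_Groups"
begin

section \<open>Preadditive and abelian categories\<close>

text \<open>
  Hom-groups are commutative groups in the sense of HOL-Algebra, so the sum of arrows is
  written multiplicatively and the zero arrow is the unit of the hom-group.  Hom-groups are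
  indexed by source and target and need not be disjoint; hence composition takes the three
  objects as arguments.  For \<open>f : X \<rightarrow> Y\<close> and \<open>g : Y \<rightarrow> Z\<close> the composite
  is \<open>Cmp C X Y Z g f : X \<rightarrow> Z\<close>.
\<close>

record ('o, 'm) acat =
  Obj :: "'o set"
  HomGrp :: "'o \<Rightarrow> 'o \<Rightarrow> 'm monoid"
  Cmp :: "'o \<Rightarrow> 'o \<Rightarrow> 'o \<Rightarrow> 'm \<Rightarrow> 'm \<Rightarrow> 'm"
  Ident :: "'o \<Rightarrow> 'm"

abbreviation arrows :: "('o, 'm) acat \<Rightarrow> 'o \<Rightarrow> 'o \<Rightarrow> 'm set" where
  "arrows C X Y \<equiv> carrier (HomGrp C X Y)"

abbreviation zero_arr :: "('o, 'm) acat \<Rightarrow> 'o \<Rightarrow> 'o \<Rightarrow> 'm" where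
  "zero_arr C X Y \<equiv> \<one>\<^bsub>HomGrp C X Y\<^esub>"

locale preadditive_category =
  fixes C :: "('o, 'm) acat"
  assumes hom_group: "\<lbrakk>X \<in> Obj C; Y \<in> Obj C\<rbrakk> \<Longrightarrow> comm_group (HomGrp C X Y)"
    and comp_closed: "\<lbrakk>X \<in> Obj C; Y \<in> Obj C; Z \<in> Obj C; f \<in> arrows C X Y; g \<in> arrows C Y Z\<rbrakk>
      \<Longrightarrow> Cmp C X Y Z g f \<in> arrows C X Z"
    and ident_closed: "X \<in> Obj C \<Longrightarrow> Ident C X \<in> arrows C X X"
    and comp_assoc: "\<lbrakk>W \<in> Obj C; X \<in> Obj C; Y \<in> Obj C; Z \<in> Obj C;
        f \<in> arrows C W X; g \<in> arrows C X Y; h \<in> arrows C Y Z\<rbrakk>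
      \<Longrightarrow> Cmp C W Y Z h (Cmp C W X Y g f) = Cmp C W X Z (Cmp C X Y Z h g) f"
    and ident_right: "\<lbrakk>X \<in> Obj C; Y \<in> Obj C; f \<in> arrows C X Y\<rbrakk>
      \<Longrightarrow> Cmp C X X Y f (Ident C X) = f"
    and ident_left: "\<lbrakk>X \<in> Obj C; Y \<in> Obj C; f \<in> arrows C X Y\<rbrakk>
      \<Longrightarrow> Cmp C X Y Y (Ident C Y) f = f"
    and comp_add_right: "\<lbrakk>X \<in> Obj C; Y \<in> Obj C; Z \<in> Obj C;
        f \<in> arrows C X Y; f' \<in> arrows C X Y; g \<in> arrows C Y Z\<rbrakk>
      \<Longrightarrow> Cmp C X Y Z g (f \<otimes>\<^bsub>HomGrp C X Y\<^esub> f')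
        = Cmp C X Y Z g f \<otimes>\<^bsub>HomGrp C X Z\<^esub> Cmp C X Y Z g f'"
    and comp_add_left: "\<lbrakk>X \<in> Obj C; Y \<in> Obj C; Z \<in> Obj C;
        f \<in> arrows C X Y; g \<in> arrows C Y Z; g' \<in> arrows C Y Z\<rbrakk>
      \<Longrightarrow> Cmp C X Y Z (g \<otimes>\<^bsub>HomGrp C Y Z\<^esub> g') f
        = Cmp C X Y Z g f \<otimes>\<^bsub>HomGrp C X Z\<^esub> Cmp C X Y Z g' f"

definition is_zero :: "('o, 'm) acat \<Rightarrow> 'o \<Rightarrow> bool" where
  "is_zero C Z \<longleftrightarrow> Z \<in> Obj C \<and>
     (\<forall>X\<in>Obj C. (\<exists>!f. f \<in> arrows C Z X) \<and> (\<exists>!f. f \<in> arrows C X Z))"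

definition isomorphic :: "('o, 'm) acat \<Rightarrow> 'o \<Rightarrow> 'o \<Rightarrow> bool" where
  "isomorphic C X Y \<longleftrightarrow> X \<in> Obj C \<and> Y \<in> Obj C \<and>
     (\<exists>f\<in>arrows C X Y. \<exists>g\<in>arrows C Y X.
        Cmp C X Y X g f = Ident C X \<and> Cmp C Y X Y f g = Ident C Y)"

definition mono_arr :: "('o, 'm) acat \<Rightarrow> 'o \<Rightarrow> 'o \<Rightarrow> 'm \<Rightarrow> bool" where
  "mono_arr C X Y f \<longleftrightarrow> X \<in> Obj C \<and> Y \<in> Obj C \<and> f \<in> arrows C X Y \<and>
     (\<forall>W\<in>Obj C. \<forall>u\<in>arrows C W X. \<forall>v\<in>arrows C W X.
        Cmp C W X Y f u = Cmp C W X Y f v \<longrightarrow> u = v)"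

definition epi_arr :: "('o, 'm) acat \<Rightarrow> 'o \<Rightarrow> 'o \<Rightarrow> 'm \<Rightarrow> bool" where
  "epi_arr C X Y f \<longleftrightarrow> X \<in> Obj C \<and> Y \<in> Obj C \<and> f \<in> arrows C X Y \<and>
     (\<forall>W\<in>Obj C. \<forall>u\<in>arrows C Y W. \<forall>v\<in>arrows C Y W.
        Cmp C X Y W u f = Cmp C X Y W v f \<longrightarrow> u = v)"

text \<open>\<open>is_kernel C K X Y k f\<close>: the arrow \<open>k : K \<rightarrow> X\<close> is a kernel of \<open>f : X \<rightarrow> Y\<close>.\<close>

definition is_kernel :: "('o, 'm) acat \<Rightarrow> 'o \<Rightarrow> 'o \<Rightarrow> 'o \<Rightarrow> 'm \<Rightarrow> 'm \<Rightarrow> bool" where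
  "is_kernel C K X Y k f \<longleftrightarrow> K \<in> Obj C \<and> X \<in> Obj C \<and> Y \<in> Obj C \<and>
     k \<in> arrows C K X \<and> f \<in> arrows C X Y \<and>
     Cmp C K X Y f k = zero_arr C K Y \<and>
     (\<forall>W\<in>Obj C. \<forall>h\<in>arrows C W X. Cmp C W X Y f h = zero_arr C W Y \<longrightarrow>
        (\<exists>!u. u \<in> arrows C W K \<and> Cmp C W K X k u = h))"

text \<open>\<open>is_cokernel C X Y Q f q\<close>: the arrow \<open>q : Y \<rightarrow> Q\<close> is a cokernel of \<open>f : X \<rightarrow> Y\<close>.\<close>

definition is_cokernel :: "('o, 'm) acat \<Rightarrow> 'o \<Rightarrow> 'o \<Rightarrow> 'o \<Rightarrow> 'm \<Rightarrow> 'm \<Rightarrow> bool" where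
  "is_cokernel C X Y Q f q \<longleftrightarrow> X \<in> Obj C \<and> Y \<in> Obj C \<and> Q \<in> Obj C \<and>
     f \<in> arrows C X Y \<and> q \<in> arrows C Y Q \<and>
     Cmp C X Y Q q f = zero_arr C X Q \<and>
     (\<forall>W\<in>Obj C. \<forall>h\<in>arrows C Y W. Cmp C X Y W h f = zero_arr C X W \<longrightarrow>
        (\<exists>!u. u \<in> arrows C Q W \<and> Cmp C Y Q W u q = h))"

definition is_biproduct ::
  "('o, 'm) acat \<Rightarrow> 'o \<Rightarrow> 'o \<Rightarrow> 'o \<Rightarrow> 'm \<Rightarrow> 'm \<Rightarrow> 'm \<Rightarrow> 'm \<Rightarrow> bool" where
  "is_biproduct C X Y S i j p q \<longleftrightarrow> S \<in> Obj C \<and>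
     i \<in> arrows C X S \<and> j \<in> arrows C Y S \<and> p \<in> arrows C S X \<and> q \<in> arrows C S Y \<and>
     Cmp C X S X p i = Ident C X \<and> Cmp C Y S Y q j = Ident C Y \<and>
     Cmp C Y S X p j = zero_arr C Y X \<and> Cmp C X S Y q i = zero_arr C X Y \<and>
     Cmp C S X S i p \<otimes>\<^bsub>HomGrp C S S\<^esub> Cmp C S Y S j q = Ident C S"

locale abelian_category = preadditive_category C for C :: "('o, 'm) acat" +
  assumes ex_zero: "\<exists>Z. is_zero C Z"
    and ex_biproduct: "\<lbrakk>X \<in> Obj C; Y \<in> Obj C\<rbrakk> \<Longrightarrow> \<exists>S i j p q. is_biproduct C X Y S i j p q"
    and ex_kernel: "\<lbrakk>X \<in> Obj C; Y \<in> Obj C; f \<in> arrows C X Y\<rbrakk> \<Longrightarrow> \<exists>K k. is_kernel C K X Y k f"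
    and ex_cokernel: "\<lbrakk>X \<in> Obj C; Y \<in> Obj C; f \<in> arrows C X Y\<rbrakk> \<Longrightarrow> \<exists>Q q. is_cokernel C X Y Q f q"
    and mono_normal: "mono_arr C X Y f \<Longrightarrow> \<exists>Z g. is_kernel C X Y Z f g"
    and epi_normal: "epi_arr C X Y f \<Longrightarrow> \<exists>W g. is_cokernel C W X Y g f"

definition projective :: "('o, 'm) acat \<Rightarrow> 'o \<Rightarrow> bool" where
  "projective C P \<longleftrightarrow> P \<in> Obj C \<and>
     (\<forall>X Y e. epi_arr C X Y e \<longrightarrow>
        (\<forall>f\<in>arrows C P Y. \<exists>g\<in>arrows C P X. Cmp C P X Y e g = f))"

definition enough_projectives :: "('o, 'm) acat \<Rightarrow> bool" where
  "enough_projectives C \<longleftrightarrow> (\<forall>X\<in>Obj C. \<exists>P e. projective C P \<and> epi_arr C P X e)"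

text \<open>
  Exactness of \<open>X \<rightarrow> Y \<rightarrow> Z\<close> at \<open>Y\<close>: \<open>f\<close> factors as an epimorphism followed by a
  kernel of \<open>g\<close>, i.e. the image of \<open>f\<close> is the kernel of \<open>g\<close>.
\<close>

definition exact_at :: "('o, 'm) acat \<Rightarrow> 'o \<Rightarrow> 'o \<Rightarrow> 'o \<Rightarrow> 'm \<Rightarrow> 'm \<Rightarrow> bool" where
  "exact_at C X Y Z f g \<longleftrightarrow>
     (\<exists>K k e. is_kernel C K Y Z k g \<and> epi_arr C X K e \<and> f = Cmp C X K Y k e)"

text \<open>\<open>H\<close> is a homology object at \<open>Y\<close> of the complex \<open>X \<rightarrow> Y \<rightarrow> Z\<close>.\<close>

definition is_homology :: "('o, 'm) acat \<Rightarrow> 'o \<Rightarrow> 'o \<Rightarrow> 'o \<Rightarrow> 'm \<Rightarrow> 'm \<Rightarrow> 'o \<Rightarrow> bool" where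
  "is_homology C X Y Z f g H \<longleftrightarrow>
     (\<exists>K k f' q. is_kernel C K Y Z k g \<and> f = Cmp C X K Y k f' \<and> is_cokernel C X K H f' q)"

definition op_cat :: "('o, 'm) acat \<Rightarrow> ('o, 'm) acat" where
  "op_cat C = \<lparr>Obj = Obj C,
     HomGrp = (\<lambda>X Y. HomGrp C Y X),
     Cmp = (\<lambda>X Y Z g f. Cmp C Z Y X f g),
     Ident = Ident C\<rparr>"

definition full_subcat :: "('o, 'm) acat \<Rightarrow> ('o \<Rightarrow> bool) \<Rightarrow> ('o, 'm) acat" where
  "full_subcat C Q = C\<lparr>Obj := {X \<in> Obj C. Q X}\<rparr>"


section \<open>Functors\<close>

record ('o, 'm, 'p, 'n) fctr =
  FOb :: "'o \<Rightarrow> 'p"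
  FAr :: "'o \<Rightarrow> 'o \<Rightarrow> 'm \<Rightarrow> 'n"

definition is_functor :: "('o, 'm) acat \<Rightarrow> ('p, 'n) acat \<Rightarrow> ('o, 'm, 'p, 'n) fctr \<Rightarrow> bool" where
  "is_functor C D T \<longleftrightarrow>
     (\<forall>X\<in>Obj C. FOb T X \<in> Obj D) \<and>
     (\<forall>X\<in>Obj C. \<forall>Y\<in>Obj C. \<forall>f\<in>arrows C X Y. FAr T X Y f \<in> arrows D (FOb T X) (FOb T Y)) \<and>
     (\<forall>X\<in>Obj C. FAr T X X (Ident C X) = Ident D (FOb T X)) \<and>
     (\<forall>X\<in>Obj C. \<forall>Y\<in>Obj C. \<forall>Z\<in>Obj C. \<forall>f\<in>arrows C X Y. \<forall>g\<in>arrows C Y Z.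
        FAr T X Z (Cmp C X Y Z g f)
          = Cmp D (FOb T X) (FOb T Y) (FOb T Z) (FAr T Y Z g) (FAr T X Y f))"

definition additive_functor :: "('o, 'm) acat \<Rightarrow> ('p, 'n) acat \<Rightarrow> ('o, 'm, 'p, 'n) fctr \<Rightarrow> bool" where
  "additive_functor C D T \<longleftrightarrow> is_functor C D T \<and>
     (\<forall>X\<in>Obj C. \<forall>Y\<in>Obj C. FAr T X Y \<in> hom (HomGrp C X Y) (HomGrp D (FOb T X) (FOb T Y)))"

definition right_exact_functor ::
  "('o, 'm) acat \<Rightarrow> ('p, 'n) acat \<Rightarrow> ('o, 'm, 'p, 'n) fctr \<Rightarrow> bool" where
  "right_exact_functor C D T \<longleftrightarrow> additive_functor C D T \<and>
     (\<forall>X\<in>Obj C. \<forall>Y\<in>Obj C. \<forall>Z\<in>Obj C. \<forall>f\<in>arrows C X Y. \<forall>g\<in>arrows C Y Z.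
        exact_at C X Y Z f g \<and> epi_arr C Y Z g \<longrightarrow>
        exact_at D (FOb T X) (FOb T Y) (FOb T Z) (FAr T X Y f) (FAr T Y Z g) \<and>
        epi_arr D (FOb T Y) (FOb T Z) (FAr T Y Z g))"

text \<open>
  Natural transformations are families indexed by the objects of \<open>C\<close>; requiring them to be
  extensional makes equality of natural transformations coincide with equality in HOL.
\<close>

definition nat_trans :: "('o, 'm) acat \<Rightarrow> ('p, 'n) acat \<Rightarrow>
    ('o, 'm, 'p, 'n) fctr \<Rightarrow> ('o, 'm, 'p, 'n) fctr \<Rightarrow> ('o \<Rightarrow> 'n) set" where
  "nat_trans C D S T = {\<tau> \<in> extensional (Obj C).
     (\<forall>X\<in>Obj C. \<tau> X \<in> arrows D (FOb S X) (FOb T X)) \<and>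
     (\<forall>X\<in>Obj C. \<forall>Y\<in>Obj C. \<forall>f\<in>arrows C X Y.
        Cmp D (FOb S X) (FOb S Y) (FOb T Y) (\<tau> Y) (FAr S X Y f)
          = Cmp D (FOb S X) (FOb T X) (FOb T Y) (FAr T X Y f) (\<tau> X))}"

definition functor_cat :: "('o, 'm) acat \<Rightarrow> ('p, 'n) acat \<Rightarrow>
    (('o, 'm, 'p, 'n) fctr, 'o \<Rightarrow> 'n) acat" where
  "functor_cat C D = \<lparr>Obj = {T. is_functor C D T},
     HomGrp = (\<lambda>S T. \<lparr>carrier = nat_trans C D S T,
        mult = (\<lambda>\<sigma> \<tau>. \<lambda>X\<in>Obj C. \<sigma> X \<otimes>\<^bsub>HomGrp D (FOb S X) (FOb T X)\<^esub> \<tau> X),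
        one = (\<lambda>X\<in>Obj C. zero_arr D (FOb S X) (FOb T X))\<rparr>),
     Cmp = (\<lambda>S T U \<tau> \<sigma>. \<lambda>X\<in>Obj C. Cmp D (FOb S X) (FOb T X) (FOb U X) (\<tau> X) (\<sigma> X)),
     Ident = (\<lambda>T. \<lambda>X\<in>Obj C. Ident D (FOb T X))\<rparr>"

definition naturally_isomorphic :: "('o, 'm) acat \<Rightarrow> ('p, 'n) acat \<Rightarrow>
    ('o, 'm, 'p, 'n) fctr \<Rightarrow> ('o, 'm, 'p, 'n) fctr \<Rightarrow> bool" where
  "naturally_isomorphic C D S T \<longleftrightarrow> isomorphic (functor_cat C D) S T"

definition inclusion_functor :: "('o, 'm, 'o, 'm) fctr" where
  "inclusion_functor = \<lparr>FOb = (\<lambda>X. X), FAr = (\<lambda>X Y f. f)\<rparr>"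

text \<open>
  \<open>L : C \<rightarrow> D\<close> is left adjoint to \<open>R : D \<rightarrow> C\<close> via bijections
  \<open>\<phi> X Y : D(L X, Y) \<cong> C(X, R Y)\<close>, natural in \<open>X\<close> and \<open>Y\<close>.
\<close>

definition left_adjoint :: "('o, 'm) acat \<Rightarrow> ('p, 'n) acat \<Rightarrow>
    ('o, 'm, 'p, 'n) fctr \<Rightarrow> ('p, 'n, 'o, 'm) fctr \<Rightarrow> bool" where
  "left_adjoint C D L R \<longleftrightarrow> is_functor C D L \<and> is_functor D C R \<and>
     (\<exists>\<phi>. (\<forall>X\<in>Obj C. \<forall>Y\<in>Obj D.
             bij_betw (\<phi> X Y) (arrows D (FOb L X) Y) (arrows C X (FOb R Y))) \<and>
          (\<forall>X\<in>Obj C. \<forall>Y\<in>Obj D. \<forall>Y'\<in>Obj D. \<forall>h\<in>arrows D (FOb L X) Y. \<forall>g\<in>arrows D Y Y'.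
             \<phi> X Y' (Cmp D (FOb L X) Y Y' g h)
               = Cmp C X (FOb R Y) (FOb R Y') (FAr R Y Y' g) (\<phi> X Y h)) \<and>
          (\<forall>X\<in>Obj C. \<forall>X'\<in>Obj C. \<forall>Y\<in>Obj D. \<forall>h\<in>arrows D (FOb L X) Y. \<forall>f\<in>arrows C X' X.
             \<phi> X' Y (Cmp D (FOb L X') (FOb L X) Y h (FAr L X' X f))
               = Cmp C X' X (FOb R Y) (\<phi> X Y h) f))"

text \<open>
  A projective resolution \<open>\<dots> \<rightarrow> P 2 \<rightarrow> P 1 \<rightarrow> P 0 \<rightarrow> X \<rightarrow> 0\<close> with differentials
  \<open>d n : P (n+1) \<rightarrow> P n\<close> and augmentation \<open>\<epsilon>\<close>.
\<close>

definition projective_resolution ::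
  "('o, 'm) acat \<Rightarrow> 'o \<Rightarrow> (nat \<Rightarrow> 'o) \<Rightarrow> (nat \<Rightarrow> 'm) \<Rightarrow> 'm \<Rightarrow> bool" where
  "projective_resolution C X P d \<epsilon> \<longleftrightarrow>
     (\<forall>n. projective C (P n)) \<and>
     (\<forall>n. d n \<in> arrows C (P (Suc n)) (P n)) \<and>
     epi_arr C (P 0) X \<epsilon> \<and>
     exact_at C (P (Suc 0)) (P 0) X (d 0) \<epsilon> \<and>
     (\<forall>n. exact_at C (P (Suc (Suc n))) (P (Suc n)) (P n) (d (Suc n)) (d n))"

text \<open>
  The value on \<open>X\<close> of the first left derived functor of \<open>T : C \<rightarrow> D\<close>, determined up to
  isomorphism: the first homology of \<open>T\<close> applied to a projective resolution of \<open>X\<close>.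
\<close>

definition left_derived1 ::
  "('o, 'm) acat \<Rightarrow> ('p, 'n) acat \<Rightarrow> ('o, 'm, 'p, 'n) fctr \<Rightarrow> 'o \<Rightarrow> 'p" where
  "left_derived1 C D T X = (SOME H. \<exists>P d \<epsilon>. projective_resolution C X P d \<epsilon> \<and>
     is_homology D (FOb T (P 2)) (FOb T (P 1)) (FOb T (P 0))
       (FAr T (P 2) (P 1) (d 1)) (FAr T (P 1) (P 0) (d 0)) H)"


section \<open>Finitely presented functors\<close>

text \<open>
  The type \<open>'u\<close> serves as the universe: \<open>Ab\<close> consists of the abelian groups carried
  by subsets of \<open>'u\<close>.
\<close>

definition Ab :: "('u monoid, 'u \<Rightarrow> 'u) acat" where
  "Ab = \<lparr>Obj = {G. comm_group G},
     HomGrp = (\<lambda>G H. \<lparr>carrier = hom G H \<inter> extensional (carrier G),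
        mult = (\<lambda>f g. \<lambda>x\<in>carrier G. f x \<otimes>\<^bsub>H\<^esub> g x),
        one = (\<lambda>x\<in>carrier G. \<one>\<^bsub>H\<^esub>)\<rparr>),
     Cmp = (\<lambda>G H K g f. compose (carrier G) g f),
     Ident = (\<lambda>G. \<lambda>x\<in>carrier G. x)\<rparr>"

text \<open>
  Contravariant functors from \<open>A\<close> to \<open>Ab\<close>.  The hom-groups of \<open>A\<close> lie in the same
  universe \<open>'u\<close> as the groups in \<open>Ab\<close>, i.e. \<open>A\<close> is locally small.  Since hom-groups
  need not be disjoint, this places no bound on the collection of objects of \<open>A\<close>.
  For \<open>f : X \<rightarrow> Y\<close> in \<open>A\<close>, the map \<open>F Y \<rightarrow> F X\<close> is \<open>FAr F Y X f\<close>.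
\<close>

type_synonym ('o, 'u) presheaf = "('o, 'u, 'u monoid, 'u \<Rightarrow> 'u) fctr"

definition presheaf_cat :: "('o, 'u) acat \<Rightarrow> (('o, 'u) presheaf, 'o \<Rightarrow> 'u \<Rightarrow> 'u) acat" where
  "presheaf_cat A = functor_cat (op_cat A) Ab"

definition yoneda_ob :: "('o, 'u) acat \<Rightarrow> 'o \<Rightarrow> ('o, 'u) presheaf" where
  "yoneda_ob A B = \<lparr>FOb = (\<lambda>X. HomGrp A X B),
     FAr = (\<lambda>X Y f. \<lambda>h\<in>arrows A X B. Cmp A Y X B h f)\<rparr>"

definition yoneda_ar :: "('o, 'u) acat \<Rightarrow> 'o \<Rightarrow> 'o \<Rightarrow> 'u \<Rightarrow> 'o \<Rightarrow> 'u \<Rightarrow> 'u" where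
  "yoneda_ar A B C g = (\<lambda>X\<in>Obj A. \<lambda>h\<in>arrows A X B. Cmp A X B C g h)"

definition yoneda :: "('o, 'u) acat \<Rightarrow> ('o, 'u, ('o, 'u) presheaf, 'o \<Rightarrow> 'u \<Rightarrow> 'u) fctr" where
  "yoneda A = \<lparr>FOb = yoneda_ob A, FAr = yoneda_ar A\<rparr>"

text \<open>Exactness of sequences of functors is pointwise exactness of sequences of abelian groups.\<close>

definition presheaf_exact :: "('o, 'u) acat \<Rightarrow>
    ('o, 'u) presheaf \<Rightarrow> ('o, 'u) presheaf \<Rightarrow> ('o, 'u) presheaf \<Rightarrow>
    ('o \<Rightarrow> 'u \<Rightarrow> 'u) \<Rightarrow> ('o \<Rightarrow> 'u \<Rightarrow> 'u) \<Rightarrow> bool" where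
  "presheaf_exact A F G H \<alpha> \<beta> \<longleftrightarrow>
     (\<forall>X\<in>Obj A. \<alpha> X ` carrier (FOb F X) = kernel (FOb G X) (FOb H X) (\<beta> X))"

definition presheaf_inj :: "('o, 'u) acat \<Rightarrow> ('o, 'u) presheaf \<Rightarrow> ('o \<Rightarrow> 'u \<Rightarrow> 'u) \<Rightarrow> bool" where
  "presheaf_inj A F \<alpha> \<longleftrightarrow> (\<forall>X\<in>Obj A. inj_on (\<alpha> X) (carrier (FOb F X)))"

definition presheaf_surj :: "('o, 'u) acat \<Rightarrow>
    ('o, 'u) presheaf \<Rightarrow> ('o, 'u) presheaf \<Rightarrow> ('o \<Rightarrow> 'u \<Rightarrow> 'u) \<Rightarrow> bool" where
  "presheaf_surj A F G \<alpha> \<longleftrightarrow> (\<forall>X\<in>Obj A. \<alpha> X ` carrier (FOb F X) = carrier (FOb G X))"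

definition finitely_presented :: "('o, 'u) acat \<Rightarrow> ('o, 'u) presheaf \<Rightarrow> bool" where
  "finitely_presented A F \<longleftrightarrow> F \<in> Obj (presheaf_cat A) \<and>
     (\<exists>B\<in>Obj A. \<exists>C\<in>Obj A.
        \<exists>\<alpha>\<in>arrows (presheaf_cat A) (yoneda_ob A B) (yoneda_ob A C).
        \<exists>\<pi>\<in>arrows (presheaf_cat A) (yoneda_ob A C) F.
          presheaf_exact A (yoneda_ob A B) (yoneda_ob A C) F \<alpha> \<pi> \<and>
          presheaf_surj A (yoneda_ob A C) F \<pi>)"

definition fp :: "('o, 'u) acat \<Rightarrow> (('o, 'u) presheaf, 'o \<Rightarrow> 'u \<Rightarrow> 'u) acat" where
  "fp A = full_subcat (presheaf_cat A) (finitely_presented A)"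

definition fp0 :: "('o, 'u) acat \<Rightarrow> (('o, 'u) presheaf, 'o \<Rightarrow> 'u \<Rightarrow> 'u) acat" where
  "fp0 A = full_subcat (fp A) (\<lambda>F. \<forall>P. projective A P \<longrightarrow> trivial_group (FOb F P))"

text \<open>
  The left adjoint of the inclusion of \<open>fp0 A\<close> into \<open>fp A\<close>, and the right exact functor
  agreeing with the Yoneda embedding on projectives; each is unique up to natural isomorphism.
\<close>

definition reflect0 :: "('o, 'u) acat \<Rightarrow>
    (('o, 'u) presheaf, 'o \<Rightarrow> 'u \<Rightarrow> 'u, ('o, 'u) presheaf, 'o \<Rightarrow> 'u \<Rightarrow> 'u) fctr" where
  "reflect0 A = (SOME T. left_adjoint (fp A) (fp0 A) T inclusion_functor)"

definition L0Y :: "('o, 'u) acat \<Rightarrow> ('o, 'u, ('o, 'u) presheaf, 'o \<Rightarrow> 'u \<Rightarrow> 'u) fctr" where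
  "L0Y A = (SOME T. right_exact_functor A (fp A) T \<and>
     naturally_isomorphic (full_subcat A (projective A)) (fp A) T (yoneda A))"

definition fp_shriek :: "('o, 'u) acat \<Rightarrow> ('o, 'u) presheaf set" where
  "fp_shriek A = {F \<in> Obj (fp A).
     is_zero (fp0 A) (FOb (reflect0 A) F) \<and>
     is_zero (fp0 A) (left_derived1 (fp A) (fp0 A) (reflect0 A) F)}"

end

theory Submission imports Defs begin

text \<open>
  Everything is reduced to one condition: \<open>F\<close> has a presentation
  \<open>Hom(-, P1) \<rightarrow> Hom(-, P0) \<rightarrow> F \<rightarrow> 0\<close> with \<open>P1\<close> and \<open>P0\<close> projective in \<open>A\<close>
  (\<open>projectively_presented\<close>).  By the Yoneda lemma such a presentation is given by an arrow
  \<open>d : P1 \<rightarrow> P0\<close> and a section of \<open>F\<close> over \<open>P0\<close>, and adding the kernel of \<open>d\<close> yields the third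
  statement of the theorem.

  For the first statement, call a section of \<open>F\<close> over \<open>X\<close> projective if it is the restriction of a
  section over a projective object.  These sections form a subfunctor, and \<open>F\<^sup>0\<close> is the quotient by
  it: as there are enough projectives, the subfunctor is generated by one section over one
  projective, which keeps the quotient finitely presented.  Hence \<open>F\<^sup>0 = 0\<close> means that all sections
  are projective (\<open>reflect0_zero_iff\<close>), and then the generator of \<open>F\<close> can be chosen over a
  projective \<open>P0\<close>.  Now let \<open>I\<close> be the kernel of \<open>Hom(-, P0) \<rightarrow> F\<close>.  The reflection kills
  \<open>Hom(-, P0)\<close> and preserves cokernels, so the value of the first derived functor at \<open>F\<close> vanishes if
  and only if \<open>I\<^sup>0\<close> does (\<open>left_derived1_zero_iff\<close>).  By the same argument this means that the
  generator of \<open>I\<close> can be chosen over a projective \<open>P1\<close>.  Because the derived functor is computed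
  from an unspecified resolution, homotopy invariance of first homology enters here
  (\<open>first_homology_transfer\<close>).

  For the second statement, a right exact functor that agrees with the Yoneda embedding on
  projectives sends the cokernel of \<open>d : P1 \<rightarrow> P0\<close> to the functor presented by \<open>d\<close>
  (\<open>right_exact_presented\<close>).  That such a functor exists is shown by dividing \<open>Hom(-, P)\<close>, for a
  projective \<open>P\<close> with an epimorphism \<open>e\<close> onto \<open>X\<close>, by those arrows that factor through an arrow from a
  projective killed by \<open>e\<close> (\<open>L0Y_exists\<close>).

  Underlying all of this is the fact that the finitely presented functors are closed under
  pointwise cokernels and images, so that epimorphisms, kernels and exactness among them are
  pointwise notions (\<open>fp_epi_iff\<close>, \<open>fp_exact_pointwise\<close>, \<open>fp_exactI\<close>).
\<close>

section \<open>Preadditive categories\<close>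

definition sub_arr :: "('o, 'm) acat \<Rightarrow> 'o \<Rightarrow> 'o \<Rightarrow> 'm \<Rightarrow> 'm \<Rightarrow> 'm" where
  "sub_arr C X Y f g = f \<otimes>\<^bsub>HomGrp C X Y\<^esub> inv\<^bsub>HomGrp C X Y\<^esub> g"

lemma comm_group_diff_one_iff:
  assumes "comm_group G" "x \<in> carrier G" "y \<in> carrier G"
  shows "x \<otimes>\<^bsub>G\<^esub> inv\<^bsub>G\<^esub> y = \<one>\<^bsub>G\<^esub> \<longleftrightarrow> x = y"
proof -
  interpret comm_group G by fact
  show ?thesis using assms(2,3)
    by (metis inv_closed inv_equality inv_inv r_inv)
qed

context preadditive_category
begin

lemmas [simp] = comp_closed ident_closed ident_left ident_right

lemma add_closed [simp]:
  "\<lbrakk>X \<in> Obj C; Y \<in> Obj C; f \<in> arrows C X Y; g \<in> arrows C X Y\<rbrakk>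
    \<Longrightarrow> f \<otimes>\<^bsub>HomGrp C X Y\<^esub> g \<in> arrows C X Y"
  by (meson comm_groupE(1) hom_group)

lemma zero_closed [simp]: "\<lbrakk>X \<in> Obj C; Y \<in> Obj C\<rbrakk> \<Longrightarrow> zero_arr C X Y \<in> arrows C X Y"
  by (meson comm_groupE(2) hom_group)

lemma neg_closed [simp]:
  "\<lbrakk>X \<in> Obj C; Y \<in> Obj C; f \<in> arrows C X Y\<rbrakk> \<Longrightarrow> inv\<^bsub>HomGrp C X Y\<^esub> f \<in> arrows C X Y"
  by (meson comm_group.axioms(2) group.inv_closed hom_group)

lemma sub_closed [simp]:
  "\<lbrakk>X \<in> Obj C; Y \<in> Obj C; f \<in> arrows C X Y; g \<in> arrows C X Y\<rbrakk> \<Longrightarrow> sub_arr C X Y f g \<in> arrows C X Y"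
  by (simp add: sub_arr_def)

lemma comp_hom_right:
  assumes "X \<in> Obj C" "Y \<in> Obj C" "Z \<in> Obj C" "g \<in> arrows C Y Z"
  shows "group_hom (HomGrp C X Y) (HomGrp C X Z) (Cmp C X Y Z g)"
  using assms hom_group
  by (auto simp: group_hom_def group_hom_axioms_def hom_def comm_group.axioms comp_add_right)

lemma comp_hom_left:
  assumes "X \<in> Obj C" "Y \<in> Obj C" "Z \<in> Obj C" "f \<in> arrows C X Y"
  shows "group_hom (HomGrp C Y Z) (HomGrp C X Z) (\<lambda>g. Cmp C X Y Z g f)"
  using assms hom_group
  by (auto simp: group_hom_def group_hom_axioms_def hom_def comm_group.axioms comp_add_left)

lemma comp_zero_right [simp]:
  assumes "X \<in> Obj C" "Y \<in> Obj C" "Z \<in> Obj C" "g \<in> arrows C Y Z"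
  shows "Cmp C X Y Z g (zero_arr C X Y) = zero_arr C X Z"
  using group_hom.hom_one[OF comp_hom_right[OF assms]] by simp

lemma comp_zero_left [simp]:
  assumes "X \<in> Obj C" "Y \<in> Obj C" "Z \<in> Obj C" "f \<in> arrows C X Y"
  shows "Cmp C X Y Z (zero_arr C Y Z) f = zero_arr C X Z"
  using group_hom.hom_one[OF comp_hom_left[OF assms]] by simp

lemma comp_sub_right:
  assumes "X \<in> Obj C" "Y \<in> Obj C" "Z \<in> Obj C" "g \<in> arrows C Y Z" "f \<in> arrows C X Y" "f' \<in> arrows C X Y"
  shows "Cmp C X Y Z g (sub_arr C X Y f f') = sub_arr C X Z (Cmp C X Y Z g f) (Cmp C X Y Z g f')"
  using assms group_hom.hom_inv[OF comp_hom_right[OF assms(1-4)]]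
  by (simp add: sub_arr_def comp_add_right)

lemma comp_sub_left:
  assumes "X \<in> Obj C" "Y \<in> Obj C" "Z \<in> Obj C" "f \<in> arrows C X Y" "g \<in> arrows C Y Z" "g' \<in> arrows C Y Z"
  shows "Cmp C X Y Z (sub_arr C Y Z g g') f = sub_arr C X Z (Cmp C X Y Z g f) (Cmp C X Y Z g' f)"
  using assms group_hom.hom_inv[OF comp_hom_left[OF assms(1-4)]]
  by (simp add: sub_arr_def comp_add_left)

lemma sub_zero_iff:
  assumes "X \<in> Obj C" "Y \<in> Obj C" "f \<in> arrows C X Y" "g \<in> arrows C X Y"
  shows "sub_arr C X Y f g = zero_arr C X Y \<longleftrightarrow> f = g"
  using assms hom_group by (simp add: sub_arr_def comm_group_diff_one_iff)

lemma sub_zero_right [simp]: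
  assumes "X \<in> Obj C" "Y \<in> Obj C" "f \<in> arrows C X Y"
  shows "sub_arr C X Y f (zero_arr C X Y) = f"
proof -
  interpret comm_group "HomGrp C X Y" using assms hom_group by blast
  show ?thesis using assms by (simp add: sub_arr_def)
qed

lemma mono_zeroI:
  assumes "X \<in> Obj C" "Y \<in> Obj C" "f \<in> arrows C X Y"
    and "\<And>W u. \<lbrakk>W \<in> Obj C; u \<in> arrows C W X; Cmp C W X Y f u = zero_arr C W Y\<rbrakk> \<Longrightarrow> u = zero_arr C W X"
  shows "mono_arr C X Y f"
  unfolding mono_arr_def
proof (intro conjI ballI impI)
  fix W u v assume W: "W \<in> Obj C" and u: "u \<in> arrows C W X" and v: "v \<in> arrows C W X"
    and "Cmp C W X Y f u = Cmp C W X Y f v"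
  then have "Cmp C W X Y f (sub_arr C W X u v) = zero_arr C W Y"
    using assms by (simp add: comp_sub_right sub_zero_iff)
  then have "sub_arr C W X u v = zero_arr C W X" using assms W u v by simp
  then show "u = v" using assms W u v by (simp add: sub_zero_iff)
qed (use assms in auto)

lemma epi_zeroI:
  assumes "X \<in> Obj C" "Y \<in> Obj C" "f \<in> arrows C X Y"
    and "\<And>W u. \<lbrakk>W \<in> Obj C; u \<in> arrows C Y W; Cmp C X Y W u f = zero_arr C X W\<rbrakk> \<Longrightarrow> u = zero_arr C Y W"
  shows "epi_arr C X Y f"
  unfolding epi_arr_def
proof (intro conjI ballI impI)
  fix W u v assume W: "W \<in> Obj C" and u: "u \<in> arrows C Y W" and v: "v \<in> arrows C Y W"
    and "Cmp C X Y W u f = Cmp C X Y W v f"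
  then have "Cmp C X Y W (sub_arr C Y W u v) f = zero_arr C X W"
    using assms by (simp add: comp_sub_left sub_zero_iff)
  then have "sub_arr C Y W u v = zero_arr C Y W" using assms W u v by simp
  then show "u = v" using assms W u v by (simp add: sub_zero_iff)
qed (use assms in auto)

lemma epi_zeroD:
  assumes "epi_arr C X Y f" "W \<in> Obj C" "u \<in> arrows C Y W" "Cmp C X Y W u f = zero_arr C X W"
  shows "u = zero_arr C Y W"
  using assms unfolding epi_arr_def by (metis comp_zero_left zero_closed)

lemma mono_zeroD:
  assumes "mono_arr C X Y f" "W \<in> Obj C" "u \<in> arrows C W X" "Cmp C W X Y f u = zero_arr C W Y"
  shows "u = zero_arr C W X"
  using assms unfolding mono_arr_def by (metis comp_zero_right zero_closed)

lemma kernel_mono: "is_kernel C K X Y k f \<Longrightarrow> mono_arr C K X k"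
  by (rule mono_zeroI) (auto simp: is_kernel_def, metis comp_zero_right zero_closed)

lemma cokernel_epi: "is_cokernel C X Y Q f q \<Longrightarrow> epi_arr C Y Q q"
  by (rule epi_zeroI) (auto simp: is_cokernel_def, metis comp_zero_left zero_closed)

lemma is_zero_iff_ident:
  "is_zero C Z \<longleftrightarrow> Z \<in> Obj C \<and> Ident C Z = zero_arr C Z Z"
proof
  assume "is_zero C Z"
  then show "Z \<in> Obj C \<and> Ident C Z = zero_arr C Z Z"
    unfolding is_zero_def by (metis ident_closed zero_closed)
next
  assume Z: "Z \<in> Obj C \<and> Ident C Z = zero_arr C Z Z"
  have "f = zero_arr C Z X" if "X \<in> Obj C" "f \<in> arrows C Z X" for X f
    using that Z by (metis comp_zero_right ident_right)
  moreover have "f = zero_arr C X Z" if "X \<in> Obj C" "f \<in> arrows C X Z" for X f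
    using that Z by (metis comp_zero_left ident_left)
  ultimately show "is_zero C Z" unfolding is_zero_def using Z zero_closed by metis
qed

lemma is_zero_to: "\<lbrakk>is_zero C Z; X \<in> Obj C; f \<in> arrows C X Z\<rbrakk> \<Longrightarrow> f = zero_arr C X Z"
  unfolding is_zero_def using zero_closed by metis

lemma is_zero_from: "\<lbrakk>is_zero C Z; X \<in> Obj C; f \<in> arrows C Z X\<rbrakk> \<Longrightarrow> f = zero_arr C Z X"
  unfolding is_zero_def using zero_closed by metis

lemma cokernel_zero_iff_epi:
  assumes "is_cokernel C X Y H f q"
  shows "is_zero C H \<longleftrightarrow> epi_arr C X Y f"
proof -
  have ob: "X \<in> Obj C" "Y \<in> Obj C" "H \<in> Obj C" "f \<in> arrows C X Y" "q \<in> arrows C Y H"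
    and qf: "Cmp C X Y H q f = zero_arr C X H"
    using assms by (auto simp: is_cokernel_def)
  show ?thesis
  proof
    assume z: "is_zero C H"
    show "epi_arr C X Y f"
    proof (rule epi_zeroI)
      fix W u assume W: "W \<in> Obj C" and u: "u \<in> arrows C Y W" and "Cmp C X Y W u f = zero_arr C X W"
      then obtain v where "v \<in> arrows C H W" "Cmp C Y H W v q = u"
        using assms unfolding is_cokernel_def by meson
      then show "u = zero_arr C Y W"
        using is_zero_from[OF z] W ob comp_zero_left by metis
    qed (use ob in auto)
  next
    assume e: "epi_arr C X Y f"
    then have "q = zero_arr C Y H" using epi_zeroD ob qf by blast
    then have "Cmp C Y H H (Ident C H) q = zero_arr C Y H" using ob by simp
    then have "Ident C H = zero_arr C H H"
      using epi_zeroD[OF cokernel_epi[OF assms] ob(3)] ob by simp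
    then show "is_zero C H" using is_zero_iff_ident ob by simp
  qed
qed

lemma exact_comp_zero:
  assumes "exact_at C X Y Z f g"
  shows "X \<in> Obj C" "Y \<in> Obj C" "Z \<in> Obj C" "f \<in> arrows C X Y" "g \<in> arrows C Y Z"
    "Cmp C X Y Z g f = zero_arr C X Z"
proof -
  obtain K k e where k: "is_kernel C K Y Z k g" and e: "epi_arr C X K e" and f: "f = Cmp C X K Y k e"
    using assms unfolding exact_at_def by blast
  show ob: "X \<in> Obj C" "Y \<in> Obj C" "Z \<in> Obj C" "f \<in> arrows C X Y" "g \<in> arrows C Y Z"
    using k e f by (auto simp: is_kernel_def epi_arr_def)
  have ob': "K \<in> Obj C" "k \<in> arrows C K Y" "e \<in> arrows C X K" "Cmp C K Y Z g k = zero_arr C K Z"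
    using k e by (auto simp: is_kernel_def epi_arr_def)
  have "Cmp C X Y Z g (Cmp C X K Y k e) = Cmp C X K Z (Cmp C K Y Z g k) e"
    using ob ob' by (intro comp_assoc)
  then show "Cmp C X Y Z g f = zero_arr C X Z" using f ob ob' by simp
qed

end

section \<open>Comparing projective resolutions\<close>

context preadditive_category
begin

lemma projective_obj: "projective C P \<Longrightarrow> P \<in> Obj C"
  by (simp add: projective_def)

lemma projective_lift:
  assumes "projective C P" "epi_arr C X Y e" "f \<in> arrows C P Y"
  obtains g where "g \<in> arrows C P X" "Cmp C P X Y e g = f"
  using assms unfolding projective_def by blast

text \<open>
  The arrow \<open>h\<close> lands in the kernel of \<open>g\<close>, onto which \<open>X\<close> maps epimorphically.
\<close>

lemma projective_lift_exact:
  assumes P: "projective C P" and ex: "exact_at C X Y Z f g"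
    and h: "h \<in> arrows C P Y" and gh: "Cmp C P Y Z g h = zero_arr C P Z"
  obtains u where "u \<in> arrows C P X" "Cmp C P X Y f u = h"
proof -
  obtain K k e where k: "is_kernel C K Y Z k g" and e: "epi_arr C X K e" and f: "f = Cmp C X K Y k e"
    using ex unfolding exact_at_def by blast
  have PO: "P \<in> Obj C" using P projective_obj by blast
  obtain v where v: "v \<in> arrows C P K" "Cmp C P K Y k v = h"
    using k h gh PO unfolding is_kernel_def by metis
  obtain u where u: "u \<in> arrows C P X" "Cmp C P X K e u = v"
    using projective_lift[OF P e v(1)] .
  have "Cmp C P X Y f u = Cmp C P K Y k (Cmp C P X K e u)"
    unfolding f using k e u PO by (intro comp_assoc[symmetric]) (auto simp: is_kernel_def epi_arr_def)
  then show ?thesis using that u v by simp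
qed

lemma resolution_arrows:
  assumes "projective_resolution C X P d \<epsilon>"
  shows "X \<in> Obj C" "\<And>n. P n \<in> Obj C" "\<And>n. d n \<in> arrows C (P (Suc n)) (P n)"
    "\<epsilon> \<in> arrows C (P 0) X" "Cmp C (P (Suc 0)) (P 0) X \<epsilon> (d 0) = zero_arr C (P (Suc 0)) X"
    "\<And>n. Cmp C (P (Suc (Suc n))) (P (Suc n)) (P n) (d n) (d (Suc n)) = zero_arr C (P (Suc (Suc n))) (P n)"
proof -
  note r = assms[unfolded projective_resolution_def]
  show "X \<in> Obj C" "\<epsilon> \<in> arrows C (P 0) X" using r by (auto simp: epi_arr_def)
  show "\<And>n. P n \<in> Obj C" "\<And>n. d n \<in> arrows C (P (Suc n)) (P n)" using r by (auto simp: projective_def)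
  show "Cmp C (P (Suc 0)) (P 0) X \<epsilon> (d 0) = zero_arr C (P (Suc 0)) X"
    "\<And>n. Cmp C (P (Suc (Suc n))) (P (Suc n)) (P n) (d n) (d (Suc n)) = zero_arr C (P (Suc (Suc n))) (P n)"
    using r exact_comp_zero(6) by blast+
qed

lemma comparison_maps:
  assumes P: "projective_resolution C X P p \<epsilon>" and Q: "projective_resolution C X Q q \<delta>"
  obtains \<phi>0 \<phi>1 \<phi>2 where
    "\<phi>0 \<in> arrows C (P 0) (Q 0)" "\<phi>1 \<in> arrows C (P 1) (Q 1)" "\<phi>2 \<in> arrows C (P 2) (Q 2)"
    "Cmp C (P 0) (Q 0) X \<delta> \<phi>0 = \<epsilon>"
    "Cmp C (P 1) (Q 1) (Q 0) (q 0) \<phi>1 = Cmp C (P 1) (P 0) (Q 0) \<phi>0 (p 0)"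
    "Cmp C (P 2) (Q 2) (Q 1) (q 1) \<phi>2 = Cmp C (P 2) (P 1) (Q 1) \<phi>1 (p 1)"
proof -
  note rP = resolution_arrows[OF P, simp] and rQ = resolution_arrows[OF Q, simp]
  have pP: "projective C (P n)" for n using P by (simp add: projective_resolution_def)
  have exQ0: "exact_at C (Q (Suc 0)) (Q 0) X (q 0) \<delta>"
    and exQ1: "exact_at C (Q (Suc (Suc 0))) (Q (Suc 0)) (Q 0) (q (Suc 0)) (q 0)"
    and epQ: "epi_arr C (Q 0) X \<delta>" using Q by (auto simp: projective_resolution_def)
  obtain \<phi>0 where 0: "\<phi>0 \<in> arrows C (P 0) (Q 0)" "Cmp C (P 0) (Q 0) X \<delta> \<phi>0 = \<epsilon>"
    using projective_lift[OF pP epQ rP(4)] .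
  have "Cmp C (P (Suc 0)) (Q 0) X \<delta> (Cmp C (P (Suc 0)) (P 0) (Q 0) \<phi>0 (p 0)) = zero_arr C (P (Suc 0)) X"
    by (subst comp_assoc) (use 0 in auto)
  then obtain \<phi>1 where 1: "\<phi>1 \<in> arrows C (P (Suc 0)) (Q (Suc 0))"
    "Cmp C (P (Suc 0)) (Q (Suc 0)) (Q 0) (q 0) \<phi>1 = Cmp C (P (Suc 0)) (P 0) (Q 0) \<phi>0 (p 0)"
    using projective_lift_exact[OF pP exQ0] 0 comp_closed rP rQ by metis
  have "Cmp C (P (Suc (Suc 0))) (Q (Suc 0)) (Q 0) (q 0) (Cmp C (P (Suc (Suc 0))) (P (Suc 0)) (Q (Suc 0)) \<phi>1 (p (Suc 0)))
      = Cmp C (P (Suc (Suc 0))) (P (Suc 0)) (Q 0) (Cmp C (P (Suc 0)) (P 0) (Q 0) \<phi>0 (p 0)) (p (Suc 0))"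
    by (subst comp_assoc) (use 1 in auto)
  also have "\<dots> = zero_arr C (P (Suc (Suc 0))) (Q 0)"
    by (subst comp_assoc[symmetric]) (use 0 in auto)
  finally obtain \<phi>2 where "\<phi>2 \<in> arrows C (P (Suc (Suc 0))) (Q (Suc (Suc 0)))"
    "Cmp C (P (Suc (Suc 0))) (Q (Suc (Suc 0))) (Q (Suc 0)) (q (Suc 0)) \<phi>2
      = Cmp C (P (Suc (Suc 0))) (P (Suc 0)) (Q (Suc 0)) \<phi>1 (p (Suc 0))"
    using projective_lift_exact[OF pP exQ1] 1(1) comp_closed rP rQ by metis
  then show ?thesis using that 0 1 by (simp add: numeral_2_eq_2)
qed

text \<open>
  The usual homotopy from the identity of \<open>Q\<close> to the self-map \<open>\<phi>\<psi>\<close>.  Only the maps up to degree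
  two that enter first homology are built, each by lifting along the exactness of a resolution.
\<close>

lemma comparison_homotopy:
  assumes P: "projective_resolution C X P p \<epsilon>" and Q: "projective_resolution C X Q q \<delta>"
  obtains \<phi>0 \<phi>1 \<phi>2 \<psi>0 \<psi>1 s0 s1 where
    "\<phi>0 \<in> arrows C (P 0) (Q 0)" "\<phi>1 \<in> arrows C (P 1) (Q 1)" "\<phi>2 \<in> arrows C (P 2) (Q 2)"
    "\<psi>0 \<in> arrows C (Q 0) (P 0)" "\<psi>1 \<in> arrows C (Q 1) (P 1)"
    "s0 \<in> arrows C (Q 0) (Q 1)" "s1 \<in> arrows C (Q 1) (Q 2)"
    "Cmp C (P 1) (Q 1) (Q 0) (q 0) \<phi>1 = Cmp C (P 1) (P 0) (Q 0) \<phi>0 (p 0)"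
    "Cmp C (P 2) (Q 2) (Q 1) (q 1) \<phi>2 = Cmp C (P 2) (P 1) (Q 1) \<phi>1 (p 1)"
    "Cmp C (Q 1) (P 1) (P 0) (p 0) \<psi>1 = Cmp C (Q 1) (Q 0) (P 0) \<psi>0 (q 0)"
    "sub_arr C (Q 1) (Q 1) (sub_arr C (Q 1) (Q 1) (Ident C (Q 1)) (Cmp C (Q 1) (P 1) (Q 1) \<phi>1 \<psi>1))
        (Cmp C (Q 1) (Q 0) (Q 1) s0 (q 0)) = Cmp C (Q 1) (Q 2) (Q 1) (q 1) s1"
proof -
  note rP = resolution_arrows[OF P, simp] and rQ = resolution_arrows[OF Q, simp]
  have pQ: "projective C (Q n)" for n using Q by (simp add: projective_resolution_def)
  have rQ': "q 0 \<in> arrows C (Q 1) (Q 0)" "p 0 \<in> arrows C (P 1) (P 0)" using rP(3)[of 0] rQ(3)[of 0] by auto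
  note rQ' [simp]
  have exQ0: "exact_at C (Q 1) (Q 0) X (q 0) \<delta>"
    and exQ1: "exact_at C (Q 2) (Q 1) (Q 0) (q 1) (q 0)"
    using Q by (auto simp: projective_resolution_def numeral_2_eq_2)
  note One_nat_def [simp del]
  obtain \<phi>0 \<phi>1 \<phi>2 where f: "\<phi>0 \<in> arrows C (P 0) (Q 0)" "\<phi>1 \<in> arrows C (P 1) (Q 1)" "\<phi>2 \<in> arrows C (P 2) (Q 2)"
    "Cmp C (P 0) (Q 0) X \<delta> \<phi>0 = \<epsilon>"
    "Cmp C (P 1) (Q 1) (Q 0) (q 0) \<phi>1 = Cmp C (P 1) (P 0) (Q 0) \<phi>0 (p 0)"
    "Cmp C (P 2) (Q 2) (Q 1) (q 1) \<phi>2 = Cmp C (P 2) (P 1) (Q 1) \<phi>1 (p 1)"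
    using comparison_maps[OF P Q] .
  obtain \<psi>0 \<psi>1 \<psi>2 where g: "\<psi>0 \<in> arrows C (Q 0) (P 0)" "\<psi>1 \<in> arrows C (Q 1) (P 1)" "\<psi>2 \<in> arrows C (Q 2) (P 2)"
    "Cmp C (Q 0) (P 0) X \<epsilon> \<psi>0 = \<delta>"
    "Cmp C (Q 1) (P 1) (P 0) (p 0) \<psi>1 = Cmp C (Q 1) (Q 0) (P 0) \<psi>0 (q 0)"
    "Cmp C (Q 2) (P 2) (P 1) (p 1) \<psi>2 = Cmp C (Q 2) (Q 1) (P 1) \<psi>1 (q 1)"
    using comparison_maps[OF Q P] .
  note fg = f(1-3)[simp] g(1-3)[simp]
  let ?a0 = "Cmp C (Q 0) (P 0) (Q 0) \<phi>0 \<psi>0" and ?a1 = "Cmp C (Q 1) (P 1) (Q 1) \<phi>1 \<psi>1"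
  have "Cmp C (Q 0) (Q 0) X \<delta> ?a0 = \<delta>"
    by (subst comp_assoc) (simp_all add: f(4) g(4))
  then have "Cmp C (Q 0) (Q 0) X \<delta> (sub_arr C (Q 0) (Q 0) (Ident C (Q 0)) ?a0) = zero_arr C (Q 0) X"
    by (simp add: comp_sub_right sub_zero_iff)
  then obtain s0 where s0: "s0 \<in> arrows C (Q 0) (Q 1)"
    "Cmp C (Q 0) (Q 1) (Q 0) (q 0) s0 = sub_arr C (Q 0) (Q 0) (Ident C (Q 0)) ?a0"
    using projective_lift_exact[OF pQ exQ0] by (metis (no_types, lifting) comp_closed f(1) g(1) ident_closed rP(2) rQ(2) sub_closed)
  note s0(1) [simp]
  let ?t = "sub_arr C (Q 1) (Q 1) (sub_arr C (Q 1) (Q 1) (Ident C (Q 1)) ?a1) (Cmp C (Q 1) (Q 0) (Q 1) s0 (q 0))"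
  have qa: "Cmp C (Q 1) (Q 1) (Q 0) (q 0) ?a1 = Cmp C (Q 1) (Q 0) (Q 0) ?a0 (q 0)"
  proof -
    have "Cmp C (Q 1) (Q 1) (Q 0) (q 0) ?a1 = Cmp C (Q 1) (P 1) (Q 0) (Cmp C (P 1) (P 0) (Q 0) \<phi>0 (p 0)) \<psi>1"
      by (subst comp_assoc) (use f in auto)
    also have "\<dots> = Cmp C (Q 1) (P 0) (Q 0) \<phi>0 (Cmp C (Q 1) (Q 0) (P 0) \<psi>0 (q 0))"
      by (subst comp_assoc[symmetric]) (use g in auto)
    also have "\<dots> = Cmp C (Q 1) (Q 0) (Q 0) ?a0 (q 0)"
      by (rule comp_assoc) auto
    finally show ?thesis .
  qed
  have qs: "Cmp C (Q 1) (Q 1) (Q 0) (q 0) (Cmp C (Q 1) (Q 0) (Q 1) s0 (q 0))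
      = sub_arr C (Q 1) (Q 0) (q 0) (Cmp C (Q 1) (Q 0) (Q 0) ?a0 (q 0))"
    by (subst comp_assoc) (simp_all add: s0 comp_sub_left)
  have "Cmp C (Q 1) (Q 1) (Q 0) (q 0) ?t = zero_arr C (Q 1) (Q 0)"
    by (simp add: comp_sub_right qa qs sub_zero_iff del: One_nat_def)
  moreover have "?t \<in> arrows C (Q 1) (Q 1)" by simp
  ultimately obtain s1 where s1: "s1 \<in> arrows C (Q 1) (Q 2)" "Cmp C (Q 1) (Q 2) (Q 1) (q 1) s1 = ?t"
    using projective_lift_exact[OF pQ exQ1, of ?t] by blast
  show ?thesis using that[OF f(1-3) g(1-2) s0(1) s1(1) f(5-6) g(5) s1(2)[symmetric]] .
qed

text \<open>
  The arrows \<open>k : K \<rightarrow> P1\<close> and \<open>l : L \<rightarrow> Q1\<close> are the cycles of two complexes, and the homotopy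
  identity makes \<open>Q\<close> a retract of \<open>P\<close> up to homotopy.  On cycles one gets \<open>v : L \<rightarrow> K\<close> and
  \<open>w : K \<rightarrow> L\<close> such that \<open>1 - w v\<close> factors through the boundary map \<open>q'\<close>.  An arrow \<open>u\<close> with
  \<open>u q' = 0\<close> thus satisfies \<open>u = u w v\<close>, and \<open>u w\<close> vanishes because it kills the epimorphism \<open>p'\<close>.
\<close>

lemma exactness_transfer:
  assumes ob [simp]: "P0 \<in> Obj C" "P1 \<in> Obj C" "P2 \<in> Obj C" "Q0 \<in> Obj C" "Q1 \<in> Obj C" "Q2 \<in> Obj C"
    and q [simp]: "q0 \<in> arrows C Q1 Q0"
    and f [simp]: "\<phi>0 \<in> arrows C P0 Q0" "\<phi>1 \<in> arrows C P1 Q1" "\<phi>2 \<in> arrows C P2 Q2"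
    and g [simp]: "\<psi>0 \<in> arrows C Q0 P0" "\<psi>1 \<in> arrows C Q1 P1"
    and s [simp]: "s0 \<in> arrows C Q0 Q1" "s1 \<in> arrows C Q1 Q2"
    and f1: "Cmp C P1 Q1 Q0 q0 \<phi>1 = Cmp C P1 P0 Q0 \<phi>0 p0"
    and f2: "Cmp C P2 Q2 Q1 q1 \<phi>2 = Cmp C P2 P1 Q1 \<phi>1 p1"
    and g1: "Cmp C Q1 P1 P0 p0 \<psi>1 = Cmp C Q1 Q0 P0 \<psi>0 q0"
    and h: "sub_arr C Q1 Q1 (sub_arr C Q1 Q1 (Ident C Q1) (Cmp C Q1 P1 Q1 \<phi>1 \<psi>1)) (Cmp C Q1 Q0 Q1 s0 q0)
        = Cmp C Q1 Q2 Q1 q1 s1"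
    and kP: "is_kernel C K P1 P0 k p0" and p1: "p1 = Cmp C P2 K P1 k p'" and eP: "epi_arr C P2 K p'"
    and kQ: "is_kernel C L Q1 Q0 l q0" and q1: "q1 = Cmp C Q2 L Q1 l q'" and q' [simp]: "q' \<in> arrows C Q2 L"
  shows "epi_arr C Q2 L q'"
proof (rule epi_zeroI)
  have [simp]: "K \<in> Obj C" "k \<in> arrows C K P1" "p0 \<in> arrows C P1 P0" "p' \<in> arrows C P2 K"
    "Cmp C K P1 P0 p0 k = zero_arr C K P0"
    using kP eP by (auto simp: is_kernel_def epi_arr_def)
  show [simp]: "L \<in> Obj C" using kQ by (auto simp: is_kernel_def)
  have [simp]: "l \<in> arrows C L Q1" "Cmp C L Q1 Q0 q0 l = zero_arr C L Q0"
    using kQ by (auto simp: is_kernel_def)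
  have ml: "u = v" if "W \<in> Obj C" "u \<in> arrows C W L" "v \<in> arrows C W L" "Cmp C W L Q1 l u = Cmp C W L Q1 l v" for W u v
    using kernel_mono[OF kQ] that by (auto simp: mono_arr_def)
  have "Cmp C L P1 P0 p0 (Cmp C L Q1 P1 \<psi>1 l) = Cmp C L Q1 P0 (Cmp C Q1 Q0 P0 \<psi>0 q0) l"
    by (subst comp_assoc) (simp_all add: g1)
  also have "\<dots> = zero_arr C L P0" by (subst comp_assoc[symmetric]) auto
  finally obtain v where v [simp]: "v \<in> arrows C L K" and kv: "Cmp C L K P1 k v = Cmp C L Q1 P1 \<psi>1 l"
    using kP unfolding is_kernel_def by (metis \<open>L \<in> Obj C\<close> \<open>l \<in> arrows C L Q1\<close> comp_closed g(2) ob(5))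
  have "Cmp C K Q1 Q0 q0 (Cmp C K P1 Q1 \<phi>1 k) = Cmp C K P1 Q0 (Cmp C P1 P0 Q0 \<phi>0 p0) k"
    by (subst comp_assoc) (simp_all add: f1)
  also have "\<dots> = zero_arr C K Q0" by (subst comp_assoc[symmetric]) auto
  finally obtain w where w [simp]: "w \<in> arrows C K L" and lw: "Cmp C K L Q1 l w = Cmp C K P1 Q1 \<phi>1 k"
    using kQ unfolding is_kernel_def by (metis \<open>K \<in> Obj C\<close> \<open>k \<in> arrows C K P1\<close> comp_closed f(2) ob(2))
  have wp: "Cmp C P2 K L w p' = Cmp C P2 Q2 L q' \<phi>2"
  proof (rule ml)
    have "Cmp C P2 L Q1 l (Cmp C P2 K L w p') = Cmp C P2 K Q1 (Cmp C K P1 Q1 \<phi>1 k) p'"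
      by (subst comp_assoc) (simp_all add: lw)
    also have "\<dots> = Cmp C P2 P1 Q1 \<phi>1 p1"
      unfolding p1 by (rule comp_assoc[symmetric]) auto
    also have "\<dots> = Cmp C P2 L Q1 l (Cmp C P2 Q2 L q' \<phi>2)"
      unfolding f2[symmetric] q1 by (rule comp_assoc[symmetric]) auto
    finally show "Cmp C P2 L Q1 l (Cmp C P2 K L w p') = Cmp C P2 L Q1 l (Cmp C P2 Q2 L q' \<phi>2)" .
  qed auto
  have id: "sub_arr C L L (Ident C L) (Cmp C L K L w v) = Cmp C L Q2 L q' (Cmp C L Q1 Q2 s1 l)"
  proof (rule ml)
    have 1: "Cmp C L Q1 Q1 (Cmp C Q1 P1 Q1 \<phi>1 \<psi>1) l = Cmp C L L Q1 l (Cmp C L K L w v)"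
    proof -
      have "Cmp C L Q1 Q1 (Cmp C Q1 P1 Q1 \<phi>1 \<psi>1) l = Cmp C L P1 Q1 \<phi>1 (Cmp C L K P1 k v)"
        unfolding kv by (rule comp_assoc[symmetric]) auto
      also have "\<dots> = Cmp C L K Q1 (Cmp C K L Q1 l w) v" unfolding lw by (rule comp_assoc) auto
      also have "\<dots> = Cmp C L L Q1 l (Cmp C L K L w v)" by (rule comp_assoc[symmetric]) auto
      finally show ?thesis .
    qed
    have 2: "Cmp C L Q1 Q1 (Cmp C Q1 Q0 Q1 s0 q0) l = zero_arr C L Q1"
      by (subst comp_assoc[symmetric]) auto
    have "Cmp C L L Q1 l (sub_arr C L L (Ident C L) (Cmp C L K L w v))
        = Cmp C L Q1 Q1 (sub_arr C Q1 Q1 (sub_arr C Q1 Q1 (Ident C Q1) (Cmp C Q1 P1 Q1 \<phi>1 \<psi>1)) (Cmp C Q1 Q0 Q1 s0 q0)) l"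
      by (simp add: comp_sub_left comp_sub_right 1 2)
    also have "\<dots> = Cmp C L Q1 Q1 (Cmp C Q1 Q2 Q1 (Cmp C Q2 L Q1 l q') s1) l"
      unfolding h q1 ..
    also have "\<dots> = Cmp C L Q2 Q1 (Cmp C Q2 L Q1 l q') (Cmp C L Q1 Q2 s1 l)"
      by (rule comp_assoc[symmetric]) auto
    also have "\<dots> = Cmp C L L Q1 l (Cmp C L Q2 L q' (Cmp C L Q1 Q2 s1 l))"
      by (rule comp_assoc[symmetric]) auto
    finally show "Cmp C L L Q1 l (sub_arr C L L (Ident C L) (Cmp C L K L w v))
      = Cmp C L L Q1 l (Cmp C L Q2 L q' (Cmp C L Q1 Q2 s1 l))" .
  qed auto
  fix W u assume W [simp]: "W \<in> Obj C" and u [simp]: "u \<in> arrows C L W"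
    and uq: "Cmp C Q2 L W u q' = zero_arr C Q2 W"
  have "Cmp C P2 K W (Cmp C K L W u w) p' = Cmp C P2 Q2 W (Cmp C Q2 L W u q') \<phi>2"
    by (subst (1 2) comp_assoc[symmetric]) (simp_all add: wp)
  then have uw: "Cmp C K L W u w = zero_arr C K W"
    using epi_zeroD[OF eP W] uq by simp
  have 1: "Cmp C L L W u (Cmp C L K L w v) = zero_arr C L W"
    by (subst comp_assoc) (simp_all add: uw)
  have 2: "Cmp C L L W u (Cmp C L Q2 L q' (Cmp C L Q1 Q2 s1 l)) = zero_arr C L W"
    by (subst comp_assoc) (simp_all add: uq)
  have "u = Cmp C L L W u (sub_arr C L L (Ident C L) (Cmp C L K L w v))"
    by (simp add: comp_sub_right 1)
  then show "u = zero_arr C L W" using 2 id by simp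
qed (use ob q' in auto)

end

lemma additive_sub:
  assumes "preadditive_category C" "preadditive_category D" "additive_functor C D T"
    and "X \<in> Obj C" "Y \<in> Obj C" "f \<in> arrows C X Y" "g \<in> arrows C X Y"
  shows "FAr T X Y (sub_arr C X Y f g) = sub_arr D (FOb T X) (FOb T Y) (FAr T X Y f) (FAr T X Y g)"
proof -
  interpret C: preadditive_category C by fact
  interpret D: preadditive_category D by fact
  have "group_hom (HomGrp C X Y) (HomGrp D (FOb T X) (FOb T Y)) (FAr T X Y)"
    using assms C.hom_group D.hom_group
    by (auto simp: group_hom_def group_hom_axioms_def additive_functor_def is_functor_def comm_group.axioms)
  then interpret group_hom "HomGrp C X Y" "HomGrp D (FOb T X) (FOb T Y)" "FAr T X Y" .
  show ?thesis using assms by (simp add: sub_arr_def)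
qed

text \<open>
  An additive functor preserves the comparison maps and the homotopy, so vanishing of first homology
  passes from one resolution to any other.  On the target side it is expressed by the boundary map
  onto the cycles being epi, which does not presuppose that a homology object exists.
\<close>

lemma first_homology_transfer:
  assumes C: "preadditive_category C" and D: "preadditive_category D" and T: "additive_functor C D T"
    and P: "projective_resolution C X P p \<epsilon>" and Q: "projective_resolution C X Q q \<delta>"
    and H: "is_homology D (FOb T (P 2)) (FOb T (P 1)) (FOb T (P 0))
       (FAr T (P 2) (P 1) (p 1)) (FAr T (P 1) (P 0) (p 0)) H" and z: "is_zero D H"
    and kQ: "is_kernel D L (FOb T (Q 1)) (FOb T (Q 0)) l (FAr T (Q 1) (Q 0) (q 0))"
    and q1: "FAr T (Q 2) (Q 1) (q 1) = Cmp D (FOb T (Q 2)) L (FOb T (Q 1)) l q'"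
    and q': "q' \<in> arrows D (FOb T (Q 2)) L"
  shows "epi_arr D (FOb T (Q 2)) L q'"
proof -
  interpret C: preadditive_category C by fact
  interpret D: preadditive_category D by fact
  note rP = C.resolution_arrows[OF P, simp] and rQ = C.resolution_arrows[OF Q, simp]
  have r' [simp]: "q 0 \<in> arrows C (Q 1) (Q 0)" "p 0 \<in> arrows C (P 1) (P 0)"
    "q 1 \<in> arrows C (Q 2) (Q 1)" "p 1 \<in> arrows C (P 2) (P 1)"
    using rP(3)[of 0] rQ(3)[of 0] rP(3)[of 1] rQ(3)[of 1] by (auto simp: numeral_2_eq_2)
  obtain K k p' c where kP: "is_kernel D K (FOb T (P 1)) (FOb T (P 0)) k (FAr T (P 1) (P 0) (p 0))"
    and p1: "FAr T (P 2) (P 1) (p 1) = Cmp D (FOb T (P 2)) K (FOb T (P 1)) k p'"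
    and ck: "is_cokernel D (FOb T (P 2)) K H p' c"
    using H unfolding is_homology_def by blast
  have eP: "epi_arr D (FOb T (P 2)) K p'" using D.cokernel_zero_iff_epi[OF ck] z by simp
  have TO [simp]: "FOb T Y \<in> Obj D" if "Y \<in> Obj C" for Y
    using T that by (simp add: additive_functor_def is_functor_def)
  have TA [simp]: "FAr T Y Z f \<in> arrows D (FOb T Y) (FOb T Z)" if "Y \<in> Obj C" "Z \<in> Obj C" "f \<in> arrows C Y Z" for Y Z f
    using T that by (simp add: additive_functor_def is_functor_def)
  have TC: "Cmp D (FOb T Y) (FOb T Z) (FOb T W) (FAr T Z W g) (FAr T Y Z f) = FAr T Y W (Cmp C Y Z W g f)"
    if "Y \<in> Obj C" "Z \<in> Obj C" "W \<in> Obj C" "f \<in> arrows C Y Z" "g \<in> arrows C Z W" for Y Z W f g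
    using T that by (simp add: additive_functor_def is_functor_def)
  have TI: "FAr T Y Y (Ident C Y) = Ident D (FOb T Y)" if "Y \<in> Obj C" for Y
    using T that by (simp add: additive_functor_def is_functor_def)
  note TS = additive_sub[OF C D T]
  show ?thesis
  proof (rule C.comparison_homotopy[OF P Q])
    fix \<phi>0 \<phi>1 \<phi>2 \<psi>0 \<psi>1 s0 s1
    assume a [simp]: "\<phi>0 \<in> arrows C (P 0) (Q 0)" "\<phi>1 \<in> arrows C (P 1) (Q 1)" "\<phi>2 \<in> arrows C (P 2) (Q 2)"
      "\<psi>0 \<in> arrows C (Q 0) (P 0)" "\<psi>1 \<in> arrows C (Q 1) (P 1)"
      "s0 \<in> arrows C (Q 0) (Q 1)" "s1 \<in> arrows C (Q 1) (Q 2)"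
    assume e: "Cmp C (P 1) (Q 1) (Q 0) (q 0) \<phi>1 = Cmp C (P 1) (P 0) (Q 0) \<phi>0 (p 0)"
      "Cmp C (P 2) (Q 2) (Q 1) (q 1) \<phi>2 = Cmp C (P 2) (P 1) (Q 1) \<phi>1 (p 1)"
      "Cmp C (Q 1) (P 1) (P 0) (p 0) \<psi>1 = Cmp C (Q 1) (Q 0) (P 0) \<psi>0 (q 0)"
    assume h: "sub_arr C (Q 1) (Q 1) (sub_arr C (Q 1) (Q 1) (Ident C (Q 1)) (Cmp C (Q 1) (P 1) (Q 1) \<phi>1 \<psi>1))
        (Cmp C (Q 1) (Q 0) (Q 1) s0 (q 0)) = Cmp C (Q 1) (Q 2) (Q 1) (q 1) s1"
    have h': "sub_arr D (FOb T (Q 1)) (FOb T (Q 1)) (sub_arr D (FOb T (Q 1)) (FOb T (Q 1)) (Ident D (FOb T (Q 1)))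
          (Cmp D (FOb T (Q 1)) (FOb T (P 1)) (FOb T (Q 1)) (FAr T (P 1) (Q 1) \<phi>1) (FAr T (Q 1) (P 1) \<psi>1)))
        (Cmp D (FOb T (Q 1)) (FOb T (Q 0)) (FOb T (Q 1)) (FAr T (Q 0) (Q 1) s0) (FAr T (Q 1) (Q 0) (q 0)))
        = Cmp D (FOb T (Q 1)) (FOb T (Q 2)) (FOb T (Q 1)) (FAr T (Q 2) (Q 1) (q 1)) (FAr T (Q 1) (Q 2) s1)"
      using arg_cong[OF h, of "FAr T (Q 1) (Q 1)"] by (simp add: TC TS TI del: One_nat_def)
    show ?thesis
      by (rule D.exactness_transfer[OF _ _ _ _ _ _ _ _ _ _ _ _ _ _ _ _ _ h' kP p1 eP kQ q1 q', where ?\<phi>0.0="FAr T (P 0) (Q 0) \<phi>0"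
            and ?\<phi>2.0="FAr T (P 2) (Q 2) \<phi>2" and ?\<psi>0.0="FAr T (Q 0) (P 0) \<psi>0"])
        (simp_all add: TC e del: One_nat_def)
  qed
qed

section \<open>Full subcategories, abelian groups and functor categories\<close>

lemma full_subcat_simps [simp]:
  "Obj (full_subcat C Q) = {X \<in> Obj C. Q X}"
  "HomGrp (full_subcat C Q) = HomGrp C"
  "Cmp (full_subcat C Q) = Cmp C"
  "Ident (full_subcat C Q) = Ident C"
  by (simp_all add: full_subcat_def)

lemma preadditive_full_subcat:
  "preadditive_category C \<Longrightarrow> preadditive_category (full_subcat C Q)"
  unfolding preadditive_category_def by simp

lemma epi_full_subcat:
  "\<lbrakk>epi_arr C X Y f; Q X; Q Y\<rbrakk> \<Longrightarrow> epi_arr (full_subcat C Q) X Y f"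
  by (auto simp: epi_arr_def)

lemma kernel_full_subcat:
  "\<lbrakk>is_kernel C K X Y k f; Q K; Q X; Q Y\<rbrakk> \<Longrightarrow> is_kernel (full_subcat C Q) K X Y k f"
  by (auto simp: is_kernel_def)

lemma cokernel_full_subcat:
  "\<lbrakk>is_cokernel C X Y Z f q; Q X; Q Y; Q Z\<rbrakk> \<Longrightarrow> is_cokernel (full_subcat C Q) X Y Z f q"
  by (auto simp: is_cokernel_def)

lemma op_cat_simps [simp]:
  "Obj (op_cat C) = Obj C"
  "HomGrp (op_cat C) X Y = HomGrp C Y X"
  "Cmp (op_cat C) X Y Z g f = Cmp C Z Y X f g"
  "Ident (op_cat C) = Ident C"
  by (simp_all add: op_cat_def)

lemma Ab_simps [simp]:
  "Obj Ab = {G. comm_group G}"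
  "carrier (HomGrp Ab G H) = hom G H \<inter> extensional (carrier G)"
  "f \<otimes>\<^bsub>HomGrp Ab G H\<^esub> g = (\<lambda>x\<in>carrier G. f x \<otimes>\<^bsub>H\<^esub> g x)"
  "\<one>\<^bsub>HomGrp Ab G H\<^esub> = (\<lambda>x\<in>carrier G. \<one>\<^bsub>H\<^esub>)"
  "Cmp Ab G H K g' f = compose (carrier G) g' f"
  "Ident Ab G = (\<lambda>x\<in>carrier G. x)"
  by (simp_all add: Ab_def)

lemma preadditive_Ab: "preadditive_category (Ab :: ('u monoid, 'u \<Rightarrow> 'u) acat)"
proof (rule preadditive_category.intro)
  fix G H :: "'u monoid" assume "G \<in> Obj Ab" "H \<in> Obj Ab"
  then interpret G: comm_group G + H: comm_group H by simp_all
  show "comm_group (HomGrp Ab G H)"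
  proof (rule comm_groupI, goal_cases)
    case (1 f g)
    then show ?case using G.m_closed by (auto simp: hom_def Pi_iff H.m_ac)
  next
    case 2
    show ?case by (auto simp: hom_def)
  next
    case (3 f g h)
    then show ?case by (auto simp: hom_def Pi_iff H.m_assoc)
  next
    case (4 f g)
    then show ?case by (auto simp: hom_def Pi_iff H.m_comm)
  next
    case (5 f)
    then show ?case by (auto simp: hom_def Pi_iff extensional_def)
  next
    case (6 f)
    then have "(\<lambda>x\<in>carrier G. inv\<^bsub>H\<^esub> (f x)) \<in> carrier (HomGrp Ab G H)"
      by (auto simp: hom_def Pi_iff H.inv_mult)
    moreover have "(\<lambda>x\<in>carrier G. inv\<^bsub>H\<^esub> (f x)) \<otimes>\<^bsub>HomGrp Ab G H\<^esub> f = \<one>\<^bsub>HomGrp Ab G H\<^esub>"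
      using 6 by (auto simp: hom_def Pi_iff)
    ultimately show ?case by blast
  qed
next
  fix G :: "'u monoid" assume "G \<in> Obj Ab"
  then interpret G: comm_group G by simp
  show "Ident Ab G \<in> arrows Ab G G" by (auto simp: hom_def)
qed (auto simp: hom_def Pi_iff compose_def fun_eq_iff extensional_def comm_groupE(1) intro!: comm_groupE(1))

lemma functor_cat_simps [simp]:
  "Obj (functor_cat C D) = {T. is_functor C D T}"
  "carrier (HomGrp (functor_cat C D) S T) = nat_trans C D S T"
  "\<sigma> \<otimes>\<^bsub>HomGrp (functor_cat C D) S T\<^esub> \<tau> = (\<lambda>X\<in>Obj C. \<sigma> X \<otimes>\<^bsub>HomGrp D (FOb S X) (FOb T X)\<^esub> \<tau> X)"
  "\<one>\<^bsub>HomGrp (functor_cat C D) S T\<^esub> = (\<lambda>X\<in>Obj C. zero_arr D (FOb S X) (FOb T X))"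
  "Cmp (functor_cat C D) S T U \<tau> \<sigma> = (\<lambda>X\<in>Obj C. Cmp D (FOb S X) (FOb T X) (FOb U X) (\<tau> X) (\<sigma> X))"
  "Ident (functor_cat C D) T = (\<lambda>X\<in>Obj C. Ident D (FOb T X))"
  by (simp_all add: functor_cat_def)

lemma (in preadditive_category) preadditive_functor_cat:
  fixes B :: "('c, 'd) acat"
  shows "preadditive_category (functor_cat B C)"
proof (rule preadditive_category.intro)
  note [simp] = nat_trans_def is_functor_def
  fix S T :: "('c, 'd, 'o, 'm) fctr" assume ST: "S \<in> Obj (functor_cat B C)" "T \<in> Obj (functor_cat B C)"
  have cg: "comm_group (HomGrp C (FOb S X) (FOb T X))" if "X \<in> Obj B" for X
    using ST that hom_group by simp
  show "comm_group (HomGrp (functor_cat B C) S T)"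
  proof (rule comm_groupI, goal_cases)
    case (1 f g)
    then show ?case using ST by (auto simp: comp_add_left comp_add_right)
  next
    case 2
    show ?case using ST by auto
  next
    case (3 f g h)
    then show ?case using cg by (intro ext) (auto intro!: comm_groupE(3))
  next
    case (4 f g)
    then show ?case using cg by (intro ext) (auto intro!: comm_groupE(4))
  next
    case (5 f)
    then show ?case using cg by (auto simp: fun_eq_iff extensional_def comm_groupE(5))
  next
    case (6 f)
    let ?g = "\<lambda>X\<in>Obj B. inv\<^bsub>HomGrp C (FOb S X) (FOb T X)\<^esub> f X"
    have "?g \<in> carrier (HomGrp (functor_cat B C) S T)"
    proof -
      { fix X Y u assume X: "X \<in> Obj B" "Y \<in> Obj B" "u \<in> arrows B X Y"
        have o: "FOb S X \<in> Obj C" "FOb S Y \<in> Obj C" "FOb T X \<in> Obj C" "FOb T Y \<in> Obj C"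
          and a: "FAr S X Y u \<in> arrows C (FOb S X) (FOb S Y)" "FAr T X Y u \<in> arrows C (FOb T X) (FOb T Y)"
            "f X \<in> arrows C (FOb S X) (FOb T X)" "f Y \<in> arrows C (FOb S Y) (FOb T Y)"
          and n: "Cmp C (FOb S X) (FOb S Y) (FOb T Y) (f Y) (FAr S X Y u)
              = Cmp C (FOb S X) (FOb T X) (FOb T Y) (FAr T X Y u) (f X)"
          using ST 6 X by auto
        have "Cmp C (FOb S X) (FOb S Y) (FOb T Y) (inv\<^bsub>HomGrp C (FOb S Y) (FOb T Y)\<^esub> f Y) (FAr S X Y u)
            = Cmp C (FOb S X) (FOb T X) (FOb T Y) (FAr T X Y u) (inv\<^bsub>HomGrp C (FOb S X) (FOb T X)\<^esub> f X)"
          using group_hom.hom_inv[OF comp_hom_left[OF o(1,2,4) a(1)] a(4)]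
            group_hom.hom_inv[OF comp_hom_right[OF o(1,3,4) a(2)] a(3)] n by simp }
      then show ?thesis using ST 6 by simp
    qed
    moreover have "?g \<otimes>\<^bsub>HomGrp (functor_cat B C) S T\<^esub> f = \<one>\<^bsub>HomGrp (functor_cat B C) S T\<^esub>"
      using 6 cg by (auto simp: comm_group.axioms(2) group.l_inv)
    ultimately show ?case by blast
  qed
next
  note [simp] = nat_trans_def is_functor_def
  fix S T U \<sigma> \<tau> assume ob: "S \<in> Obj (functor_cat B C)" "T \<in> Obj (functor_cat B C)" "U \<in> Obj (functor_cat B C)"
    and ar: "\<sigma> \<in> arrows (functor_cat B C) S T" "\<tau> \<in> arrows (functor_cat B C) T U"
  { fix X Y u assume X: "X \<in> Obj B" "Y \<in> Obj B" "u \<in> arrows B X Y"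
    have o: "FOb S X \<in> Obj C" "FOb S Y \<in> Obj C" "FOb T X \<in> Obj C" "FOb T Y \<in> Obj C" "FOb U X \<in> Obj C" "FOb U Y \<in> Obj C"
      and a: "FAr S X Y u \<in> arrows C (FOb S X) (FOb S Y)" "FAr T X Y u \<in> arrows C (FOb T X) (FOb T Y)"
        "FAr U X Y u \<in> arrows C (FOb U X) (FOb U Y)"
        "\<sigma> X \<in> arrows C (FOb S X) (FOb T X)" "\<sigma> Y \<in> arrows C (FOb S Y) (FOb T Y)"
        "\<tau> X \<in> arrows C (FOb T X) (FOb U X)" "\<tau> Y \<in> arrows C (FOb T Y) (FOb U Y)"
      and n: "Cmp C (FOb S X) (FOb S Y) (FOb T Y) (\<sigma> Y) (FAr S X Y u) = Cmp C (FOb S X) (FOb T X) (FOb T Y) (FAr T X Y u) (\<sigma> X)"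
        "Cmp C (FOb T X) (FOb T Y) (FOb U Y) (\<tau> Y) (FAr T X Y u) = Cmp C (FOb T X) (FOb U X) (FOb U Y) (FAr U X Y u) (\<tau> X)"
      using ob ar X by auto
    have "Cmp C (FOb S X) (FOb S Y) (FOb U Y) (Cmp C (FOb S Y) (FOb T Y) (FOb U Y) (\<tau> Y) (\<sigma> Y)) (FAr S X Y u)
        = Cmp C (FOb S X) (FOb T Y) (FOb U Y) (\<tau> Y) (Cmp C (FOb S X) (FOb T X) (FOb T Y) (FAr T X Y u) (\<sigma> X))"
      unfolding n(1)[symmetric] using o a by (simp add: comp_assoc)
    also have "\<dots> = Cmp C (FOb S X) (FOb T X) (FOb U Y) (Cmp C (FOb T X) (FOb U X) (FOb U Y) (FAr U X Y u) (\<tau> X)) (\<sigma> X)"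
      unfolding n(2)[symmetric] using o a by (simp add: comp_assoc)
    also have "\<dots> = Cmp C (FOb S X) (FOb U X) (FOb U Y) (FAr U X Y u) (Cmp C (FOb S X) (FOb T X) (FOb U X) (\<tau> X) (\<sigma> X))"
      using o a by (simp add: comp_assoc)
    finally have "Cmp C (FOb S X) (FOb S Y) (FOb U Y) (Cmp C (FOb S Y) (FOb T Y) (FOb U Y) (\<tau> Y) (\<sigma> Y)) (FAr S X Y u)
        = Cmp C (FOb S X) (FOb U X) (FOb U Y) (FAr U X Y u) (Cmp C (FOb S X) (FOb T X) (FOb U X) (\<tau> X) (\<sigma> X))" . }
  then show "Cmp (functor_cat B C) S T U \<tau> \<sigma> \<in> arrows (functor_cat B C) S U"
    using ob ar by auto
next
  note [simp] = nat_trans_def is_functor_def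
  fix S assume "S \<in> Obj (functor_cat B C)"
  then show "Ident (functor_cat B C) S \<in> arrows (functor_cat B C) S S" by auto
qed (auto simp: is_functor_def nat_trans_def comp_assoc comp_add_left comp_add_right fun_eq_iff extensional_def)

section \<open>Natural transformations of presheaves\<close>

lemma preadditive_presheaf_cat: "preadditive_category (presheaf_cat C)"
  unfolding presheaf_cat_def
  by (rule preadditive_category.preadditive_functor_cat[OF preadditive_Ab])

lemma preadditive_fp: "preadditive_category (fp C)"
  unfolding fp_def by (rule preadditive_full_subcat[OF preadditive_presheaf_cat])

lemma preadditive_fp0: "preadditive_category (fp0 C)"
  unfolding fp0_def by (rule preadditive_full_subcat[OF preadditive_fp])

lemma fp_simps [simp]:
  "Obj (fp C) = {F. finitely_presented C F}"
  "HomGrp (fp C) = HomGrp (presheaf_cat C)"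
  "Cmp (fp C) = Cmp (presheaf_cat C)"
  "Ident (fp C) = Ident (presheaf_cat C)"
  by (auto simp: fp_def finitely_presented_def)

lemma fp0_simps [simp]:
  "Obj (fp0 C) = {F. finitely_presented C F \<and> (\<forall>P. projective C P \<longrightarrow> trivial_group (FOb F P))}"
  "HomGrp (fp0 C) = HomGrp (presheaf_cat C)"
  "Cmp (fp0 C) = Cmp (presheaf_cat C)"
  "Ident (fp0 C) = Ident (presheaf_cat C)"
  by (auto simp: fp0_def)

abbreviation sections :: "('o, 'u) presheaf \<Rightarrow> 'o \<Rightarrow> 'u set" where
  "sections F X \<equiv> carrier (FOb F X)"

lemma presheafI:
  assumes "\<And>X. X \<in> Obj C \<Longrightarrow> comm_group (FOb F X)"
    and "\<And>X Y f. \<lbrakk>X \<in> Obj C; Y \<in> Obj C; f \<in> arrows C X Y\<rbrakk> \<Longrightarrow> FAr F Y X f \<in> hom (FOb F Y) (FOb F X)"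
    and "\<And>X Y f. \<lbrakk>X \<in> Obj C; Y \<in> Obj C; f \<in> arrows C X Y\<rbrakk> \<Longrightarrow> FAr F Y X f \<in> extensional (sections F Y)"
    and "\<And>X z. \<lbrakk>X \<in> Obj C; z \<in> sections F X\<rbrakk> \<Longrightarrow> FAr F X X (Ident C X) z = z"
    and "\<And>X Y Z f g z. \<lbrakk>X \<in> Obj C; Y \<in> Obj C; Z \<in> Obj C; f \<in> arrows C X Y; g \<in> arrows C Y Z; z \<in> sections F Z\<rbrakk>
      \<Longrightarrow> FAr F Z X (Cmp C X Y Z g f) z = FAr F Y X f (FAr F Z Y g z)"
    and cl: "\<And>X Y Z f g. \<lbrakk>X \<in> Obj C; Y \<in> Obj C; Z \<in> Obj C; f \<in> arrows C X Y; g \<in> arrows C Y Z\<rbrakk> \<Longrightarrow> Cmp C X Y Z g f \<in> arrows C X Z"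
    and id: "\<And>X. X \<in> Obj C \<Longrightarrow> Ident C X \<in> arrows C X X"
  shows "F \<in> Obj (presheaf_cat C)"
proof -
  have "FAr F X X (Ident C X) = (\<lambda>z\<in>sections F X. z)" if "X \<in> Obj C" for X
    using assms(3)[of X X "Ident C X"] assms(4) id that by (auto simp: fun_eq_iff extensional_def)
  moreover have "FAr F Z X (Cmp C X Y Z g f) = compose (sections F Z) (FAr F Y X f) (FAr F Z Y g)"
    if "X \<in> Obj C" "Y \<in> Obj C" "Z \<in> Obj C" "f \<in> arrows C X Y" "g \<in> arrows C Y Z" for X Y Z f g
    using assms(3)[of X Z "Cmp C X Y Z g f"] assms(5) cl that by (auto simp: fun_eq_iff compose_def extensional_def)
  ultimately show ?thesis
    using assms(1-3) by (simp add: presheaf_cat_def is_functor_def)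
qed

lemma presheafD:
  assumes "F \<in> Obj (presheaf_cat C)"
  shows presheaf_group: "X \<in> Obj C \<Longrightarrow> comm_group (FOb F X)"
    and presheaf_hom: "\<lbrakk>X \<in> Obj C; Y \<in> Obj C; f \<in> arrows C X Y\<rbrakk> \<Longrightarrow> FAr F Y X f \<in> hom (FOb F Y) (FOb F X)"
    and presheaf_id: "\<lbrakk>X \<in> Obj C; z \<in> sections F X\<rbrakk> \<Longrightarrow> FAr F X X (Ident C X) z = z"
    and presheaf_comp: "\<lbrakk>X \<in> Obj C; Y \<in> Obj C; Z \<in> Obj C; f \<in> arrows C X Y; g \<in> arrows C Y Z; z \<in> sections F Z\<rbrakk>
      \<Longrightarrow> FAr F Z X (Cmp C X Y Z g f) z = FAr F Y X f (FAr F Z Y g z)"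
  using assms by (simp_all add: presheaf_cat_def is_functor_def compose_def)

lemma presheaf_closed:
  "\<lbrakk>F \<in> Obj (presheaf_cat C); X \<in> Obj C; Y \<in> Obj C; f \<in> arrows C X Y; z \<in> sections F Y\<rbrakk>
    \<Longrightarrow> FAr F Y X f z \<in> sections F X"
  by (meson hom_in_carrier presheaf_hom)

lemma presheaf_group_hom:
  assumes "F \<in> Obj (presheaf_cat C)" "X \<in> Obj C" "Y \<in> Obj C" "f \<in> arrows C X Y"
  shows "group_hom (FOb F Y) (FOb F X) (FAr F Y X f)"
  using presheafD[OF assms(1)] assms(2-)
  by (simp add: group_hom_def group_hom_axioms_def comm_group.axioms)

lemma nat_iff:
  assumes F: "F \<in> Obj (presheaf_cat C)" and G: "G \<in> Obj (presheaf_cat C)"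
  shows "\<alpha> \<in> arrows (presheaf_cat C) F G \<longleftrightarrow> \<alpha> \<in> extensional (Obj C) \<and>
    (\<forall>X\<in>Obj C. \<alpha> X \<in> hom (FOb F X) (FOb G X) \<and> \<alpha> X \<in> extensional (sections F X)) \<and>
    (\<forall>X\<in>Obj C. \<forall>Y\<in>Obj C. \<forall>f\<in>arrows C X Y. \<forall>z\<in>sections F Y. \<alpha> X (FAr F Y X f z) = FAr G Y X f (\<alpha> Y z))"
proof -
  have "compose (sections F Y) (\<alpha> X) (FAr F Y X f) = compose (sections F Y) (FAr G Y X f) (\<alpha> Y)
    \<longleftrightarrow> (\<forall>z\<in>sections F Y. \<alpha> X (FAr F Y X f z) = FAr G Y X f (\<alpha> Y z))" for X Y f
    by (auto simp: compose_def fun_eq_iff)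
  then show ?thesis by (auto simp: presheaf_cat_def nat_trans_def)
qed

text \<open>
  Extensional in the object and in the section, which is what arrows of a functor category with
  values in \<open>Ab\<close> have to be.
\<close>

definition mk_nat :: "('o, 'u) acat \<Rightarrow> ('o, 'u) presheaf \<Rightarrow> ('o \<Rightarrow> 'u \<Rightarrow> 'u) \<Rightarrow> 'o \<Rightarrow> 'u \<Rightarrow> 'u" where
  "mk_nat C F t = (\<lambda>X\<in>Obj C. \<lambda>z\<in>sections F X. t X z)"

lemma mk_nat_apply [simp]: "\<lbrakk>X \<in> Obj C; z \<in> sections F X\<rbrakk> \<Longrightarrow> mk_nat C F t X z = t X z"
  by (simp add: mk_nat_def)

lemma mk_natI:
  assumes F: "F \<in> Obj (presheaf_cat C)" and G: "G \<in> Obj (presheaf_cat C)"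
    and "\<And>X z. \<lbrakk>X \<in> Obj C; z \<in> sections F X\<rbrakk> \<Longrightarrow> t X z \<in> sections G X"
    and "\<And>X z z'. \<lbrakk>X \<in> Obj C; z \<in> sections F X; z' \<in> sections F X\<rbrakk>
      \<Longrightarrow> t X (z \<otimes>\<^bsub>FOb F X\<^esub> z') = t X z \<otimes>\<^bsub>FOb G X\<^esub> t X z'"
    and "\<And>X Y f z. \<lbrakk>X \<in> Obj C; Y \<in> Obj C; f \<in> arrows C X Y; z \<in> sections F Y\<rbrakk>
      \<Longrightarrow> t X (FAr F Y X f z) = FAr G Y X f (t Y z)"
  shows "mk_nat C F t \<in> arrows (presheaf_cat C) F G"
  unfolding nat_iff[OF F G] using assms presheaf_closed[OF F] presheaf_group[OF F]
  by (auto simp: mk_nat_def hom_def Pi_iff comm_groupE(1))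

lemma nat_hom:
  assumes "F \<in> Obj (presheaf_cat C)" "G \<in> Obj (presheaf_cat C)" "\<alpha> \<in> arrows (presheaf_cat C) F G" "X \<in> Obj C"
  shows "group_hom (FOb F X) (FOb G X) (\<alpha> X)"
  using assms presheaf_group[OF assms(1,4)] presheaf_group[OF assms(2,4)] by (auto simp: nat_iff group_hom_def group_hom_axioms_def comm_group.axioms)

lemma nat_closed:
  assumes "F \<in> Obj (presheaf_cat C)" "G \<in> Obj (presheaf_cat C)" "\<alpha> \<in> arrows (presheaf_cat C) F G" "X \<in> Obj C"
    "z \<in> sections F X"
  shows "\<alpha> X z \<in> sections G X"
  using group_hom.hom_closed[OF nat_hom[OF assms(1-4)] assms(5)] .

lemma nat_natural:
  assumes "F \<in> Obj (presheaf_cat C)" "G \<in> Obj (presheaf_cat C)" "\<alpha> \<in> arrows (presheaf_cat C) F G"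
    "X \<in> Obj C" "Y \<in> Obj C" "f \<in> arrows C X Y" "z \<in> sections F Y"
  shows "\<alpha> X (FAr F Y X f z) = FAr G Y X f (\<alpha> Y z)"
  using assms by (auto simp: nat_iff)

lemma nat_eqI:
  assumes F: "F \<in> Obj (presheaf_cat C)" and G: "G \<in> Obj (presheaf_cat C)"
    and a: "\<alpha> \<in> arrows (presheaf_cat C) F G" and b: "\<beta> \<in> arrows (presheaf_cat C) F G"
    and eq: "\<And>X z. \<lbrakk>X \<in> Obj C; z \<in> sections F X\<rbrakk> \<Longrightarrow> \<alpha> X z = \<beta> X z"
  shows "\<alpha> = \<beta>"
proof (rule extensionalityI[of _ "Obj C"])
  show "\<alpha> \<in> extensional (Obj C)" "\<beta> \<in> extensional (Obj C)" using a b F G by (auto simp: nat_iff)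
  fix X assume X: "X \<in> Obj C"
  show "\<alpha> X = \<beta> X"
    by (rule extensionalityI[of _ "sections F X"]) (use a b F G X eq in \<open>auto simp: nat_iff\<close>)
qed

lemma psh_comp_apply [simp]:
  "\<lbrakk>X \<in> Obj C; z \<in> sections F X\<rbrakk> \<Longrightarrow> Cmp (presheaf_cat C) F G H \<beta> \<alpha> X z = \<beta> X (\<alpha> X z)"
  by (simp add: presheaf_cat_def compose_def)

lemma psh_zero_apply [simp]:
  "\<lbrakk>X \<in> Obj C; z \<in> sections F X\<rbrakk> \<Longrightarrow> zero_arr (presheaf_cat C) F G X z = \<one>\<^bsub>FOb G X\<^esub>"
  by (simp add: presheaf_cat_def)

lemma psh_ident_apply [simp]:
  "\<lbrakk>X \<in> Obj C; z \<in> sections F X\<rbrakk> \<Longrightarrow> Ident (presheaf_cat C) F X z = z"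
  by (simp add: presheaf_cat_def)

lemmas psh_comp_closed = preadditive_category.comp_closed[OF preadditive_presheaf_cat]
lemmas psh_zero_closed = preadditive_category.zero_closed[OF preadditive_presheaf_cat]
lemmas psh_ident_closed = preadditive_category.ident_closed[OF preadditive_presheaf_cat]

lemma psh_mult_apply [simp]:
  "\<lbrakk>X \<in> Obj C; z \<in> sections F X\<rbrakk>
    \<Longrightarrow> (\<alpha> \<otimes>\<^bsub>HomGrp (presheaf_cat C) F G\<^esub> \<beta>) X z = \<alpha> X z \<otimes>\<^bsub>FOb G X\<^esub> \<beta> X z"
  by (simp add: presheaf_cat_def)

lemma presheaf_surjE:
  assumes "presheaf_surj C F G \<alpha>" "X \<in> Obj C" "w \<in> sections G X"
  obtains z where "z \<in> sections F X" "w = \<alpha> X z"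
proof -
  have "w \<in> \<alpha> X ` sections F X" using assms by (simp add: presheaf_surj_def)
  then show ?thesis using that by blast
qed

text \<open>
  Preimages under \<open>\<pi>\<close> can be chosen section by section: the assumption on kernels makes the result
  independent of the choice, and this independence yields additivity and naturality.
\<close>

lemma factor_through_surj:
  assumes F: "F \<in> Obj (presheaf_cat C)" and G: "G \<in> Obj (presheaf_cat C)" and H: "H \<in> Obj (presheaf_cat C)"
    and p: "\<pi> \<in> arrows (presheaf_cat C) F G" and s: "presheaf_surj C F G \<pi>"
    and a: "\<alpha> \<in> arrows (presheaf_cat C) F H"
    and k: "\<And>X z. \<lbrakk>X \<in> Obj C; z \<in> sections F X; \<pi> X z = \<one>\<^bsub>FOb G X\<^esub>\<rbrakk> \<Longrightarrow> \<alpha> X z = \<one>\<^bsub>FOb H X\<^esub>"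
  obtains \<beta> where "\<beta> \<in> arrows (presheaf_cat C) G H" "Cmp (presheaf_cat C) F G H \<beta> \<pi> = \<alpha>"
    "\<And>X z. \<lbrakk>X \<in> Obj C; z \<in> sections F X\<rbrakk> \<Longrightarrow> \<beta> X (\<pi> X z) = \<alpha> X z"
proof -
  define pre where "pre X w = (SOME z. z \<in> sections F X \<and> \<pi> X z = w)" for X w
  have pre: "pre X w \<in> sections F X" "\<pi> X (pre X w) = w" if "X \<in> Obj C" "w \<in> sections G X" for X w
  proof -
    have "\<exists>z. z \<in> sections F X \<and> \<pi> X z = w" using s that unfolding presheaf_surj_def by (metis imageE)
    then show "pre X w \<in> sections F X" "\<pi> X (pre X w) = w" unfolding pre_def by (metis (mono_tags, lifting) someI_ex)+
  qed
  have ker: "\<alpha> X z = \<alpha> X z'" if X: "X \<in> Obj C" and z: "z \<in> sections F X" "z' \<in> sections F X" and eq: "\<pi> X z = \<pi> X z'" for X z z'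
  proof -
    interpret p: group_hom "FOb F X" "FOb G X" "\<pi> X" using nat_hom[OF F G p X] .
    interpret a: group_hom "FOb F X" "FOb H X" "\<alpha> X" using nat_hom[OF F H a X] .
    have "\<pi> X (z \<otimes>\<^bsub>FOb F X\<^esub> inv\<^bsub>FOb F X\<^esub> z') = \<one>\<^bsub>FOb G X\<^esub>" using z eq by simp
    then have "\<alpha> X z \<otimes>\<^bsub>FOb H X\<^esub> inv\<^bsub>FOb H X\<^esub> \<alpha> X z' = \<one>\<^bsub>FOb H X\<^esub>"
      using k[OF X, of "z \<otimes>\<^bsub>FOb F X\<^esub> inv\<^bsub>FOb F X\<^esub> z'"] z by simp
    then show ?thesis using comm_group_diff_one_iff[OF presheaf_group[OF H X]] z by simp
  qed
  let ?b = "mk_nat C G (\<lambda>X w. \<alpha> X (pre X w))"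
  have b: "?b X (\<pi> X z) = \<alpha> X z" if X: "X \<in> Obj C" and z: "z \<in> sections F X" for X z
    using ker[OF X _ z] pre[OF X] nat_closed[OF F G p X z] X by simp
  have arr: "?b \<in> arrows (presheaf_cat C) G H"
  proof (rule mk_natI[OF G H])
    fix X z z' assume X: "X \<in> Obj C" and z: "z \<in> sections G X" "z' \<in> sections G X"
    interpret p: group_hom "FOb F X" "FOb G X" "\<pi> X" using nat_hom[OF F G p X] .
    interpret a: group_hom "FOb F X" "FOb H X" "\<alpha> X" using nat_hom[OF F H a X] .
    show "\<alpha> X (pre X z) \<in> sections H X" using pre[OF X] z by simp
    have "\<alpha> X (pre X (z \<otimes>\<^bsub>FOb G X\<^esub> z')) = \<alpha> X (pre X z \<otimes>\<^bsub>FOb F X\<^esub> pre X z')"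
      using pre[OF X] z by (intro ker[OF X]) auto
    then show "\<alpha> X (pre X (z \<otimes>\<^bsub>FOb G X\<^esub> z')) = \<alpha> X (pre X z) \<otimes>\<^bsub>FOb H X\<^esub> \<alpha> X (pre X z')"
      using pre[OF X] z by simp
  next
    fix X Y f z assume X: "X \<in> Obj C" "Y \<in> Obj C" "f \<in> arrows C X Y" and z: "z \<in> sections G Y"
    have "\<alpha> X (pre X (FAr G Y X f z)) = \<alpha> X (FAr F Y X f (pre Y z))"
      using pre[OF X(1)] pre[OF X(2) z] presheaf_closed[OF G X z] presheaf_closed[OF F X] nat_natural[OF F G p X]
      by (intro ker[OF X(1)]) auto
    then show "\<alpha> X (pre X (FAr G Y X f z)) = FAr H Y X f (\<alpha> Y (pre Y z))"
      using nat_natural[OF F H a X] pre[OF X(2) z] by simp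
  qed
  have "Cmp (presheaf_cat C) F G H ?b \<pi> = \<alpha>"
    by (rule nat_eqI[OF F H psh_comp_closed[OF F G H p arr] a]) (simp add: b)
  then show ?thesis using that arr b by blast
qed

lemma factor_through_inj:
  assumes F: "F \<in> Obj (presheaf_cat C)" and G: "G \<in> Obj (presheaf_cat C)" and H: "H \<in> Obj (presheaf_cat C)"
    and i: "\<iota> \<in> arrows (presheaf_cat C) G H" and j: "presheaf_inj C G \<iota>"
    and a: "\<alpha> \<in> arrows (presheaf_cat C) F H"
    and k: "\<And>X z. \<lbrakk>X \<in> Obj C; z \<in> sections F X\<rbrakk> \<Longrightarrow> \<alpha> X z \<in> \<iota> X ` sections G X"
  obtains \<beta> where "\<beta> \<in> arrows (presheaf_cat C) F G" "Cmp (presheaf_cat C) F G H \<iota> \<beta> = \<alpha>"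
    "\<And>X z. \<lbrakk>X \<in> Obj C; z \<in> sections F X\<rbrakk> \<Longrightarrow> \<iota> X (\<beta> X z) = \<alpha> X z"
proof -
  let ?b = "mk_nat C F (\<lambda>X z. inv_into (sections G X) (\<iota> X) (\<alpha> X z))"
  have cl: "inv_into (sections G X) (\<iota> X) (\<alpha> X z) \<in> sections G X"
    and ib: "\<iota> X (inv_into (sections G X) (\<iota> X) (\<alpha> X z)) = \<alpha> X z" if "X \<in> Obj C" "z \<in> sections F X" for X z
    using k[OF that] by (auto simp: inv_into_into f_inv_into_f)
  have inj: "w = w'" if "X \<in> Obj C" "w \<in> sections G X" "w' \<in> sections G X" "\<iota> X w = \<iota> X w'" for X w w'
    using j that by (auto simp: presheaf_inj_def inj_on_def)
  have arr: "?b \<in> arrows (presheaf_cat C) F G"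
  proof (rule mk_natI[OF F G])
    fix X z z' assume X: "X \<in> Obj C" and z: "z \<in> sections F X" "z' \<in> sections F X"
    interpret i: group_hom "FOb G X" "FOb H X" "\<iota> X" using nat_hom[OF G H i X] .
    interpret a: group_hom "FOb F X" "FOb H X" "\<alpha> X" using nat_hom[OF F H a X] .
    show "inv_into (sections G X) (\<iota> X) (\<alpha> X z) \<in> sections G X" using cl X z by simp
    show "inv_into (sections G X) (\<iota> X) (\<alpha> X (z \<otimes>\<^bsub>FOb F X\<^esub> z'))
        = inv_into (sections G X) (\<iota> X) (\<alpha> X z) \<otimes>\<^bsub>FOb G X\<^esub> inv_into (sections G X) (\<iota> X) (\<alpha> X z')"
    proof (rule inj[OF X])
      have zz: "z \<otimes>\<^bsub>FOb F X\<^esub> z' \<in> sections F X" using z by simp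
      show "inv_into (sections G X) (\<iota> X) (\<alpha> X (z \<otimes>\<^bsub>FOb F X\<^esub> z')) \<in> sections G X" by (rule cl[OF X zz])
      show "inv_into (sections G X) (\<iota> X) (\<alpha> X z) \<otimes>\<^bsub>FOb G X\<^esub> inv_into (sections G X) (\<iota> X) (\<alpha> X z') \<in> sections G X"
        using cl[OF X] z by simp
      show "\<iota> X (inv_into (sections G X) (\<iota> X) (\<alpha> X (z \<otimes>\<^bsub>FOb F X\<^esub> z')))
        = \<iota> X (inv_into (sections G X) (\<iota> X) (\<alpha> X z) \<otimes>\<^bsub>FOb G X\<^esub> inv_into (sections G X) (\<iota> X) (\<alpha> X z'))"
        unfolding ib[OF X zz] using cl[OF X] ib[OF X] z by simp
    qed
  next
    fix X Y f z assume X: "X \<in> Obj C" "Y \<in> Obj C" "f \<in> arrows C X Y" and z: "z \<in> sections F Y"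
    have fz: "FAr F Y X f z \<in> sections F X" by (rule presheaf_closed[OF F X z])
    show "inv_into (sections G X) (\<iota> X) (\<alpha> X (FAr F Y X f z)) = FAr G Y X f (inv_into (sections G Y) (\<iota> Y) (\<alpha> Y z))"
    proof (rule inj[OF X(1) cl[OF X(1) fz] presheaf_closed[OF G X cl[OF X(2) z]]])
      show "\<iota> X (inv_into (sections G X) (\<iota> X) (\<alpha> X (FAr F Y X f z)))
        = \<iota> X (FAr G Y X f (inv_into (sections G Y) (\<iota> Y) (\<alpha> Y z)))"
        unfolding ib[OF X(1) fz] nat_natural[OF G H i X cl[OF X(2) z]] ib[OF X(2) z]
        by (rule nat_natural[OF F H a X z])
    qed
  qed
  have "Cmp (presheaf_cat C) F G H \<iota> ?b = \<alpha>"
    by (rule nat_eqI[OF F H psh_comp_closed[OF F G H arr i] a]) (simp add: ib)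
  then show ?thesis using that arr ib by simp
qed

lemma isomorphic_pointwise:
  assumes F: "F \<in> Obj (presheaf_cat C)" and G: "G \<in> Obj (presheaf_cat C)"
    and a: "\<alpha> \<in> arrows (presheaf_cat C) F G" and "presheaf_inj C F \<alpha>" "presheaf_surj C F G \<alpha>"
  obtains \<beta> where "\<beta> \<in> arrows (presheaf_cat C) G F"
    "Cmp (presheaf_cat C) F G F \<beta> \<alpha> = Ident (presheaf_cat C) F" "Cmp (presheaf_cat C) G F G \<alpha> \<beta> = Ident (presheaf_cat C) G"
proof -
  have "Ident (presheaf_cat C) F X z = \<one>\<^bsub>FOb F X\<^esub>" if X: "X \<in> Obj C" and z: "z \<in> sections F X" and e: "\<alpha> X z = \<one>\<^bsub>FOb G X\<^esub>" for X z
  proof -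
    interpret a: group_hom "FOb F X" "FOb G X" "\<alpha> X" using nat_hom[OF F G a X] .
    show ?thesis using assms(4) X z e a.hom_one unfolding presheaf_inj_def inj_on_def
      by (metis a.G.one_closed psh_ident_apply)
  qed
  then obtain \<beta> where b: "\<beta> \<in> arrows (presheaf_cat C) G F" "Cmp (presheaf_cat C) F G F \<beta> \<alpha> = Ident (presheaf_cat C) F"
    "\<And>X z. \<lbrakk>X \<in> Obj C; z \<in> sections F X\<rbrakk> \<Longrightarrow> \<beta> X (\<alpha> X z) = Ident (presheaf_cat C) F X z"
    using factor_through_surj[OF F G F a assms(5) psh_ident_closed[OF F]] by blast
  have ab: "\<alpha> X (\<beta> X w) = w" if X: "X \<in> Obj C" and w: "w \<in> sections G X" for X w
  proof -
    obtain z where "z \<in> sections F X" "\<alpha> X z = w" using assms(5) X w by (metis imageE presheaf_surj_def)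
    then show ?thesis using b(3)[OF X] X by auto
  qed
  have "Cmp (presheaf_cat C) G F G \<alpha> \<beta> = Ident (presheaf_cat C) G"
    by (rule nat_eqI[OF G G psh_comp_closed[OF G F G b(1) a] psh_ident_closed[OF G]]) (simp add: ab)
  then show ?thesis using that b by blast
qed

lemma epi_if_surj:
  assumes F: "F \<in> Obj (presheaf_cat C)" and G: "G \<in> Obj (presheaf_cat C)"
    and a: "\<alpha> \<in> arrows (presheaf_cat C) F G" and s: "presheaf_surj C F G \<alpha>"
  shows "epi_arr (presheaf_cat C) F G \<alpha>"
  unfolding epi_arr_def
proof (intro conjI ballI impI F G a)
  fix H u v assume H: "H \<in> Obj (presheaf_cat C)" and u: "u \<in> arrows (presheaf_cat C) G H" and v: "v \<in> arrows (presheaf_cat C) G H"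
    and eq: "Cmp (presheaf_cat C) F G H u \<alpha> = Cmp (presheaf_cat C) F G H v \<alpha>"
  show "u = v"
  proof (rule nat_eqI[OF G H u v])
    fix X w assume X: "X \<in> Obj C" and w: "w \<in> sections G X"
    then obtain z where z: "z \<in> sections F X" "\<alpha> X z = w" using s by (metis imageE presheaf_surj_def)
    then show "u X w = v X w" using fun_cong[OF fun_cong[OF eq], of X z] X by simp
  qed
qed

lemma kernel_if_pointwise:
  assumes K: "K \<in> Obj (presheaf_cat C)" and F: "F \<in> Obj (presheaf_cat C)" and G: "G \<in> Obj (presheaf_cat C)"
    and i: "\<iota> \<in> arrows (presheaf_cat C) K F" and a: "\<alpha> \<in> arrows (presheaf_cat C) F G"
    and j: "presheaf_inj C K \<iota>" and ex: "presheaf_exact C K F G \<iota> \<alpha>"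
  shows "is_kernel (presheaf_cat C) K F G \<iota> \<alpha>"
  unfolding is_kernel_def
proof (intro conjI ballI impI K F G i a)
  have im: "\<iota> X ` sections K X = {z \<in> sections F X. \<alpha> X z = \<one>\<^bsub>FOb G X\<^esub>}" if "X \<in> Obj C" for X
    using ex that by (simp add: presheaf_exact_def kernel_def)
  show "Cmp (presheaf_cat C) K F G \<alpha> \<iota> = zero_arr (presheaf_cat C) K G"
    by (rule nat_eqI[OF K G psh_comp_closed[OF K F G i a] psh_zero_closed[OF K G]]) (use im in auto)
  fix H h assume H: "H \<in> Obj (presheaf_cat C)" and h: "h \<in> arrows (presheaf_cat C) H F"
    and z: "Cmp (presheaf_cat C) H F G \<alpha> h = zero_arr (presheaf_cat C) H G"
  have "h X w \<in> \<iota> X ` sections K X" if X: "X \<in> Obj C" and w: "w \<in> sections H X" for X w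
    using fun_cong[OF fun_cong[OF z], of X w] im[OF X] nat_closed[OF H F h X w] X w by simp
  then obtain u where u: "u \<in> arrows (presheaf_cat C) H K" "Cmp (presheaf_cat C) H K F \<iota> u = h"
    using factor_through_inj[OF H K F i j h] by blast
  show "\<exists>!u. u \<in> arrows (presheaf_cat C) H K \<and> Cmp (presheaf_cat C) H K F \<iota> u = h"
  proof (intro ex1I[of _ u] conjI u)
    fix v assume v: "v \<in> arrows (presheaf_cat C) H K \<and> Cmp (presheaf_cat C) H K F \<iota> v = h"
    show "v = u"
    proof (rule nat_eqI[OF H K _ u(1)])
      show "v \<in> arrows (presheaf_cat C) H K" using v by blast
      fix X w assume X: "X \<in> Obj C" and w: "w \<in> sections H X"
      have "\<iota> X (v X w) = \<iota> X (u X w)" using v u(2) X w psh_comp_apply by metis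
      then show "v X w = u X w" using j X nat_closed[OF H K _ X w] v u(1) by (auto simp: presheaf_inj_def inj_on_def)
    qed
  qed
qed

lemma cokernel_if_pointwise:
  assumes E: "E \<in> Obj (presheaf_cat C)" and F: "F \<in> Obj (presheaf_cat C)" and G: "G \<in> Obj (presheaf_cat C)"
    and a: "\<alpha> \<in> arrows (presheaf_cat C) E F" and b: "\<beta> \<in> arrows (presheaf_cat C) F G"
    and ex: "presheaf_exact C E F G \<alpha> \<beta>" and s: "presheaf_surj C F G \<beta>"
  shows "is_cokernel (presheaf_cat C) E F G \<alpha> \<beta>"
  unfolding is_cokernel_def
proof (intro conjI ballI impI E F G a b)
  have im: "\<alpha> X ` sections E X = {z \<in> sections F X. \<beta> X z = \<one>\<^bsub>FOb G X\<^esub>}" if "X \<in> Obj C" for X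
    using ex that by (simp add: presheaf_exact_def kernel_def)
  show "Cmp (presheaf_cat C) E F G \<beta> \<alpha> = zero_arr (presheaf_cat C) E G"
    by (rule nat_eqI[OF E G psh_comp_closed[OF E F G a b] psh_zero_closed[OF E G]]) (use im in auto)
  fix H h assume H: "H \<in> Obj (presheaf_cat C)" and h: "h \<in> arrows (presheaf_cat C) F H"
    and z: "Cmp (presheaf_cat C) E F H h \<alpha> = zero_arr (presheaf_cat C) E H"
  have "h X w = \<one>\<^bsub>FOb H X\<^esub>" if X: "X \<in> Obj C" and w: "w \<in> sections F X" "\<beta> X w = \<one>\<^bsub>FOb G X\<^esub>" for X w
  proof -
    obtain v where "v \<in> sections E X" "w = \<alpha> X v" using im[OF X] w by blast
    then show ?thesis using fun_cong[OF fun_cong[OF z], of X v] X by simp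
  qed
  then obtain u where u: "u \<in> arrows (presheaf_cat C) G H" "Cmp (presheaf_cat C) F G H u \<beta> = h"
    using factor_through_surj[OF F G H b s h] by metis
  then show "\<exists>!u. u \<in> arrows (presheaf_cat C) G H \<and> Cmp (presheaf_cat C) F G H u \<beta> = h"
    using epi_if_surj[OF F G b s] H unfolding epi_arr_def by metis
qed

section \<open>Representable and finitely presented presheaves\<close>

definition additive_presheaf :: "('o, 'u) acat \<Rightarrow> ('o, 'u) presheaf \<Rightarrow> bool" where
  "additive_presheaf C F \<longleftrightarrow> F \<in> Obj (presheaf_cat C) \<and>
     (\<forall>X\<in>Obj C. \<forall>Y\<in>Obj C. \<forall>f\<in>arrows C X Y. \<forall>f'\<in>arrows C X Y. \<forall>z\<in>sections F Y.
        FAr F Y X (f \<otimes>\<^bsub>HomGrp C X Y\<^esub> f') z = FAr F Y X f z \<otimes>\<^bsub>FOb F X\<^esub> FAr F Y X f' z)"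

definition yoneda_el :: "('o, 'u) acat \<Rightarrow> ('o, 'u) presheaf \<Rightarrow> 'o \<Rightarrow> 'u \<Rightarrow> 'o \<Rightarrow> 'u \<Rightarrow> 'u" where
  "yoneda_el C F B x = mk_nat C (yoneda_ob C B) (\<lambda>X h. FAr F B X h x)"

text \<open>
  A finite presentation read through the Yoneda lemma: the section \<open>x\<close> over \<open>B\<close> is the image of the
  identity of \<open>B\<close>, and \<open>r : R \<rightarrow> B\<close> generates the relations among its restrictions.  Additivity
  is part of the notion because a presheaf is an arbitrary functor on the underlying category.
\<close>

definition presented_by :: "('o, 'u) acat \<Rightarrow> ('o, 'u) presheaf \<Rightarrow> 'o \<Rightarrow> 'o \<Rightarrow> 'u \<Rightarrow> 'u \<Rightarrow> bool" where
  "presented_by C F R B r x \<longleftrightarrow> additive_presheaf C F \<and> R \<in> Obj C \<and> B \<in> Obj C \<and> r \<in> arrows C R B \<and>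
     x \<in> sections F B \<and>
     (\<forall>X\<in>Obj C. \<forall>z\<in>sections F X. \<exists>h\<in>arrows C X B. z = FAr F B X h x) \<and>
     (\<forall>X\<in>Obj C. \<forall>h\<in>arrows C X B. FAr F B X h x = \<one>\<^bsub>FOb F X\<^esub> \<longleftrightarrow> (\<exists>u\<in>arrows C X R. h = Cmp C X R B r u))"

lemma yoneda_ob_simps [simp]:
  "FOb (yoneda_ob C B) X = HomGrp C X B"
  "h \<in> arrows C Y B \<Longrightarrow> FAr (yoneda_ob C B) Y X f h = Cmp C X Y B h f"
  by (simp_all add: yoneda_ob_def)

context preadditive_category
begin

lemma yoneda_presheaf [simp]:
  assumes "B \<in> Obj C"
  shows "yoneda_ob C B \<in> Obj (presheaf_cat C)"
proof (rule presheafI)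
  show "FAr (yoneda_ob C B) Y X f \<in> hom (FOb (yoneda_ob C B) Y) (FOb (yoneda_ob C B) X)"
    if "X \<in> Obj C" "Y \<in> Obj C" "f \<in> arrows C X Y" for X Y f
    using that assms by (auto simp: hom_def comp_add_left)
  show "FAr (yoneda_ob C B) Y X f \<in> extensional (sections (yoneda_ob C B) Y)" for X Y f
    by (simp add: yoneda_ob_def)
qed (use assms hom_group in \<open>auto simp: comp_assoc\<close>)

lemma yoneda_additive [simp]: "B \<in> Obj C \<Longrightarrow> additive_presheaf C (yoneda_ob C B)"
  by (auto simp: additive_presheaf_def comp_add_right)

lemma yoneda_ar_mk_nat: "yoneda_ar C B D g = mk_nat C (yoneda_ob C B) (\<lambda>X h. Cmp C X B D g h)"
  by (simp add: yoneda_ar_def mk_nat_def)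

lemma yoneda_ar_apply [simp]: "\<lbrakk>X \<in> Obj C; h \<in> arrows C X B\<rbrakk> \<Longrightarrow> yoneda_ar C B D g X h = Cmp C X B D g h"
  by (simp add: yoneda_ar_def)

lemma yoneda_ar_arrow [simp]:
  assumes "B \<in> Obj C" "D \<in> Obj C" "g \<in> arrows C B D"
  shows "yoneda_ar C B D g \<in> arrows (presheaf_cat C) (yoneda_ob C B) (yoneda_ob C D)"
  unfolding yoneda_ar_mk_nat
  by (rule mk_natI) (use assms in \<open>auto simp: comp_add_right comp_assoc\<close>)

lemma yoneda_nat_apply:
  assumes F: "F \<in> Obj (presheaf_cat C)" and B: "B \<in> Obj C" and a: "\<alpha> \<in> arrows (presheaf_cat C) (yoneda_ob C B) F"
    and X: "X \<in> Obj C" and h: "h \<in> arrows C X B"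
  shows "\<alpha> X h = FAr F B X h (\<alpha> B (Ident C B))"
  using nat_natural[OF yoneda_presheaf[OF B] F a X B h, of "Ident C B"] B X h by simp

lemma additive_presheafD: "additive_presheaf C F \<Longrightarrow> F \<in> Obj (presheaf_cat C)"
  by (simp add: additive_presheaf_def)

lemma restriction_hom:
  assumes "additive_presheaf C F" "X \<in> Obj C" "Y \<in> Obj C" "z \<in> sections F Y"
  shows "group_hom (HomGrp C X Y) (FOb F X) (\<lambda>f. FAr F Y X f z)"
  using assms hom_group presheaf_group[OF additive_presheafD] presheaf_closed[OF additive_presheafD]
  by (auto simp: group_hom_def group_hom_axioms_def hom_def comm_group.axioms additive_presheaf_def)

lemma yoneda_el_arrow:
  assumes F: "additive_presheaf C F" and B: "B \<in> Obj C" and x: "x \<in> sections F B"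
  shows "yoneda_el C F B x \<in> arrows (presheaf_cat C) (yoneda_ob C B) F"
  unfolding yoneda_el_def
proof (rule mk_natI)
  show "F \<in> Obj (presheaf_cat C)" using F by (rule additive_presheafD)
  note F' = this
  fix X z assume X: "X \<in> Obj C" and z: "z \<in> sections (yoneda_ob C B) X"
  show "FAr F B X z x \<in> sections F X" using presheaf_closed[OF F'] X z B x by simp
qed (use assms in \<open>auto simp: additive_presheaf_def presheaf_comp\<close>)

lemma yoneda_el_apply [simp]:
  "\<lbrakk>X \<in> Obj C; h \<in> arrows C X B\<rbrakk> \<Longrightarrow> yoneda_el C F B x X h = FAr F B X h x"
  by (simp add: yoneda_el_def)

lemma presented_by_imp_fp:
  assumes "presented_by C F R B r x"
  shows "finitely_presented C F"
proof -
  note a = assms[unfolded presented_by_def]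
  have F: "F \<in> Obj (presheaf_cat C)" using a additive_presheafD by blast
  have "presheaf_exact C (yoneda_ob C R) (yoneda_ob C B) F (yoneda_ar C R B r) (yoneda_el C F B x)"
    unfolding presheaf_exact_def kernel_def using a by (auto simp: image_iff)
  moreover have "presheaf_surj C (yoneda_ob C B) F (yoneda_el C F B x)"
    unfolding presheaf_surj_def using a presheaf_closed[OF F] by (auto simp: image_iff)
  moreover have "yoneda_ar C R B r \<in> arrows (presheaf_cat C) (yoneda_ob C R) (yoneda_ob C B)"
    and "yoneda_el C F B x \<in> arrows (presheaf_cat C) (yoneda_ob C B) F"
    using a yoneda_ar_arrow yoneda_el_arrow by simp_all
  ultimately show ?thesis unfolding finitely_presented_def using a F
    by (intro conjI bexI[of _ R] bexI[of _ B] bexI[of _ "yoneda_ar C R B r"] bexI[of _ "yoneda_el C F B x"]) simp_all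
qed

text \<open>
  The functor is additive because every section is the image under \<open>\<pi>\<close> of an arrow \<open>h\<close> into \<open>B\<close>, its
  restriction along \<open>g\<close> is the image of \<open>h g\<close>, and composition is additive in \<open>g\<close>.
\<close>

lemma presented_byI:
  assumes F: "F \<in> Obj (presheaf_cat C)" and R: "R \<in> Obj C" and B: "B \<in> Obj C"
    and r: "\<rho> \<in> arrows (presheaf_cat C) (yoneda_ob C R) (yoneda_ob C B)"
    and p: "\<pi> \<in> arrows (presheaf_cat C) (yoneda_ob C B) F"
    and ex: "presheaf_exact C (yoneda_ob C R) (yoneda_ob C B) F \<rho> \<pi>"
    and s: "presheaf_surj C (yoneda_ob C B) F \<pi>"
  shows "presented_by C F R B (\<rho> R (Ident C R)) (\<pi> B (Ident C B))"
proof -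
  let ?x = "\<pi> B (Ident C B)" and ?r = "\<rho> R (Ident C R)"
  note YB = yoneda_presheaf[OF B] and YR = yoneda_presheaf[OF R]
  have pa: "\<pi> X h = FAr F B X h ?x" if "X \<in> Obj C" "h \<in> arrows C X B" for X h
    using yoneda_nat_apply[OF F B p that] .
  have rr: "?r \<in> arrows C R B" using nat_closed[OF YR YB r R] R by simp
  have ra: "\<rho> X h = Cmp C X R B ?r h" if "X \<in> Obj C" "h \<in> arrows C X R" for X h
    using yoneda_nat_apply[OF YB R r that] rr by simp
  have x: "?x \<in> sections F B" using nat_closed[OF YB F p B] B by simp
  have sur: "\<exists>h\<in>arrows C X B. z = FAr F B X h ?x" if X: "X \<in> Obj C" and z: "z \<in> sections F X" for X z
  proof -
    obtain h where "h \<in> arrows C X B" "z = \<pi> X h" using s X z unfolding presheaf_surj_def by fastforce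
    then show ?thesis using pa X by auto
  qed
  have "additive_presheaf C F" unfolding additive_presheaf_def
  proof (intro conjI ballI F)
    fix X Y f f' z assume X: "X \<in> Obj C" and Y: "Y \<in> Obj C" and f: "f \<in> arrows C X Y" and f': "f' \<in> arrows C X Y"
      and z: "z \<in> sections F Y"
    obtain h where h: "h \<in> arrows C Y B" "z = FAr F B Y h ?x" using sur[OF Y z] by blast
    have c: "FAr F Y X g z = \<pi> X (Cmp C X Y B h g)" if "g \<in> arrows C X Y" for g
      using presheaf_comp[OF F X Y B that h(1) x] pa[OF X, of "Cmp C X Y B h g"] h X Y B that by simp
    interpret p: group_hom "HomGrp C X B" "FOb F X" "\<pi> X" using nat_hom[OF YB F p X] by simp
    show "FAr F Y X (f \<otimes>\<^bsub>HomGrp C X Y\<^esub> f') z = FAr F Y X f z \<otimes>\<^bsub>FOb F X\<^esub> FAr F Y X f' z"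
      using c X Y B f f' h(1) by (simp add: comp_add_right)
  qed
  moreover have "FAr F B X h ?x = \<one>\<^bsub>FOb F X\<^esub> \<longleftrightarrow> (\<exists>u\<in>arrows C X R. h = Cmp C X R B ?r u)"
    if X: "X \<in> Obj C" and h: "h \<in> arrows C X B" for X h
  proof -
    have "\<rho> X ` arrows C X R = {h \<in> arrows C X B. \<pi> X h = \<one>\<^bsub>FOb F X\<^esub>}"
      using ex X by (simp add: presheaf_exact_def kernel_def)
    then have "\<pi> X h = \<one>\<^bsub>FOb F X\<^esub> \<longleftrightarrow> h \<in> \<rho> X ` arrows C X R" using h by auto
    then show ?thesis using pa[OF X h] ra[OF X] by (auto simp: image_iff)
  qed
  ultimately show ?thesis unfolding presented_by_def using R B rr x sur by blast
qed

lemma fp_iff_presented: "finitely_presented C F \<longleftrightarrow> (\<exists>R B r x. presented_by C F R B r x)"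
  using presented_by_imp_fp presented_byI unfolding finitely_presented_def by meson

lemma fp_additive: "finitely_presented C F \<Longrightarrow> additive_presheaf C F"
  unfolding fp_iff_presented presented_by_def by blast

lemma fp_presheaf: "finitely_presented C F \<Longrightarrow> F \<in> Obj (presheaf_cat C)"
  by (simp add: finitely_presented_def)

end

section \<open>Subpresheaves and quotients\<close>

definition subpresheaf :: "('o, 'u) acat \<Rightarrow> ('o, 'u) presheaf \<Rightarrow> ('o \<Rightarrow> 'u set) \<Rightarrow> bool" where
  "subpresheaf C F N \<longleftrightarrow> (\<forall>X\<in>Obj C. subgroup (N X) (FOb F X)) \<and>
     (\<forall>X\<in>Obj C. \<forall>Y\<in>Obj C. \<forall>f\<in>arrows C X Y. \<forall>z\<in>N Y. FAr F Y X f z \<in> N X)"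

text \<open>
  Quotient groups are carried by sets of coset representatives.  Cosets themselves are sets of
  elements and would leave the universe \<open>'u\<close> in which \<open>Ab\<close> lives.
\<close>

definition coset_rep :: "'u monoid \<Rightarrow> 'u set \<Rightarrow> 'u \<Rightarrow> 'u" where
  "coset_rep G N x = (SOME y. y \<in> carrier G \<and> x \<otimes>\<^bsub>G\<^esub> inv\<^bsub>G\<^esub> y \<in> N)"

definition rep_quotient :: "'u monoid \<Rightarrow> 'u set \<Rightarrow> 'u monoid" where
  "rep_quotient G N = \<lparr>carrier = coset_rep G N ` carrier G,
     mult = (\<lambda>x y. coset_rep G N (x \<otimes>\<^bsub>G\<^esub> y)), one = coset_rep G N \<one>\<^bsub>G\<^esub>\<rparr>"

context
  fixes G :: "'u monoid" and N :: "'u set"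
  assumes G: "comm_group G" and N: "subgroup N G"
begin

interpretation comm_group G by (rule G)

lemma coset_rep:
  assumes "x \<in> carrier G"
  shows "coset_rep G N x \<in> carrier G" "x \<otimes>\<^bsub>G\<^esub> inv\<^bsub>G\<^esub> coset_rep G N x \<in> N"
proof -
  have "x \<in> carrier G \<and> x \<otimes>\<^bsub>G\<^esub> inv\<^bsub>G\<^esub> x \<in> N"
    using assms subgroup.one_closed[OF N] by simp
  then have "coset_rep G N x \<in> carrier G \<and> x \<otimes>\<^bsub>G\<^esub> inv\<^bsub>G\<^esub> coset_rep G N x \<in> N"
    unfolding coset_rep_def by (rule someI)
  then show "coset_rep G N x \<in> carrier G" "x \<otimes>\<^bsub>G\<^esub> inv\<^bsub>G\<^esub> coset_rep G N x \<in> N" by auto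
qed

lemma coset_diff_trans:
  assumes "x \<in> carrier G" "y \<in> carrier G" "z \<in> carrier G"
    and "x \<otimes>\<^bsub>G\<^esub> inv\<^bsub>G\<^esub> y \<in> N" "y \<otimes>\<^bsub>G\<^esub> inv\<^bsub>G\<^esub> z \<in> N"
  shows "x \<otimes>\<^bsub>G\<^esub> inv\<^bsub>G\<^esub> z \<in> N"
proof -
  have "(x \<otimes>\<^bsub>G\<^esub> inv\<^bsub>G\<^esub> y) \<otimes>\<^bsub>G\<^esub> (y \<otimes>\<^bsub>G\<^esub> inv\<^bsub>G\<^esub> z) = x \<otimes>\<^bsub>G\<^esub> inv\<^bsub>G\<^esub> z"
    using assms(1-3) by (metis inv_closed inv_solve_left m_assoc m_closed)
  then show ?thesis using subgroup.m_closed[OF N assms(4,5)] by simp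
qed

lemma coset_diff_sym:
  assumes "x \<in> carrier G" "y \<in> carrier G" "x \<otimes>\<^bsub>G\<^esub> inv\<^bsub>G\<^esub> y \<in> N"
  shows "y \<otimes>\<^bsub>G\<^esub> inv\<^bsub>G\<^esub> x \<in> N"
  using subgroup.m_inv_closed[OF N assms(3)] assms(1,2) by (simp add: inv_mult m_comm)

lemma coset_rep_eq_iff:
  assumes "x \<in> carrier G" "y \<in> carrier G"
  shows "coset_rep G N x = coset_rep G N y \<longleftrightarrow> x \<otimes>\<^bsub>G\<^esub> inv\<^bsub>G\<^esub> y \<in> N"
proof
  assume "coset_rep G N x = coset_rep G N y"
  then show "x \<otimes>\<^bsub>G\<^esub> inv\<^bsub>G\<^esub> y \<in> N"
    using coset_rep[OF assms(1)] coset_rep[OF assms(2)] coset_diff_trans coset_diff_sym assms by metis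
next
  assume a: "x \<otimes>\<^bsub>G\<^esub> inv\<^bsub>G\<^esub> y \<in> N"
  have "(w \<in> carrier G \<and> x \<otimes>\<^bsub>G\<^esub> inv\<^bsub>G\<^esub> w \<in> N) = (w \<in> carrier G \<and> y \<otimes>\<^bsub>G\<^esub> inv\<^bsub>G\<^esub> w \<in> N)" for w
    using a assms coset_diff_trans coset_diff_sym by blast
  then show "coset_rep G N x = coset_rep G N y" unfolding coset_rep_def by simp
qed

lemma coset_rep_mult:
  assumes "x \<in> carrier G" "y \<in> carrier G"
  shows "coset_rep G N (coset_rep G N x \<otimes>\<^bsub>G\<^esub> coset_rep G N y) = coset_rep G N (x \<otimes>\<^bsub>G\<^esub> y)"
proof -
  have "(x \<otimes>\<^bsub>G\<^esub> y) \<otimes>\<^bsub>G\<^esub> inv\<^bsub>G\<^esub> (coset_rep G N x \<otimes>\<^bsub>G\<^esub> coset_rep G N y)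
     = (x \<otimes>\<^bsub>G\<^esub> inv\<^bsub>G\<^esub> coset_rep G N x) \<otimes>\<^bsub>G\<^esub> (y \<otimes>\<^bsub>G\<^esub> inv\<^bsub>G\<^esub> coset_rep G N y)"
    using assms coset_rep by (simp add: inv_mult m_ac)
  then have "(x \<otimes>\<^bsub>G\<^esub> y) \<otimes>\<^bsub>G\<^esub> inv\<^bsub>G\<^esub> (coset_rep G N x \<otimes>\<^bsub>G\<^esub> coset_rep G N y) \<in> N"
    using subgroup.m_closed[OF N] coset_rep assms by simp
  then have "coset_rep G N (x \<otimes>\<^bsub>G\<^esub> y) = coset_rep G N (coset_rep G N x \<otimes>\<^bsub>G\<^esub> coset_rep G N y)"
    using coset_rep_eq_iff coset_rep assms by simp
  then show ?thesis ..
qed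

lemma coset_rep_rep: "x \<in> carrier G \<Longrightarrow> coset_rep G N (coset_rep G N x) = coset_rep G N x"
  using coset_rep_mult[of x "\<one>\<^bsub>G\<^esub>"] coset_rep_eq_iff coset_rep coset_diff_sym by metis

lemma rep_quotient_simps [simp]:
  "carrier (rep_quotient G N) = coset_rep G N ` carrier G"
  "x \<otimes>\<^bsub>rep_quotient G N\<^esub> y = coset_rep G N (x \<otimes>\<^bsub>G\<^esub> y)"
  "\<one>\<^bsub>rep_quotient G N\<^esub> = coset_rep G N \<one>\<^bsub>G\<^esub>"
  by (simp_all add: rep_quotient_def)

lemma rep_quotient_group: "comm_group (rep_quotient G N)"
proof (rule comm_groupI, goal_cases)
  case (3 x y z)
  then obtain a b c where abc: "a \<in> carrier G" "b \<in> carrier G" "c \<in> carrier G"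
    "x = coset_rep G N a" "y = coset_rep G N b" "z = coset_rep G N c" by auto
  have "coset_rep G N (coset_rep G N (a \<otimes>\<^bsub>G\<^esub> b) \<otimes>\<^bsub>G\<^esub> coset_rep G N c)
      = coset_rep G N (coset_rep G N a \<otimes>\<^bsub>G\<^esub> coset_rep G N (b \<otimes>\<^bsub>G\<^esub> c))"
    using abc(1-3) by (simp add: coset_rep_mult m_assoc)
  then show ?case using abc by (simp add: coset_rep_mult)
next
  case (5 x)
  then show ?case by (auto simp: coset_rep_mult)
next
  case (6 x)
  then obtain a where "a \<in> carrier G" "x = coset_rep G N a" by auto
  then show ?case by (auto intro!: bexI[of _ "inv\<^bsub>G\<^esub> a"] simp: coset_rep_mult)
qed (auto simp: m_comm coset_rep)

lemma coset_rep_one_iff: "x \<in> carrier G \<Longrightarrow> coset_rep G N x = \<one>\<^bsub>rep_quotient G N\<^esub> \<longleftrightarrow> x \<in> N"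
  using coset_rep_eq_iff[of x "\<one>\<^bsub>G\<^esub>"] by simp

end

context preadditive_category
begin

lemma presheaf_quotient:
  assumes F: "F \<in> Obj (presheaf_cat C)" and N: "subpresheaf C F N"
  obtains Q \<pi> where "Q \<in> Obj (presheaf_cat C)" "\<pi> \<in> arrows (presheaf_cat C) F Q" "presheaf_surj C F Q \<pi>"
    "\<And>X z. \<lbrakk>X \<in> Obj C; z \<in> sections F X\<rbrakk> \<Longrightarrow> \<pi> X z = \<one>\<^bsub>FOb Q X\<^esub> \<longleftrightarrow> z \<in> N X"
proof -
  define rep where "rep X = coset_rep (FOb F X) (N X)" for X
  define Q :: "('o, 'm) presheaf" where "Q = \<lparr>FOb = \<lambda>X. rep_quotient (FOb F X) (N X),
    FAr = \<lambda>Y X f. \<lambda>z\<in>rep Y ` sections F Y. rep X (FAr F Y X f z)\<rparr>"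
  have sg: "subgroup (N X) (FOb F X)" if "X \<in> Obj C" for X using N that by (simp add: subpresheaf_def)
  note cg = presheaf_group[OF F]
  have Qs: "sections Q X = rep X ` sections F X" "\<And>x y. x \<otimes>\<^bsub>FOb Q X\<^esub> y = rep X (x \<otimes>\<^bsub>FOb F X\<^esub> y)" for X
    by (simp_all add: Q_def rep_def rep_quotient_def)
  have rcl: "rep X z \<in> sections F X" if "X \<in> Obj C" "z \<in> sections F X" for X z
    using coset_rep(1)[OF cg sg] that by (simp add: rep_def)
  have req: "rep X z = rep X z' \<longleftrightarrow> z \<otimes>\<^bsub>FOb F X\<^esub> inv\<^bsub>FOb F X\<^esub> z' \<in> N X"
    if "X \<in> Obj C" "z \<in> sections F X" "z' \<in> sections F X" for X z z'
    using coset_rep_eq_iff[OF cg sg] that by (simp add: rep_def)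
  have rmult: "rep X (rep X z \<otimes>\<^bsub>FOb F X\<^esub> rep X z') = rep X (z \<otimes>\<^bsub>FOb F X\<^esub> z')"
    if "X \<in> Obj C" "z \<in> sections F X" "z' \<in> sections F X" for X z z'
    using coset_rep_mult[OF cg sg] that by (simp add: rep_def)
  have rrep: "rep X (rep X z) = rep X z" if "X \<in> Obj C" "z \<in> sections F X" for X z
    using coset_rep_rep[OF cg sg] that by (simp add: rep_def)
  have Qar: "FAr Q Y X f (rep Y z) = rep X (FAr F Y X f z)"
    if X: "X \<in> Obj C" "Y \<in> Obj C" "f \<in> arrows C X Y" "z \<in> sections F Y" for X Y f z
  proof -
    interpret group_hom "FOb F Y" "FOb F X" "FAr F Y X f" using presheaf_group_hom[OF F X(1-3)] .
    have "rep Y z \<otimes>\<^bsub>FOb F Y\<^esub> inv\<^bsub>FOb F Y\<^esub> z \<in> N Y"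
      using req[OF X(2) rcl[OF X(2,4)] X(4)] rrep[OF X(2,4)] by simp
    then have "FAr F Y X f (rep Y z \<otimes>\<^bsub>FOb F Y\<^esub> inv\<^bsub>FOb F Y\<^esub> z) \<in> N X"
      using N X by (simp add: subpresheaf_def)
    then have "rep X (FAr F Y X f (rep Y z)) = rep X (FAr F Y X f z)"
      using req X rcl by simp
    then show ?thesis using X by (simp add: Q_def)
  qed
  have mcl: "z \<otimes>\<^bsub>FOb F X\<^esub> z' \<in> sections F X" if "X \<in> Obj C" "z \<in> sections F X" "z' \<in> sections F X" for X z z'
    using that cg by (simp add: comm_groupE(1))
  have Q: "Q \<in> Obj (presheaf_cat C)"
  proof (rule presheafI)
    show "comm_group (FOb Q X)" if "X \<in> Obj C" for X
      using rep_quotient_group[OF cg sg] that by (simp add: Q_def)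
    fix X Y f assume X: "X \<in> Obj C" "Y \<in> Obj C" "f \<in> arrows C X Y"
    interpret group_hom "FOb F Y" "FOb F X" "FAr F Y X f" using presheaf_group_hom[OF F X] .
    show "FAr Q Y X f \<in> hom (FOb Q Y) (FOb Q X)"
      unfolding hom_def using X by (auto simp: Qs Qar rmult)
    show "FAr Q Y X f \<in> extensional (sections Q Y)" by (simp add: Q_def rep_def rep_quotient_def)
  next
    fix X z assume "X \<in> Obj C" "z \<in> sections Q X"
    then show "FAr Q X X (Ident C X) z = z" by (auto simp: Qs Qar presheaf_id[OF F])
  next
    fix X Y Z f g z assume "X \<in> Obj C" "Y \<in> Obj C" "Z \<in> Obj C" "f \<in> arrows C X Y" "g \<in> arrows C Y Z" "z \<in> sections Q Z"
    then show "FAr Q Z X (Cmp C X Y Z g f) z = FAr Q Y X f (FAr Q Z Y g z)"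
      by (auto simp: Qs Qar presheaf_comp[OF F] presheaf_closed[OF F])
  qed auto
  have pi: "mk_nat C F rep \<in> arrows (presheaf_cat C) F Q"
    by (rule mk_natI[OF F Q]) (auto simp: Qs Qar rmult)
  have "presheaf_surj C F Q (mk_nat C F rep)" by (auto simp: presheaf_surj_def Qs image_iff)
  moreover have "mk_nat C F rep X z = \<one>\<^bsub>FOb Q X\<^esub> \<longleftrightarrow> z \<in> N X" if "X \<in> Obj C" "z \<in> sections F X" for X z
    using coset_rep_one_iff[OF cg sg] that by (simp add: Q_def rep_def)
  ultimately show ?thesis using that Q pi by blast
qed

lemma presheaf_inclusion:
  assumes F: "F \<in> Obj (presheaf_cat C)" and N: "subpresheaf C F N"
  obtains K \<iota> where "K \<in> Obj (presheaf_cat C)" "\<iota> \<in> arrows (presheaf_cat C) K F" "presheaf_inj C K \<iota>"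
    "\<And>X. X \<in> Obj C \<Longrightarrow> sections K X = N X" "\<And>X z. \<lbrakk>X \<in> Obj C; z \<in> N X\<rbrakk> \<Longrightarrow> \<iota> X z = z"
    "\<And>X. \<one>\<^bsub>FOb K X\<^esub> = \<one>\<^bsub>FOb F X\<^esub>" "\<And>X Y f z. z \<in> N Y \<Longrightarrow> FAr K Y X f z = FAr F Y X f z"
    "\<And>X y z. y \<otimes>\<^bsub>FOb K X\<^esub> z = y \<otimes>\<^bsub>FOb F X\<^esub> z"
proof -
  define K :: "('o, 'm) presheaf" where "K = \<lparr>FOb = \<lambda>X. (FOb F X)\<lparr>carrier := N X\<rparr>,
    FAr = \<lambda>Y X f. \<lambda>z\<in>N Y. FAr F Y X f z\<rparr>"
  have Ks [simp]: "sections K X = N X" "y \<otimes>\<^bsub>FOb K X\<^esub> z = y \<otimes>\<^bsub>FOb F X\<^esub> z" "\<one>\<^bsub>FOb K X\<^esub> = \<one>\<^bsub>FOb F X\<^esub>"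
    "w \<in> N Y \<Longrightarrow> FAr K Y X f w = FAr F Y X f w" for X y z Y f w
    by (simp_all add: K_def)
  have sg: "subgroup (N X) (FOb F X)" if "X \<in> Obj C" for X using N that by (simp add: subpresheaf_def)
  have sub: "z \<in> sections F X" if "X \<in> Obj C" "z \<in> N X" for X z using sg[OF that(1)] that subgroup.subset by blast
  have cl: "FAr F Y X f z \<in> N X" if "X \<in> Obj C" "Y \<in> Obj C" "f \<in> arrows C X Y" "z \<in> N Y" for X Y f z
    using N that by (simp add: subpresheaf_def)
  have K: "K \<in> Obj (presheaf_cat C)"
  proof (rule presheafI)
    fix X assume X: "X \<in> Obj C"
    interpret comm_group "FOb F X" using presheaf_group[OF F X] .
    have "group (FOb K X)" using subgroup.subgroup_is_group[OF sg[OF X] is_group] by (simp add: K_def)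
    then show "comm_group (FOb K X)" by (rule group.group_comm_groupI) (use m_comm sub[OF X] in auto)
  next
    fix X Y f assume X: "X \<in> Obj C" "Y \<in> Obj C" "f \<in> arrows C X Y"
    interpret group_hom "FOb F Y" "FOb F X" "FAr F Y X f" using presheaf_group_hom[OF F X] .
    show "FAr K Y X f \<in> hom (FOb K Y) (FOb K X)"
      unfolding hom_def using X cl sub subgroup.m_closed[OF sg[OF X(2)]] by auto
    show "FAr K Y X f \<in> extensional (sections K Y)" by (simp add: K_def)
  qed (auto simp: presheaf_id[OF F] presheaf_comp[OF F] sub cl)
  have i: "mk_nat C K (\<lambda>X z. z) \<in> arrows (presheaf_cat C) K F"
    by (rule mk_natI[OF K F]) (auto simp: sub)
  show ?thesis using that[OF K i] by (auto simp: presheaf_inj_def inj_on_def)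
qed

end

section \<open>Finite presentation over an abelian category\<close>

context preadditive_category
begin

lemma biproduct_maps:
  assumes b: "is_biproduct C X Y S i j p q" and [simp]: "X \<in> Obj C" "Y \<in> Obj C"
  shows "S \<in> Obj C" "i \<in> arrows C X S" "j \<in> arrows C Y S" "p \<in> arrows C S X" "q \<in> arrows C S Y"
    and "\<lbrakk>W \<in> Obj C; u \<in> arrows C W X; v \<in> arrows C W Y\<rbrakk>
      \<Longrightarrow> Cmp C W S X p (Cmp C W X S i u \<otimes>\<^bsub>HomGrp C W S\<^esub> Cmp C W Y S j v) = u"
    and "\<lbrakk>W \<in> Obj C; u \<in> arrows C W X; v \<in> arrows C W Y\<rbrakk>
      \<Longrightarrow> Cmp C W S Y q (Cmp C W X S i u \<otimes>\<^bsub>HomGrp C W S\<^esub> Cmp C W Y S j v) = v"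
proof -
  show [simp]: "S \<in> Obj C" "i \<in> arrows C X S" "j \<in> arrows C Y S" "p \<in> arrows C S X" "q \<in> arrows C S Y"
    using b by (auto simp: is_biproduct_def)
  have [simp]: "Cmp C X S X p i = Ident C X" "Cmp C Y S Y q j = Ident C Y"
    "Cmp C Y S X p j = zero_arr C Y X" "Cmp C X S Y q i = zero_arr C X Y"
    using b by (auto simp: is_biproduct_def)
  assume [simp]: "W \<in> Obj C" "u \<in> arrows C W X" "v \<in> arrows C W Y"
  interpret X: comm_group "HomGrp C W X" by (simp add: hom_group)
  interpret Y: comm_group "HomGrp C W Y" by (simp add: hom_group)
  show "Cmp C W S X p (Cmp C W X S i u \<otimes>\<^bsub>HomGrp C W S\<^esub> Cmp C W Y S j v) = u"
    by (simp add: comp_add_right comp_assoc)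
  show "Cmp C W S Y q (Cmp C W X S i u \<otimes>\<^bsub>HomGrp C W S\<^esub> Cmp C W Y S j v) = v"
    by (simp add: comp_add_right comp_assoc)
qed

end

context abelian_category
begin

text \<open>
  This adds relations to a presentation.  The arrow \<open>r\<close> is the one out of the biproduct of \<open>B\<close> and
  \<open>D\<close> with components \<open>b\<close> and \<open>c\<close>.
\<close>

lemma joint_image:
  assumes [simp]: "B \<in> Obj C" "D \<in> Obj C" "A \<in> Obj C" "b \<in> arrows C B A" "c \<in> arrows C D A"
  obtains S r where "S \<in> Obj C" "r \<in> arrows C S A"
    "\<And>X h. \<lbrakk>X \<in> Obj C; h \<in> arrows C X A\<rbrakk> \<Longrightarrow> (\<exists>u\<in>arrows C X S. h = Cmp C X S A r u) \<longleftrightarrow>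
      (\<exists>u\<in>arrows C X B. \<exists>v\<in>arrows C X D. h = Cmp C X B A b u \<otimes>\<^bsub>HomGrp C X A\<^esub> Cmp C X D A c v)"
proof -
  obtain S i j p q where bp: "is_biproduct C B D S i j p q" using ex_biproduct[of B D] by auto
  note m = biproduct_maps[OF bp assms(1,2)]
  note m(1-5)[simp]
  let ?r = "Cmp C S B A b p \<otimes>\<^bsub>HomGrp C S A\<^esub> Cmp C S D A c q"
  have ru: "Cmp C X S A ?r u = Cmp C X B A b (Cmp C X S B p u) \<otimes>\<^bsub>HomGrp C X A\<^esub> Cmp C X D A c (Cmp C X S D q u)"
    if "X \<in> Obj C" "u \<in> arrows C X S" for X u
    using that by (simp add: comp_add_left comp_assoc)
  show ?thesis
  proof (rule that[of S ?r])
    fix X h assume [simp]: "X \<in> Obj C" "h \<in> arrows C X A"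
    show "(\<exists>u\<in>arrows C X S. h = Cmp C X S A ?r u) \<longleftrightarrow>
      (\<exists>u\<in>arrows C X B. \<exists>v\<in>arrows C X D. h = Cmp C X B A b u \<otimes>\<^bsub>HomGrp C X A\<^esub> Cmp C X D A c v)" (is "?L \<longleftrightarrow> ?R")
    proof
      assume ?L
      then show ?R using ru by (metis \<open>X \<in> Obj C\<close> assms(1,2) comp_closed m(1,4,5))
    next
      assume ?R
      then obtain u v where uv [simp]: "u \<in> arrows C X B" "v \<in> arrows C X D"
        and h: "h = Cmp C X B A b u \<otimes>\<^bsub>HomGrp C X A\<^esub> Cmp C X D A c v" by blast
      show ?L by (rule bexI[of _ "Cmp C X B S i u \<otimes>\<^bsub>HomGrp C X S\<^esub> Cmp C X D S j v"])
        (simp_all add: ru m(6,7) h)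
    qed
  qed auto
qed

text \<open>
  Here \<open>r\<close> is the pullback of \<open>b\<close> along \<open>c\<close>, obtained from the kernel of the difference of the two
  maps on the biproduct.  It describes the relations of a section in terms of those of a generator.
\<close>

lemma image_preimage:
  assumes [simp]: "B \<in> Obj C" "D \<in> Obj C" "A \<in> Obj C" "b \<in> arrows C B A" "c \<in> arrows C D A"
  obtains S r where "S \<in> Obj C" "r \<in> arrows C S D"
    "\<And>X h. \<lbrakk>X \<in> Obj C; h \<in> arrows C X D\<rbrakk> \<Longrightarrow> (\<exists>u\<in>arrows C X S. h = Cmp C X S D r u) \<longleftrightarrow>
      (\<exists>v\<in>arrows C X B. Cmp C X D A c h = Cmp C X B A b v)"
proof -
  obtain T i j p q where bp: "is_biproduct C D B T i j p q" using ex_biproduct[of D B] by auto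
  note m = biproduct_maps[OF bp assms(2,1)]
  note m(1-5)[simp]
  let ?f = "sub_arr C T A (Cmp C T D A c p) (Cmp C T B A b q)"
  obtain S k where k: "is_kernel C S T A k ?f" using ex_kernel[of T A ?f] by auto
  then have [simp]: "S \<in> Obj C" "k \<in> arrows C S T" by (auto simp: is_kernel_def)
  have f: "Cmp C X T A ?f w = sub_arr C X A (Cmp C X D A c (Cmp C X T D p w)) (Cmp C X B A b (Cmp C X T B q w))"
    if "X \<in> Obj C" "w \<in> arrows C X T" for X w
    using that by (simp add: comp_sub_left comp_assoc)
  show ?thesis
  proof (rule that[of S "Cmp C S T D p k"])
    fix X h assume [simp]: "X \<in> Obj C" "h \<in> arrows C X D"
    show "(\<exists>u\<in>arrows C X S. h = Cmp C X S D (Cmp C S T D p k) u) \<longleftrightarrow>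
      (\<exists>v\<in>arrows C X B. Cmp C X D A c h = Cmp C X B A b v)" (is "?L \<longleftrightarrow> ?R")
    proof
      assume ?L
      then obtain u where u [simp]: "u \<in> arrows C X S" and h: "h = Cmp C X S D (Cmp C S T D p k) u" by blast
      let ?w = "Cmp C X S T k u"
      have "Cmp C X T A ?f ?w = zero_arr C X A"
        using k by (simp add: comp_assoc[of X S T A u k] is_kernel_def)
      then have "Cmp C X D A c (Cmp C X T D p ?w) = Cmp C X B A b (Cmp C X T B q ?w)"
        by (simp add: f sub_zero_iff)
      moreover have "h = Cmp C X T D p ?w" unfolding h by (simp add: comp_assoc)
      ultimately show ?R by (intro bexI[of _ "Cmp C X T B q ?w"]) simp_all
    next
      assume ?R
      then obtain v where v [simp]: "v \<in> arrows C X B" and e: "Cmp C X D A c h = Cmp C X B A b v" by blast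
      let ?w = "Cmp C X D T i h \<otimes>\<^bsub>HomGrp C X T\<^esub> Cmp C X B T j v"
      have "Cmp C X T A ?f ?w = zero_arr C X A" by (simp add: f m(6,7) e sub_zero_iff)
      moreover have "?w \<in> arrows C X T" by simp
      ultimately obtain u where "u \<in> arrows C X S" "Cmp C X S T k u = ?w"
        using k \<open>X \<in> Obj C\<close> unfolding is_kernel_def by metis
      then show ?L by (intro bexI[of _ u]) (simp_all add: comp_assoc[symmetric] m(6))
    qed
  qed auto
qed

end

definition generated_by :: "('o, 'u) acat \<Rightarrow> ('o, 'u) presheaf \<Rightarrow> 'o \<Rightarrow> 'u \<Rightarrow> 'o \<Rightarrow> 'u set" where
  "generated_by C F B x X = {FAr F B X h x | h. h \<in> arrows C X B}"

context preadditive_category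
begin

lemma generated_by_sub:
  assumes F: "additive_presheaf C F" and B: "B \<in> Obj C" and x: "x \<in> sections F B"
  shows "subpresheaf C F (generated_by C F B x)"
  unfolding subpresheaf_def
proof (intro conjI ballI)
  fix X assume X: "X \<in> Obj C"
  interpret group_hom "HomGrp C X B" "FOb F X" "\<lambda>h. FAr F B X h x" using restriction_hom[OF F X B x] .
  have "generated_by C F B x X = (\<lambda>h. FAr F B X h x) ` arrows C X B" by (auto simp: generated_by_def)
  then show "subgroup (generated_by C F B x X) (FOb F X)" using img_is_subgroup by simp
next
  fix X Y f z assume X: "X \<in> Obj C" "Y \<in> Obj C" "f \<in> arrows C X Y" and z: "z \<in> generated_by C F B x Y"
  then obtain h where h: "h \<in> arrows C Y B" "z = FAr F B Y h x" by (auto simp: generated_by_def)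
  have "FAr F Y X f z = FAr F B X (Cmp C X Y B h f) x"
    using presheaf_comp[OF additive_presheafD[OF F] X(1,2) B X(3) h(1) x] h by simp
  then show "FAr F Y X f z \<in> generated_by C F B x X" using X B h by (auto simp: generated_by_def)
qed

lemma additive_if_inj:
  assumes F: "additive_presheaf C F" and K: "K \<in> Obj (presheaf_cat C)"
    and i: "\<iota> \<in> arrows (presheaf_cat C) K F" and j: "presheaf_inj C K \<iota>"
  shows "additive_presheaf C K"
  unfolding additive_presheaf_def
proof (intro conjI ballI K)
  note F' = additive_presheafD[OF F]
  fix X Y f g z assume X [simp]: "X \<in> Obj C" "Y \<in> Obj C" "f \<in> arrows C X Y" "g \<in> arrows C X Y" and z: "z \<in> sections K Y"
  interpret i: group_hom "FOb K X" "FOb F X" "\<iota> X" using nat_hom[OF K F' i X(1)] .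
  have cl: "FAr K Y X u z \<in> sections K X" if "u \<in> arrows C X Y" for u using presheaf_closed[OF K X(1,2) that z] .
  have nt: "\<iota> X (FAr K Y X u z) = FAr F Y X u (\<iota> Y z)" if "u \<in> arrows C X Y" for u
    using nat_natural[OF K F' i X(1,2) that z] .
  have eq: "\<iota> X (FAr K Y X (f \<otimes>\<^bsub>HomGrp C X Y\<^esub> g) z) = \<iota> X (FAr K Y X f z \<otimes>\<^bsub>FOb K X\<^esub> FAr K Y X g z)"
    using F nat_closed[OF K F' i X(2) z] cl by (simp add: nt additive_presheaf_def)
  have "inj_on (\<iota> X) (sections K X)" using j by (simp add: presheaf_inj_def)
  from this eq show "FAr K Y X (f \<otimes>\<^bsub>HomGrp C X Y\<^esub> g) z = FAr K Y X f z \<otimes>\<^bsub>FOb K X\<^esub> FAr K Y X g z"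
    by (rule inj_onD) (use cl in auto)
qed

lemma additive_if_surj:
  assumes F: "additive_presheaf C F" and Q: "Q \<in> Obj (presheaf_cat C)"
    and p: "\<pi> \<in> arrows (presheaf_cat C) F Q" and s: "presheaf_surj C F Q \<pi>"
  shows "additive_presheaf C Q"
  unfolding additive_presheaf_def
proof (intro conjI ballI Q)
  note F' = additive_presheafD[OF F]
  fix X Y f g w assume X [simp]: "X \<in> Obj C" "Y \<in> Obj C" "f \<in> arrows C X Y" "g \<in> arrows C X Y" and w: "w \<in> sections Q Y"
  obtain z where z: "z \<in> sections F Y" "w = \<pi> Y z" using s X w by (metis imageE presheaf_surj_def)
  interpret p: group_hom "FOb F X" "FOb Q X" "\<pi> X" using nat_hom[OF F' Q p X(1)] .
  have nt: "FAr Q Y X u w = \<pi> X (FAr F Y X u z)" if "u \<in> arrows C X Y" for u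
    using nat_natural[OF F' Q p X(1,2) that z(1)] z(2) by simp
  show "FAr Q Y X (f \<otimes>\<^bsub>HomGrp C X Y\<^esub> g) w = FAr Q Y X f w \<otimes>\<^bsub>FOb Q X\<^esub> FAr Q Y X g w"
    using F z(1) presheaf_closed[OF F' X(1,2)] by (simp add: nt additive_presheaf_def)
qed

lemma restriction_sub:
  assumes F: "additive_presheaf C F" and "X \<in> Obj C" "Y \<in> Obj C" "f \<in> arrows C X Y" "g \<in> arrows C X Y" "z \<in> sections F Y"
  shows "FAr F Y X (sub_arr C X Y f g) z = FAr F Y X f z \<otimes>\<^bsub>FOb F X\<^esub> inv\<^bsub>FOb F X\<^esub> FAr F Y X g z"
proof -
  interpret group_hom "HomGrp C X Y" "FOb F X" "\<lambda>f. FAr F Y X f z" using restriction_hom[OF F assms(2,3,6)] .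
  show ?thesis using assms by (simp add: sub_arr_def)
qed

lemma sub_eq_iff_add:
  assumes "X \<in> Obj C" "Y \<in> Obj C" "f \<in> arrows C X Y" "g \<in> arrows C X Y" "h \<in> arrows C X Y"
  shows "sub_arr C X Y f g = h \<longleftrightarrow> f = h \<otimes>\<^bsub>HomGrp C X Y\<^esub> g"
proof -
  interpret comm_group "HomGrp C X Y" using assms hom_group by simp
  show ?thesis using assms unfolding sub_arr_def by (metis inv_closed inv_solve_right m_closed)
qed

end

context abelian_category
begin

text \<open>
  Killing \<open>y = F(c) x\<close> in a functor generated by \<open>x\<close> with relations \<open>b\<close> adds \<open>c\<close> to the relations.
\<close>

lemma fp_quotient_generated:
  assumes F: "finitely_presented C F" and D: "D \<in> Obj C" and y: "y \<in> sections F D"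
    and Q: "Q \<in> Obj (presheaf_cat C)" and p: "\<pi> \<in> arrows (presheaf_cat C) F Q" and s: "presheaf_surj C F Q \<pi>"
    and k: "\<And>X z. \<lbrakk>X \<in> Obj C; z \<in> sections F X\<rbrakk> \<Longrightarrow> \<pi> X z = \<one>\<^bsub>FOb Q X\<^esub> \<longleftrightarrow> z \<in> generated_by C F D y X"
  shows "finitely_presented C Q"
proof -
  obtain B A b x where pr: "presented_by C F B A b x" using F fp_iff_presented by blast
  then have ad: "additive_presheaf C F" and ob [simp]: "B \<in> Obj C" "A \<in> Obj C" "b \<in> arrows C B A" and x: "x \<in> sections F A"
    and gen: "\<And>X z. \<lbrakk>X \<in> Obj C; z \<in> sections F X\<rbrakk> \<Longrightarrow> \<exists>h\<in>arrows C X A. z = FAr F A X h x"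
    and rel: "\<And>X h. \<lbrakk>X \<in> Obj C; h \<in> arrows C X A\<rbrakk> \<Longrightarrow> FAr F A X h x = \<one>\<^bsub>FOb F X\<^esub> \<longleftrightarrow> (\<exists>u\<in>arrows C X B. h = Cmp C X B A b u)"
    by (auto simp: presented_by_def)
  note F' = additive_presheafD[OF ad]
  obtain c where c [simp]: "c \<in> arrows C D A" and yc: "y = FAr F A D c x" using gen[OF D y] by blast
  obtain S r where S: "S \<in> Obj C" "r \<in> arrows C S A"
    and r: "\<And>X h. \<lbrakk>X \<in> Obj C; h \<in> arrows C X A\<rbrakk> \<Longrightarrow> (\<exists>u\<in>arrows C X S. h = Cmp C X S A r u) \<longleftrightarrow>
      (\<exists>u\<in>arrows C X B. \<exists>v\<in>arrows C X D. h = Cmp C X B A b u \<otimes>\<^bsub>HomGrp C X A\<^esub> Cmp C X D A c v)"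
    using joint_image[OF ob(1) D ob(2,3) c] by blast
  have qx: "FAr Q A X h (\<pi> A x) = \<pi> X (FAr F A X h x)" if "X \<in> Obj C" "h \<in> arrows C X A" for X h
    using nat_natural[OF F' Q p that(1) ob(2) that(2) x] by simp
  have "presented_by C Q S A r (\<pi> A x)"
    unfolding presented_by_def
  proof (intro conjI ballI)
    show "additive_presheaf C Q" using additive_if_surj[OF ad Q p s] .
    show "\<pi> A x \<in> sections Q A" using nat_closed[OF F' Q p ob(2) x] .
  next
    fix X w assume X: "X \<in> Obj C" and w: "w \<in> sections Q X"
    obtain z where z: "z \<in> sections F X" "w = \<pi> X z" using s X w by (metis imageE presheaf_surj_def)
    obtain h where h: "h \<in> arrows C X A" "z = FAr F A X h x" using gen[OF X z(1)] by blast
    then show "\<exists>h\<in>arrows C X A. w = FAr Q A X h (\<pi> A x)" using z(2) qx[OF X h(1)] by (intro bexI[of _ h]) simp_all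
  next
    fix X h assume X [simp]: "X \<in> Obj C" and h [simp]: "h \<in> arrows C X A"
    have fh: "FAr F A X h x \<in> sections F X" using presheaf_closed[OF F' X ob(2) h x] .
    have cv: "FAr F D X v y = FAr F A X (Cmp C X D A c v) x" if "v \<in> arrows C X D" for v
      using presheaf_comp[OF F' X D ob(2) that c x] yc by simp
    have "FAr Q A X h (\<pi> A x) = \<one>\<^bsub>FOb Q X\<^esub> \<longleftrightarrow> (\<exists>v\<in>arrows C X D. FAr F A X h x = FAr F A X (Cmp C X D A c v) x)"
    proof -
      have "FAr F A X h x \<in> generated_by C F D y X \<longleftrightarrow> (\<exists>v\<in>arrows C X D. FAr F A X h x = FAr F D X v y)"
        unfolding generated_by_def by blast
      also have "\<dots> \<longleftrightarrow> (\<exists>v\<in>arrows C X D. FAr F A X h x = FAr F A X (Cmp C X D A c v) x)"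
        by (rule bex_cong[OF refl]) (simp add: cv)
      finally show ?thesis using qx[OF X h] k[OF X fh] by simp
    qed
    also have "\<dots> \<longleftrightarrow> (\<exists>v\<in>arrows C X D. \<exists>u\<in>arrows C X B. h = Cmp C X B A b u \<otimes>\<^bsub>HomGrp C X A\<^esub> Cmp C X D A c v)"
    proof (rule bex_cong[OF refl])
      fix v assume v [simp]: "v \<in> arrows C X D"
      let ?cv = "Cmp C X D A c v"
      have cvA [simp]: "?cv \<in> arrows C X A" using D by simp
      have "FAr F A X h x = FAr F A X ?cv x \<longleftrightarrow> FAr F A X (sub_arr C X A h ?cv) x = \<one>\<^bsub>FOb F X\<^esub>"
        using comm_group_diff_one_iff[OF presheaf_group[OF F' X] fh presheaf_closed[OF F' X ob(2) cvA x]]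
        by (simp add: restriction_sub[OF ad X ob(2) h cvA x])
      also have "\<dots> \<longleftrightarrow> (\<exists>u\<in>arrows C X B. sub_arr C X A h ?cv = Cmp C X B A b u)" by (rule rel) auto
      also have "\<dots> \<longleftrightarrow> (\<exists>u\<in>arrows C X B. h = Cmp C X B A b u \<otimes>\<^bsub>HomGrp C X A\<^esub> ?cv)"
        by (rule bex_cong[OF refl]) (simp add: sub_eq_iff_add)
      finally show "FAr F A X h x = FAr F A X ?cv x \<longleftrightarrow> (\<exists>u\<in>arrows C X B. h = Cmp C X B A b u \<otimes>\<^bsub>HomGrp C X A\<^esub> ?cv)" .
    qed
    finally show "FAr Q A X h (\<pi> A x) = \<one>\<^bsub>FOb Q X\<^esub> \<longleftrightarrow> (\<exists>u\<in>arrows C X S. h = Cmp C X S A r u)"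
      using r[OF X h] by blast
  qed (use S in auto)
  then show ?thesis by (rule presented_by_imp_fp)
qed

text \<open>
  Write \<open>y\<close> as the restriction along \<open>c\<close> of a generator with relations \<open>b\<close>.  A relation of \<open>y\<close> is
  then an arrow that \<open>c\<close> carries into the image of \<open>b\<close>.
\<close>

lemma section_relations:
  assumes F: "finitely_presented C F" and D [simp]: "D \<in> Obj C" and y: "y \<in> sections F D"
  obtains S r where "S \<in> Obj C" "r \<in> arrows C S D"
    "\<And>X h. \<lbrakk>X \<in> Obj C; h \<in> arrows C X D\<rbrakk> \<Longrightarrow>
      FAr F D X h y = \<one>\<^bsub>FOb F X\<^esub> \<longleftrightarrow> (\<exists>u\<in>arrows C X S. h = Cmp C X S D r u)"
proof -
  obtain B A b x where pr: "presented_by C F B A b x" using F fp_iff_presented by blast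
  then have ad: "additive_presheaf C F" and ob [simp]: "B \<in> Obj C" "A \<in> Obj C" "b \<in> arrows C B A" and x: "x \<in> sections F A"
    and gen: "\<And>X z. \<lbrakk>X \<in> Obj C; z \<in> sections F X\<rbrakk> \<Longrightarrow> \<exists>h\<in>arrows C X A. z = FAr F A X h x"
    and rel: "\<And>X h. \<lbrakk>X \<in> Obj C; h \<in> arrows C X A\<rbrakk> \<Longrightarrow> FAr F A X h x = \<one>\<^bsub>FOb F X\<^esub> \<longleftrightarrow> (\<exists>u\<in>arrows C X B. h = Cmp C X B A b u)"
    by (auto simp: presented_by_def)
  note F' = additive_presheafD[OF ad]
  obtain c where c [simp]: "c \<in> arrows C D A" and yc: "y = FAr F A D c x" using gen[OF D y] by blast
  obtain S r where S: "S \<in> Obj C" "r \<in> arrows C S D"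
    and r: "\<And>X h. \<lbrakk>X \<in> Obj C; h \<in> arrows C X D\<rbrakk> \<Longrightarrow> (\<exists>u\<in>arrows C X S. h = Cmp C X S D r u) \<longleftrightarrow>
      (\<exists>v\<in>arrows C X B. Cmp C X D A c h = Cmp C X B A b v)"
    using image_preimage[OF ob(1) D ob(2,3) c] by blast
  have "FAr F D X h y = \<one>\<^bsub>FOb F X\<^esub> \<longleftrightarrow> (\<exists>u\<in>arrows C X S. h = Cmp C X S D r u)"
    if X [simp]: "X \<in> Obj C" and h [simp]: "h \<in> arrows C X D" for X h
  proof -
    have "FAr F D X h y = \<one>\<^bsub>FOb F X\<^esub> \<longleftrightarrow> FAr F A X (Cmp C X D A c h) x = \<one>\<^bsub>FOb F X\<^esub>"
      using presheaf_comp[OF F' X D ob(2) h c x] yc by simp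
    also have "\<dots> \<longleftrightarrow> (\<exists>v\<in>arrows C X B. Cmp C X D A c h = Cmp C X B A b v)" by (rule rel) auto
    finally show ?thesis using r[OF X h] by simp
  qed
  then show ?thesis using that S by blast
qed

lemma fp_generated:
  assumes F: "finitely_presented C F" and D [simp]: "D \<in> Obj C" and y: "y \<in> sections F D"
    and K: "K \<in> Obj (presheaf_cat C)" and i: "\<iota> \<in> arrows (presheaf_cat C) K F" and j: "presheaf_inj C K \<iota>"
    and im: "\<And>X. X \<in> Obj C \<Longrightarrow> \<iota> X ` sections K X = generated_by C F D y X"
  shows "finitely_presented C K"
proof -
  note ad = fp_additive[OF F] and F' = fp_presheaf[OF F]
  obtain S r where S: "S \<in> Obj C" "r \<in> arrows C S D"
    and r: "\<And>X h. \<lbrakk>X \<in> Obj C; h \<in> arrows C X D\<rbrakk> \<Longrightarrow>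
      FAr F D X h y = \<one>\<^bsub>FOb F X\<^esub> \<longleftrightarrow> (\<exists>u\<in>arrows C X S. h = Cmp C X S D r u)"
    using section_relations[OF F D y] by blast
  have "y \<in> generated_by C F D y D"
    using presheaf_id[OF F' D y] ident_closed[OF D] unfolding generated_by_def by (metis (mono_tags, lifting) mem_Collect_eq)
  then obtain y' where y': "y' \<in> sections K D" "\<iota> D y' = y" using im[OF D] by (metis imageE)
  have inj: "w = w'" if "X \<in> Obj C" "w \<in> sections K X" "w' \<in> sections K X" "\<iota> X w = \<iota> X w'" for X w w'
    using j that by (auto simp: presheaf_inj_def inj_on_def)
  have iy: "\<iota> X (FAr K D X h y') = FAr F D X h y" if "X \<in> Obj C" "h \<in> arrows C X D" for X h
    using nat_natural[OF K F' i that(1) D that(2) y'(1)] y' by simp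
  have kcl: "FAr K D X h y' \<in> sections K X" if "X \<in> Obj C" "h \<in> arrows C X D" for X h
    using presheaf_closed[OF K that(1) D that(2) y'(1)] .
  have "presented_by C K S D r y'"
    unfolding presented_by_def
  proof (intro conjI ballI)
    show "additive_presheaf C K" using additive_if_inj[OF ad K i j] .
  next
    fix X w assume X: "X \<in> Obj C" and w: "w \<in> sections K X"
    have "\<iota> X w \<in> generated_by C F D y X" using im[OF X] w by blast
    then obtain h where h: "h \<in> arrows C X D" "\<iota> X w = FAr F D X h y" by (auto simp: generated_by_def)
    then have "w = FAr K D X h y'" by (intro inj[OF X w kcl[OF X]]) (simp_all add: iy[OF X])
    then show "\<exists>h\<in>arrows C X D. w = FAr K D X h y'" using h by blast
  next
    fix X h assume X [simp]: "X \<in> Obj C" and h [simp]: "h \<in> arrows C X D"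
    interpret i: group_hom "FOb K X" "FOb F X" "\<iota> X" using nat_hom[OF K F' i X] .
    have "FAr K D X h y' = \<one>\<^bsub>FOb K X\<^esub> \<longleftrightarrow> \<iota> X (FAr K D X h y') = \<one>\<^bsub>FOb F X\<^esub>"
      using inj[OF X kcl[OF X h] i.G.one_closed] i.hom_one by auto
    then show "FAr K D X h y' = \<one>\<^bsub>FOb K X\<^esub> \<longleftrightarrow> (\<exists>u\<in>arrows C X S. h = Cmp C X S D r u)"
      using r[OF X h] iy[OF X h] by simp
  qed (use S y' in auto)
  then show ?thesis by (rule presented_by_imp_fp)
qed

lemma yoneda_fp [simp]:
  assumes [simp]: "B \<in> Obj C"
  shows "finitely_presented C (yoneda_ob C B)"
proof -
  obtain Z where Z: "is_zero C Z" using ex_zero by blast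
  then have [simp]: "Z \<in> Obj C" by (simp add: is_zero_def)
  have "presented_by C (yoneda_ob C B) Z B (zero_arr C Z B) (Ident C B)"
    unfolding presented_by_def
  proof (intro conjI ballI)
    fix X h assume [simp]: "X \<in> Obj C" "h \<in> arrows C X B"
    have "(\<exists>u\<in>arrows C X Z. h = Cmp C X Z B (zero_arr C Z B) u) \<longleftrightarrow> h = zero_arr C X B"
      by (auto intro!: exI[of _ "zero_arr C X Z"])
    then show "FAr (yoneda_ob C B) B X h (Ident C B) = \<one>\<^bsub>FOb (yoneda_ob C B) X\<^esub>
      \<longleftrightarrow> (\<exists>u\<in>arrows C X Z. h = Cmp C X Z B (zero_arr C Z B) u)" by simp
  qed (auto)
  then show ?thesis by (rule presented_by_imp_fp)
qed

end

section \<open>Epimorphisms and exactness of finitely presented functors\<close>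

context abelian_category
begin

lemma image_generated:
  assumes "additive_presheaf C F" and pr: "presented_by C G B A b x" and a: "\<alpha> \<in> arrows (presheaf_cat C) G F" and X: "X \<in> Obj C"
  shows "\<alpha> X ` sections G X = generated_by C F A (\<alpha> A x) X"
proof -
  note F = additive_presheafD[OF assms(1)]
  note p = pr[unfolded presented_by_def]
  have G: "G \<in> Obj (presheaf_cat C)" using p additive_presheafD by blast
  have A: "A \<in> Obj C" and x: "x \<in> sections G A" using p by auto
  have e: "FAr F A X h (\<alpha> A x) = \<alpha> X (FAr G A X h x)" if "h \<in> arrows C X A" for h
    using nat_natural[OF G F a X A that x] by simp
  have "sections G X = {FAr G A X h x | h. h \<in> arrows C X A}"
  proof (intro equalityI subsetI)
    fix z assume "z \<in> sections G X"
    then have "\<exists>h\<in>arrows C X A. z = FAr G A X h x" using p X by blast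
    then show "z \<in> {FAr G A X h x | h. h \<in> arrows C X A}" by blast
  next
    fix z assume "z \<in> {FAr G A X h x | h. h \<in> arrows C X A}"
    then show "z \<in> sections G X" using presheaf_closed[OF G X A _ x] by blast
  qed
  then have "\<alpha> X ` sections G X = {\<alpha> X (FAr G A X h x) | h. h \<in> arrows C X A}" by auto
  also have "\<dots> = generated_by C F A (\<alpha> A x) X"
    unfolding generated_by_def by (rule Collect_cong) (metis e)
  finally show ?thesis .
qed

text \<open>
  An epimorphism kills its pointwise cokernel.  That cokernel is again finitely presented, because
  the image of a finitely presented functor is generated by a single section.
\<close>

lemma fp_epi_surj:
  assumes e: "epi_arr (fp C) G F \<alpha>"
  shows "presheaf_surj C G F \<alpha>"
proof -
  have fG: "finitely_presented C G" and fF: "finitely_presented C F" and a: "\<alpha> \<in> arrows (presheaf_cat C) G F"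
    using e by (auto simp: epi_arr_def)
  note F = fp_presheaf[OF fF] and G = fp_presheaf[OF fG] and aF = fp_additive[OF fF]
  obtain B A b x where pr: "presented_by C G B A b x" using fG fp_iff_presented by blast
  then have A: "A \<in> Obj C" and x: "x \<in> sections G A" by (auto simp: presented_by_def)
  have y: "\<alpha> A x \<in> sections F A" using nat_closed[OF G F a A x] .
  obtain Q \<pi> where Q: "Q \<in> Obj (presheaf_cat C)" and p: "\<pi> \<in> arrows (presheaf_cat C) F Q" and s: "presheaf_surj C F Q \<pi>"
    and k: "\<And>X z. \<lbrakk>X \<in> Obj C; z \<in> sections F X\<rbrakk> \<Longrightarrow> \<pi> X z = \<one>\<^bsub>FOb Q X\<^esub> \<longleftrightarrow> z \<in> generated_by C F A (\<alpha> A x) X"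
    using presheaf_quotient[OF F generated_by_sub[OF aF A y]] by blast
  have fQ: "finitely_presented C Q" by (rule fp_quotient_generated[OF fF A y Q p s k])
  note im = image_generated[OF aF pr a]
  have "Cmp (presheaf_cat C) G F Q \<pi> \<alpha> = zero_arr (presheaf_cat C) G Q"
  proof (rule nat_eqI[OF G Q psh_comp_closed[OF G F Q a p] psh_zero_closed[OF G Q]])
    fix X z assume X: "X \<in> Obj C" and z: "z \<in> sections G X"
    then have "\<alpha> X z \<in> generated_by C F A (\<alpha> A x) X" using im by blast
    then show "Cmp (presheaf_cat C) G F Q \<pi> \<alpha> X z = zero_arr (presheaf_cat C) G Q X z"
      using k[OF X nat_closed[OF G F a X z]] X z by simp
  qed
  then have "\<pi> = zero_arr (presheaf_cat C) F Q"
    using preadditive_category.epi_zeroD[OF preadditive_fp e, of Q \<pi>] fQ p by simp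
  then have "z \<in> \<alpha> X ` sections G X" if "X \<in> Obj C" "z \<in> sections F X" for X z
    using k[OF that] im that by simp
  then show ?thesis unfolding presheaf_surj_def using nat_closed[OF G F a] by blast
qed

text \<open>
  A section over \<open>X\<close> killed by \<open>\<alpha>\<close> is a map from the representable functor of \<open>X\<close> killed by \<open>\<alpha>\<close>;
  representables are finitely presented, so it factors through the categorical kernel.
\<close>

lemma fp_kernel_pointwise:
  assumes k: "is_kernel (fp C) K F G \<kappa> \<alpha>"
  shows "presheaf_exact C K F G \<kappa> \<alpha>"
  unfolding presheaf_exact_def
proof (intro ballI equalityI subsetI)
  have f: "finitely_presented C K" "finitely_presented C F" "finitely_presented C G"
    and ka: "\<kappa> \<in> arrows (presheaf_cat C) K F" and a: "\<alpha> \<in> arrows (presheaf_cat C) F G"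
    and z: "Cmp (presheaf_cat C) K F G \<alpha> \<kappa> = zero_arr (presheaf_cat C) K G"
    using k by (auto simp: is_kernel_def)
  note p = f[THEN fp_presheaf] and ad = f[THEN fp_additive]
  fix X w assume X: "X \<in> Obj C"
  { assume "w \<in> \<kappa> X ` sections K X"
    then obtain v where v: "v \<in> sections K X" "w = \<kappa> X v" by blast
    then show "w \<in> kernel (FOb F X) (FOb G X) (\<alpha> X)"
      using nat_closed[OF p(1,2) ka X] fun_cong[OF fun_cong[OF z], of X v] X by (simp add: kernel_def)
  }
  { assume "w \<in> kernel (FOb F X) (FOb G X) (\<alpha> X)"
    then have w: "w \<in> sections F X" and aw: "\<alpha> X w = \<one>\<^bsub>FOb G X\<^esub>" by (auto simp: kernel_def)
    let ?h = "yoneda_el C F X w"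
    note h = yoneda_el_arrow[OF ad(2) X w] and Y = yoneda_presheaf[OF X]
    have "Cmp (presheaf_cat C) (yoneda_ob C X) F G \<alpha> ?h = zero_arr (presheaf_cat C) (yoneda_ob C X) G"
    proof (rule nat_eqI[OF Y p(3) psh_comp_closed[OF Y p(2,3) h a] psh_zero_closed[OF Y p(3)]])
      fix V u assume V: "V \<in> Obj C" and u: "u \<in> sections (yoneda_ob C X) V"
      interpret g: group_hom "FOb G X" "FOb G V" "FAr G X V u" using presheaf_group_hom[OF p(3) V X] u by simp
      show "Cmp (presheaf_cat C) (yoneda_ob C X) F G \<alpha> ?h V u = zero_arr (presheaf_cat C) (yoneda_ob C X) G V u"
        using nat_natural[OF p(2,3) a V X _ w] u V aw by simp
    qed
    then obtain u where u: "u \<in> arrows (presheaf_cat C) (yoneda_ob C X) K" "Cmp (presheaf_cat C) (yoneda_ob C X) K F \<kappa> u = ?h"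
      using k h X unfolding is_kernel_def by (metis (no_types, lifting) fp_simps(1-3) mem_Collect_eq yoneda_fp)
    have "\<kappa> X (u X (Ident C X)) = w"
      using fun_cong[OF fun_cong[OF u(2)], of X "Ident C X"] X presheaf_id[OF p(2) X w] by simp
    then show "w \<in> \<kappa> X ` sections K X" using nat_closed[OF Y p(1) u(1) X, of "Ident C X"] X by (simp add: image_iff) metis
  }
qed

lemma fp_exact_pointwise:
  assumes "exact_at (fp C) E F G \<alpha> \<beta>"
  shows "presheaf_exact C E F G \<alpha> \<beta>"
proof -
  obtain K k e where k: "is_kernel (fp C) K F G k \<beta>" and e: "epi_arr (fp C) E K e"
    and a: "\<alpha> = Cmp (presheaf_cat C) E K F k e"
    using assms unfolding exact_at_def by auto
  have ec: "e X z \<in> sections K X" if "X \<in> Obj C" "z \<in> sections E X" for X z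
    using fp_epi_surj[OF e] that unfolding presheaf_surj_def by blast
  have "\<alpha> X ` sections E X = k X ` sections K X" if X: "X \<in> Obj C" for X
  proof -
    have "\<alpha> X ` sections E X = k X ` (e X ` sections E X)"
      unfolding image_image using X by (intro image_cong) (simp_all add: a)
    then show ?thesis using fp_epi_surj[OF e] X by (simp add: presheaf_surj_def)
  qed
  then show ?thesis using fp_kernel_pointwise[OF k] by (simp add: presheaf_exact_def)
qed

lemma fp_epi_iff:
  "epi_arr (fp C) F G \<alpha> \<longleftrightarrow> finitely_presented C F \<and> finitely_presented C G \<and>
     \<alpha> \<in> arrows (presheaf_cat C) F G \<and> presheaf_surj C F G \<alpha>"
proof
  assume "epi_arr (fp C) F G \<alpha>"
  then show "finitely_presented C F \<and> finitely_presented C G \<and>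
     \<alpha> \<in> arrows (presheaf_cat C) F G \<and> presheaf_surj C F G \<alpha>"
    using fp_epi_surj by (auto simp: epi_arr_def)
next
  assume a: "finitely_presented C F \<and> finitely_presented C G \<and>
     \<alpha> \<in> arrows (presheaf_cat C) F G \<and> presheaf_surj C F G \<alpha>"
  then show "epi_arr (fp C) F G \<alpha>"
    unfolding fp_def by (intro epi_full_subcat epi_if_surj) (auto simp: fp_presheaf)
qed

text \<open>
  The pointwise image is generated by the image of a generator of \<open>F\<close>, and the relations of that
  section are again generated by one arrow.
\<close>

lemma fp_image:
  assumes fF: "finitely_presented C F" and fG: "finitely_presented C G" and a: "\<alpha> \<in> arrows (presheaf_cat C) F G"
  obtains I \<iota> e where "finitely_presented C I" "\<iota> \<in> arrows (presheaf_cat C) I G" "presheaf_inj C I \<iota>"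
    "epi_arr (fp C) F I e" "Cmp (presheaf_cat C) F I G \<iota> e = \<alpha>"
    "\<And>X. X \<in> Obj C \<Longrightarrow> \<iota> X ` sections I X = \<alpha> X ` sections F X"
proof -
  note F = fp_presheaf[OF fF] and G = fp_presheaf[OF fG] and aG = fp_additive[OF fG]
  obtain B A b x where pr: "presented_by C F B A b x" using fF fp_iff_presented by blast
  then have A: "A \<in> Obj C" and x: "x \<in> sections F A" by (auto simp: presented_by_def)
  have y: "\<alpha> A x \<in> sections G A" using nat_closed[OF F G a A x] .
  note im = image_generated[OF aG pr a]
  obtain I \<iota> where I: "I \<in> Obj (presheaf_cat C)" and i: "\<iota> \<in> arrows (presheaf_cat C) I G" and j: "presheaf_inj C I \<iota>"
    and s: "\<And>X. X \<in> Obj C \<Longrightarrow> sections I X = generated_by C G A (\<alpha> A x) X" and ii: "\<And>X z. \<lbrakk>X \<in> Obj C; z \<in> generated_by C G A (\<alpha> A x) X\<rbrakk> \<Longrightarrow> \<iota> X z = z"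
    using presheaf_inclusion[OF G generated_by_sub[OF aG A y]] by metis
  have ig: "\<iota> X ` sections I X = generated_by C G A (\<alpha> A x) X" if "X \<in> Obj C" for X
    using s[OF that] ii[OF that] by (simp cong: image_cong)
  have fI: "finitely_presented C I" by (rule fp_generated[OF fG A y I i j ig])
  have "\<alpha> X z \<in> \<iota> X ` sections I X" if "X \<in> Obj C" "z \<in> sections F X" for X z
    using im ig that by blast
  then obtain e where e: "e \<in> arrows (presheaf_cat C) F I" "Cmp (presheaf_cat C) F I G \<iota> e = \<alpha>"
    "\<And>X z. \<lbrakk>X \<in> Obj C; z \<in> sections F X\<rbrakk> \<Longrightarrow> \<iota> X (e X z) = \<alpha> X z"
    using factor_through_inj[OF F I G i j a] by blast
  have "presheaf_surj C F I e" unfolding presheaf_surj_def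
  proof (intro ballI equalityI subsetI)
    fix X w assume X: "X \<in> Obj C"
    { assume "w \<in> e X ` sections F X" then show "w \<in> sections I X" using nat_closed[OF F I e(1) X] by blast }
    { assume w: "w \<in> sections I X"
      then have "\<iota> X w \<in> \<alpha> X ` sections F X" using ig[OF X] im[OF X] by blast
      then obtain z where z: "z \<in> sections F X" "\<iota> X w = \<iota> X (e X z)" using e(3)[OF X] by auto
      then have "w = e X z" using j X w nat_closed[OF F I e(1) X z(1)] by (auto simp: presheaf_inj_def inj_on_def)
      then show "w \<in> e X ` sections F X" using z by blast }
  qed
  then have "epi_arr (fp C) F I e" using fp_epi_iff fF fI e by blast
  then show ?thesis using that fI i j e ig im by simp
qed

lemma fp_exactI:
  assumes f: "finitely_presented C E" "finitely_presented C F" "finitely_presented C G"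
    and a: "\<alpha> \<in> arrows (presheaf_cat C) E F" and b: "\<beta> \<in> arrows (presheaf_cat C) F G"
    and ex: "presheaf_exact C E F G \<alpha> \<beta>"
  shows "exact_at (fp C) E F G \<alpha> \<beta>"
proof -
  obtain I \<iota> e where I: "finitely_presented C I" "\<iota> \<in> arrows (presheaf_cat C) I F" "presheaf_inj C I \<iota>"
    "epi_arr (fp C) E I e" "Cmp (presheaf_cat C) E I F \<iota> e = \<alpha>"
    "\<And>X. X \<in> Obj C \<Longrightarrow> \<iota> X ` sections I X = \<alpha> X ` sections E X"
    using fp_image[OF f(1,2) a] by blast
  have "presheaf_exact C I F G \<iota> \<beta>" using ex I(6) by (simp add: presheaf_exact_def)
  then have "is_kernel (fp C) I F G \<iota> \<beta>"
    unfolding fp_def using f I b by (intro kernel_full_subcat kernel_if_pointwise) (auto simp: fp_presheaf)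
  then show ?thesis unfolding exact_at_def using I by auto
qed

end

section \<open>Reflective subcategories\<close>

lemma inclusion_functor_simps [simp]:
  "FOb inclusion_functor X = X" "FAr inclusion_functor X Y f = f"
  by (simp_all add: inclusion_functor_def)

definition universal_arrow :: "('o, 'm) acat \<Rightarrow> ('o \<Rightarrow> bool) \<Rightarrow> 'o \<Rightarrow> 'o \<Rightarrow> 'm \<Rightarrow> bool" where
  "universal_arrow C Q X R u \<longleftrightarrow> R \<in> Obj C \<and> Q R \<and> u \<in> arrows C X R \<and>
     (\<forall>Y\<in>Obj C. Q Y \<longrightarrow> (\<forall>f\<in>arrows C X Y. \<exists>!g. g \<in> arrows C R Y \<and> Cmp C X R Y g u = f))"

lemma universal_arrow_eqI:
  "\<lbrakk>universal_arrow C Q X R u; Y \<in> Obj C; Q Y; g \<in> arrows C R Y; g' \<in> arrows C R Y;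
     Cmp C X R Y g u = f; Cmp C X R Y g' u = f; f \<in> arrows C X Y\<rbrakk> \<Longrightarrow> g = g'"
  unfolding universal_arrow_def by blast

context preadditive_category
begin

lemma left_adjoint_if_universal_arrows:
  assumes "\<And>X. X \<in> Obj C \<Longrightarrow> \<exists>R u. universal_arrow C Q X R u"
  shows "\<exists>T. left_adjoint C (full_subcat C Q) T inclusion_functor"
proof -
  obtain R u where U: "\<And>X. X \<in> Obj C \<Longrightarrow> universal_arrow C Q X (R X) (u X)"
    using assms by metis
  have R [simp]: "R X \<in> Obj C" "Q (R X)" and u [simp]: "u X \<in> arrows C X (R X)" if "X \<in> Obj C" for X
    using U[OF that] by (auto simp: universal_arrow_def)
  have ex: "\<exists>!g. g \<in> arrows C (R X) Y \<and> Cmp C X (R X) Y g (u X) = f" if "X \<in> Obj C" "Y \<in> Obj C" "Q Y" "f \<in> arrows C X Y" for X Y f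
    using U[OF that(1)] that by (auto simp: universal_arrow_def)
  have eqI: "g = g'" if "X \<in> Obj C" "Y \<in> Obj C" "Q Y" "g \<in> arrows C (R X) Y" "g' \<in> arrows C (R X) Y"
    "Cmp C X (R X) Y g (u X) = Cmp C X (R X) Y g' (u X)" for X Y g g'
    using ex[OF that(1-3), of "Cmp C X (R X) Y g (u X)"] that R u comp_closed by metis
  define m where "m X Y f = (THE g. g \<in> arrows C (R X) (R Y) \<and> Cmp C X (R X) (R Y) g (u X) = Cmp C X Y (R Y) (u Y) f)" for X Y f
  have m [simp]: "m X Y f \<in> arrows C (R X) (R Y)" and mu: "Cmp C X (R X) (R Y) (m X Y f) (u X) = Cmp C X Y (R Y) (u Y) f"
    if "X \<in> Obj C" "Y \<in> Obj C" "f \<in> arrows C X Y" for X Y f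
    using theI'[OF ex[of X "R Y" "Cmp C X Y (R Y) (u Y) f"]] that unfolding m_def by auto
  let ?T = "\<lparr>FOb = R, FAr = m\<rparr>"
  have mc: "m X Z (Cmp C X Y Z g f) = Cmp C (R X) (R Y) (R Z) (m Y Z g) (m X Y f)"
    if [simp]: "X \<in> Obj C" "Y \<in> Obj C" "Z \<in> Obj C" "f \<in> arrows C X Y" "g \<in> arrows C Y Z" for X Y Z f g
  proof (rule eqI[of X "R Z"])
    have "Cmp C X (R X) (R Z) (Cmp C (R X) (R Y) (R Z) (m Y Z g) (m X Y f)) (u X)
        = Cmp C X (R Y) (R Z) (m Y Z g) (Cmp C X Y (R Y) (u Y) f)"
      by (subst comp_assoc[symmetric]) (simp_all add: mu)
    also have "\<dots> = Cmp C X Y (R Z) (Cmp C Y Z (R Z) (u Z) g) f"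
      by (subst comp_assoc) (simp_all add: mu)
    also have "\<dots> = Cmp C X (R X) (R Z) (m X Z (Cmp C X Y Z g f)) (u X)"
      by (simp add: mu comp_assoc)
    finally show "Cmp C X (R X) (R Z) (m X Z (Cmp C X Y Z g f)) (u X)
        = Cmp C X (R X) (R Z) (Cmp C (R X) (R Y) (R Z) (m Y Z g) (m X Y f)) (u X)" ..
  qed auto
  have mi: "m X X (Ident C X) = Ident C (R X)" if [simp]: "X \<in> Obj C" for X
    by (rule eqI[of X "R X"]) (simp_all add: mu)
  have T: "is_functor C (full_subcat C Q) ?T" by (simp add: is_functor_def mc mi)
  have I: "is_functor (full_subcat C Q) C inclusion_functor" by (simp add: is_functor_def inclusion_functor_def)
  have "left_adjoint C (full_subcat C Q) ?T inclusion_functor"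
    unfolding left_adjoint_def
  proof (intro conjI T I exI[of _ "\<lambda>X Y h. Cmp C X (R X) Y h (u X)"] ballI)
    fix X Y assume XY: "X \<in> Obj C" "Y \<in> Obj (full_subcat C Q)"
    show "bij_betw (\<lambda>h. Cmp C X (R X) Y h (u X)) (arrows (full_subcat C Q) (FOb ?T X) Y) (arrows C X (FOb inclusion_functor Y))"
      unfolding bij_betw_def
    proof
      show "inj_on (\<lambda>h. Cmp C X (R X) Y h (u X)) (arrows (full_subcat C Q) (FOb ?T X) Y)"
        using XY eqI[of X Y] by (auto simp: inj_on_def)
      show "(\<lambda>h. Cmp C X (R X) Y h (u X)) ` arrows (full_subcat C Q) (FOb ?T X) Y = arrows C X (FOb inclusion_functor Y)"
      proof (intro equalityI subsetI)
        fix f assume "f \<in> arrows C X (FOb inclusion_functor Y)"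
        then show "f \<in> (\<lambda>h. Cmp C X (R X) Y h (u X)) ` arrows (full_subcat C Q) (FOb ?T X) Y"
          using ex[of X Y f] XY by (auto simp: inclusion_functor_def)
      qed (use XY in \<open>auto simp: inclusion_functor_def\<close>)
    qed
  qed (auto simp: inclusion_functor_def comp_assoc[symmetric] mu)
  then show ?thesis ..
qed

text \<open>
  Naturality of the adjunction bijection in the second variable shows that it is composition with
  the image \<open>u\<close> of the identity.
\<close>

lemma left_adjoint_universal_arrows:
  assumes L: "left_adjoint C (full_subcat C Q) T inclusion_functor"
  obtains u where "\<And>X. X \<in> Obj C \<Longrightarrow> universal_arrow C Q X (FOb T X) (u X)"
    and "\<And>X Y f. \<lbrakk>X \<in> Obj C; Y \<in> Obj C; f \<in> arrows C X Y\<rbrakk>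
      \<Longrightarrow> Cmp C X (FOb T X) (FOb T Y) (FAr T X Y f) (u X) = Cmp C X Y (FOb T Y) (u Y) f"
proof -
  obtain \<phi> where bij: "\<And>X Y. \<lbrakk>X \<in> Obj C; Y \<in> Obj C; Q Y\<rbrakk> \<Longrightarrow> bij_betw (\<phi> X Y) (arrows C (FOb T X) Y) (arrows C X Y)"
    and n1: "\<And>X Y Y' h g. \<lbrakk>X \<in> Obj C; Y \<in> Obj C; Q Y; Y' \<in> Obj C; Q Y'; h \<in> arrows C (FOb T X) Y; g \<in> arrows C Y Y'\<rbrakk>
      \<Longrightarrow> \<phi> X Y' (Cmp C (FOb T X) Y Y' g h) = Cmp C X Y Y' g (\<phi> X Y h)"
    and n2: "\<And>X X' Y h f. \<lbrakk>X \<in> Obj C; X' \<in> Obj C; Y \<in> Obj C; Q Y; h \<in> arrows C (FOb T X) Y; f \<in> arrows C X' X\<rbrakk>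
      \<Longrightarrow> \<phi> X' Y (Cmp C (FOb T X') (FOb T X) Y h (FAr T X' X f)) = Cmp C X' X Y (\<phi> X Y h) f"
  proof -
    obtain \<phi> where "(\<forall>X\<in>Obj C. \<forall>Y\<in>Obj (full_subcat C Q).
             bij_betw (\<phi> X Y) (arrows (full_subcat C Q) (FOb T X) Y) (arrows C X Y)) \<and>
          (\<forall>X\<in>Obj C. \<forall>Y\<in>Obj (full_subcat C Q). \<forall>Y'\<in>Obj (full_subcat C Q). \<forall>h\<in>arrows (full_subcat C Q) (FOb T X) Y.
             \<forall>g\<in>arrows (full_subcat C Q) Y Y'.
             \<phi> X Y' (Cmp (full_subcat C Q) (FOb T X) Y Y' g h)
               = Cmp C X Y Y' g (\<phi> X Y h)) \<and>
          (\<forall>X\<in>Obj C. \<forall>X'\<in>Obj C. \<forall>Y\<in>Obj (full_subcat C Q). \<forall>h\<in>arrows (full_subcat C Q) (FOb T X) Y. \<forall>f\<in>arrows C X' X.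
             \<phi> X' Y (Cmp (full_subcat C Q) (FOb T X') (FOb T X) Y h (FAr T X' X f))
               = Cmp C X' X Y (\<phi> X Y h) f)"
      using L unfolding left_adjoint_def inclusion_functor_simps by (elim conjE exE) (rule that, intro conjI, assumption+)
    then show thesis by (intro that[of \<phi>]) simp_all
  qed
  have T: "is_functor C (full_subcat C Q) T" using L by (simp add: left_adjoint_def)
  have TO [simp]: "FOb T X \<in> Obj C" "Q (FOb T X)" if "X \<in> Obj C" for X using T that by (auto simp: is_functor_def)
  have TA [simp]: "FAr T X Y f \<in> arrows C (FOb T X) (FOb T Y)" if "X \<in> Obj C" "Y \<in> Obj C" "f \<in> arrows C X Y" for X Y f
    using T that by (auto simp: is_functor_def)
  define u where "u X = \<phi> X (FOb T X) (Ident C (FOb T X))" for X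
  have pu: "\<phi> X Y h = Cmp C X (FOb T X) Y h (u X)" if "X \<in> Obj C" "Y \<in> Obj C" "Q Y" "h \<in> arrows C (FOb T X) Y" for X Y h
    using n1[of X "FOb T X" Y "Ident C (FOb T X)" h] that by (simp add: u_def)
  have uc [simp]: "u X \<in> arrows C X (FOb T X)" if "X \<in> Obj C" for X
    unfolding u_def using bij_betw_apply[OF bij[OF that TO[OF that]] ident_closed[OF TO(1)[OF that]]] .
  show ?thesis
  proof (rule that)
    fix X assume X: "X \<in> Obj C"
    show "universal_arrow C Q X (FOb T X) (u X)"
      unfolding universal_arrow_def
    proof (intro conjI ballI impI TO[OF X] uc[OF X])
      fix Y f assume Y: "Y \<in> Obj C" "Q Y" and f: "f \<in> arrows C X Y"
      have b: "inj_on (\<phi> X Y) (arrows C (FOb T X) Y)" "f \<in> \<phi> X Y ` arrows C (FOb T X) Y"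
        using bij[OF X Y] f by (auto simp: bij_betw_def)
      then obtain g where g: "g \<in> arrows C (FOb T X) Y" "\<phi> X Y g = f" by blast
      show "\<exists>!g. g \<in> arrows C (FOb T X) Y \<and> Cmp C X (FOb T X) Y g (u X) = f"
      proof (intro ex1I[of _ g] conjI g(1))
        show "Cmp C X (FOb T X) Y g (u X) = f" using pu[OF X Y g(1)] g(2) by simp
        fix v assume v: "v \<in> arrows C (FOb T X) Y \<and> Cmp C X (FOb T X) Y v (u X) = f"
        then have "\<phi> X Y v = \<phi> X Y g" using pu[OF X Y, of v] g(2) by simp
        then show "v = g" by (rule inj_onD[OF b(1)]) (use v g in blast)+
      qed
    qed
  next
    fix X Y f assume a: "X \<in> Obj C" "Y \<in> Obj C" "f \<in> arrows C X Y"
    then show "Cmp C X (FOb T X) (FOb T Y) (FAr T X Y f) (u X) = Cmp C X Y (FOb T Y) (u Y) f"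
      using n2[of Y X "FOb T Y" "Ident C (FOb T Y)" f] pu[of X "FOb T Y" "FAr T X Y f"] by (simp add: u_def[symmetric])
  qed
qed

text \<open>
  Composition with the unit is additive, and it is injective on arrows into the subcategory.
\<close>

lemma left_adjoint_additive:
  assumes L: "left_adjoint C (full_subcat C Q) T inclusion_functor"
  shows "additive_functor C (full_subcat C Q) T"
proof -
  obtain u where U: "\<And>X. X \<in> Obj C \<Longrightarrow> universal_arrow C Q X (FOb T X) (u X)"
    and n: "\<And>X Y f. \<lbrakk>X \<in> Obj C; Y \<in> Obj C; f \<in> arrows C X Y\<rbrakk>
      \<Longrightarrow> Cmp C X (FOb T X) (FOb T Y) (FAr T X Y f) (u X) = Cmp C X Y (FOb T Y) (u Y) f"
    using left_adjoint_universal_arrows[OF L] by blast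
  have T: "is_functor C (full_subcat C Q) T" using L by (simp add: left_adjoint_def)
  have TO [simp]: "FOb T X \<in> Obj C" "Q (FOb T X)" "u X \<in> arrows C X (FOb T X)" if "X \<in> Obj C" for X
    using U[OF that] by (auto simp: universal_arrow_def)
  have TA [simp]: "FAr T X Y f \<in> arrows C (FOb T X) (FOb T Y)" if "X \<in> Obj C" "Y \<in> Obj C" "f \<in> arrows C X Y" for X Y f
    using T that by (auto simp: is_functor_def)
  have "FAr T X Y (f \<otimes>\<^bsub>HomGrp C X Y\<^esub> g) = FAr T X Y f \<otimes>\<^bsub>HomGrp C (FOb T X) (FOb T Y)\<^esub> FAr T X Y g"
    if a [simp]: "X \<in> Obj C" "Y \<in> Obj C" "f \<in> arrows C X Y" "g \<in> arrows C X Y" for X Y f g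
    by (rule universal_arrow_eqI[OF U[OF a(1)], of "FOb T Y" _ _ "Cmp C X Y (FOb T Y) (u Y) (f \<otimes>\<^bsub>HomGrp C X Y\<^esub> g)"])
      (simp_all add: n comp_add_left comp_add_right)
  then show ?thesis using T by (simp add: additive_functor_def hom_def)
qed

end

text \<open>
  Arrows out of \<open>T Y\<close> into the subcategory are arrows out of \<open>Y\<close>, and this correspondence is compatible
  with composition with \<open>f\<close>.
\<close>

lemma left_adjoint_preserves_cokernel:
  assumes C: "preadditive_category C" and L: "left_adjoint C (full_subcat C Q) T inclusion_functor"
    and c: "is_cokernel C X Y Z f q"
  shows "is_cokernel (full_subcat C Q) (FOb T X) (FOb T Y) (FOb T Z) (FAr T X Y f) (FAr T Y Z q)"
proof -
  interpret preadditive_category C by fact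
  obtain u where U: "\<And>X. X \<in> Obj C \<Longrightarrow> universal_arrow C Q X (FOb T X) (u X)"
    and n: "\<And>X Y f. \<lbrakk>X \<in> Obj C; Y \<in> Obj C; f \<in> arrows C X Y\<rbrakk>
      \<Longrightarrow> Cmp C X (FOb T X) (FOb T Y) (FAr T X Y f) (u X) = Cmp C X Y (FOb T Y) (u Y) f"
    using left_adjoint_universal_arrows[OF L] by blast
  have T: "is_functor C (full_subcat C Q) T" using L by (simp add: left_adjoint_def)
  have TO [simp]: "FOb T X \<in> Obj C" "Q (FOb T X)" "u X \<in> arrows C X (FOb T X)" if "X \<in> Obj C" for X
    using U[OF that] by (auto simp: universal_arrow_def)
  have TA [simp]: "FAr T X Y f \<in> arrows C (FOb T X) (FOb T Y)" if "X \<in> Obj C" "Y \<in> Obj C" "f \<in> arrows C X Y" for X Y f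
    using T that by (auto simp: is_functor_def)
  have [simp]: "X \<in> Obj C" "Y \<in> Obj C" "Z \<in> Obj C" "f \<in> arrows C X Y" "q \<in> arrows C Y Z" "Cmp C X Y Z q f = zero_arr C X Z"
    using c by (auto simp: is_cokernel_def)
  have eqI: "g = g'" if "V \<in> Obj C" "W \<in> Obj C" "Q W" "g \<in> arrows C (FOb T V) W" "g' \<in> arrows C (FOb T V) W"
    "Cmp C V (FOb T V) W g (u V) = Cmp C V (FOb T V) W g' (u V)" for V W g g'
    by (rule universal_arrow_eqI[OF U[OF that(1)] that(2-5) _ that(6)[symmetric]]) (use that in auto)
  have Tqf: "Cmp C (FOb T X) (FOb T Y) (FOb T Z) (FAr T Y Z q) (FAr T X Y f) = zero_arr C (FOb T X) (FOb T Z)"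
  proof (rule eqI)
    have "Cmp C X (FOb T X) (FOb T Z) (Cmp C (FOb T X) (FOb T Y) (FOb T Z) (FAr T Y Z q) (FAr T X Y f)) (u X)
        = Cmp C X (FOb T Y) (FOb T Z) (FAr T Y Z q) (Cmp C X Y (FOb T Y) (u Y) f)"
      by (subst comp_assoc[symmetric]) (simp_all add: n)
    also have "\<dots> = Cmp C X Z (FOb T Z) (u Z) (Cmp C X Y Z q f)"
      by (subst (1 2) comp_assoc) (simp_all add: n)
    finally show "Cmp C X (FOb T X) (FOb T Z) (Cmp C (FOb T X) (FOb T Y) (FOb T Z) (FAr T Y Z q) (FAr T X Y f)) (u X)
       = Cmp C X (FOb T X) (FOb T Z) (zero_arr C (FOb T X) (FOb T Z)) (u X)" by simp
  qed auto
  have qu: "Cmp C Y (FOb T Y) W (Cmp C (FOb T Y) (FOb T Z) W g (FAr T Y Z q)) (u Y)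
      = Cmp C Y Z W (Cmp C Z (FOb T Z) W g (u Z)) q" if "W \<in> Obj C" "g \<in> arrows C (FOb T Z) W" for W g
    using that by (simp add: comp_assoc[symmetric] n)
  show ?thesis
    unfolding is_cokernel_def
  proof (intro conjI ballI impI)
    fix W h assume "W \<in> Obj (full_subcat C Q)" and "h \<in> arrows (full_subcat C Q) (FOb T Y) W"
      and "Cmp (full_subcat C Q) (FOb T X) (FOb T Y) W h (FAr T X Y f) = zero_arr (full_subcat C Q) (FOb T X) W"
    then have W [simp]: "W \<in> Obj C" "Q W" and h [simp]: "h \<in> arrows C (FOb T Y) W"
      and hz: "Cmp C (FOb T X) (FOb T Y) W h (FAr T X Y f) = zero_arr C (FOb T X) W" by auto
    have "Cmp C X Y W (Cmp C Y (FOb T Y) W h (u Y)) f = Cmp C X (FOb T X) W (Cmp C (FOb T X) (FOb T Y) W h (FAr T X Y f)) (u X)"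
      by (simp add: comp_assoc[symmetric] n)
    also have "\<dots> = zero_arr C X W" by (simp add: hz)
    finally have "Cmp C X Y W (Cmp C Y (FOb T Y) W h (u Y)) f = zero_arr C X W" .
    moreover have "Cmp C Y (FOb T Y) W h (u Y) \<in> arrows C Y W" by simp
    ultimately obtain g where g: "g \<in> arrows C Z W" "Cmp C Y Z W g q = Cmp C Y (FOb T Y) W h (u Y)"
      using c W(1) unfolding is_cokernel_def by blast
    obtain g' where g': "g' \<in> arrows C (FOb T Z) W" "Cmp C Z (FOb T Z) W g' (u Z) = g"
      using U[OF \<open>Z \<in> Obj C\<close>] g(1) W unfolding universal_arrow_def by blast
    have "\<exists>!v. v \<in> arrows C (FOb T Z) W \<and> Cmp C (FOb T Y) (FOb T Z) W v (FAr T Y Z q) = h"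
    proof (intro ex1I[of _ g'] conjI g')
      show "Cmp C (FOb T Y) (FOb T Z) W g' (FAr T Y Z q) = h"
      proof (rule eqI[of Y W])
        show "Cmp C Y (FOb T Y) W (Cmp C (FOb T Y) (FOb T Z) W g' (FAr T Y Z q)) (u Y) = Cmp C Y (FOb T Y) W h (u Y)"
          by (simp only: qu[OF W(1) g'(1)] g'(2) g(2))
      qed (use g'(1) in auto)
      fix v assume v: "v \<in> arrows C (FOb T Z) W \<and> Cmp C (FOb T Y) (FOb T Z) W v (FAr T Y Z q) = h"
      then have "Cmp C Y Z W (Cmp C Z (FOb T Z) W v (u Z)) q = Cmp C Y Z W g q"
        using qu[OF W(1), of v] g(2) by (simp only:)
      moreover have "Cmp C Z (FOb T Z) W v (u Z) \<in> arrows C Z W" using v by simp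
      ultimately have "Cmp C Z (FOb T Z) W v (u Z) = g"
        using cokernel_epi[OF c] g(1) W(1) unfolding epi_arr_def by blast
      then show "v = g'" using v g' by (intro eqI[of Z W v g']) simp_all
    qed
    then show "\<exists>!v. v \<in> arrows (full_subcat C Q) (FOb T Z) W \<and> Cmp (full_subcat C Q) (FOb T Y) (FOb T Z) W v (FAr T Y Z q) = h"
      by simp
  qed (use Tqf in auto)
qed

section \<open>The reflection onto functors vanishing on projectives\<close>

text \<open>
  For a finitely presented functor this is the smallest subfunctor that contains all values at
  projective objects.  The reflection \<open>(-)\<^sup>0\<close> divides it out, so such a functor is projectively
  generated if and only if its reflection is zero.
\<close>

definition projective_part :: "('o, 'u) acat \<Rightarrow> ('o, 'u) presheaf \<Rightarrow> 'o \<Rightarrow> 'u set" where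
  "projective_part C F X = {FAr F Q X h y | Q h y. projective C Q \<and> h \<in> arrows C X Q \<and> y \<in> sections F Q}"

definition projectively_generated :: "('o, 'u) acat \<Rightarrow> ('o, 'u) presheaf \<Rightarrow> bool" where
  "projectively_generated C F \<longleftrightarrow> (\<forall>X\<in>Obj C. sections F X \<subseteq> projective_part C F X)"

lemma fp0_projective_part_zero:
  assumes F: "F \<in> Obj (presheaf_cat C)" and G: "G \<in> Obj (presheaf_cat C)"
    and t: "\<And>P. projective C P \<Longrightarrow> trivial_group (FOb G P)" and a: "\<alpha> \<in> arrows (presheaf_cat C) F G"
    and X: "X \<in> Obj C" and z: "z \<in> projective_part C F X"
  shows "\<alpha> X z = \<one>\<^bsub>FOb G X\<^esub>"
proof -
  obtain Q h y where Q: "projective C Q" and h: "h \<in> arrows C X Q" and y: "y \<in> sections F Q" and z: "z = FAr F Q X h y"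
    using z by (auto simp: projective_part_def)
  have QO: "Q \<in> Obj C" using Q by (simp add: projective_def)
  have "\<alpha> Q y = \<one>\<^bsub>FOb G Q\<^esub>" using nat_closed[OF F G a QO y] t[OF Q] by (simp add: trivial_group_def)
  then show ?thesis
    using nat_natural[OF F G a X QO h y] z group_hom.hom_one[OF presheaf_group_hom[OF G X QO h]] by simp
qed

locale abelian_enough_projectives = abelian_category C for C :: "('o, 'm) acat" +
  assumes enough: "enough_projectives C"
begin

text \<open>
  If \<open>x\<close> generates \<open>F\<close> over \<open>A\<close> and the projective \<open>P\<close> maps onto \<open>A\<close>, then every section over a projective is a
  restriction of \<open>x\<close> along an arrow that lifts to \<open>P\<close>.  So one projective suffices, and the quotient
  of \<open>F\<close> by its projective part is finitely presented.
\<close>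

lemma projective_part_generated:
  assumes F: "finitely_presented C F"
  obtains P x where "projective C P" "x \<in> sections F P"
    "\<And>X. X \<in> Obj C \<Longrightarrow> projective_part C F X = generated_by C F P x X"
proof -
  obtain B A b x where pr: "presented_by C F B A b x" using F fp_iff_presented by blast
  then have [simp]: "A \<in> Obj C" and x: "x \<in> sections F A"
    and gen: "\<And>X z. \<lbrakk>X \<in> Obj C; z \<in> sections F X\<rbrakk> \<Longrightarrow> \<exists>h\<in>arrows C X A. z = FAr F A X h x"
    by (auto simp: presented_by_def)
  note F' = fp_presheaf[OF F]
  obtain P e where P: "projective C P" and e: "epi_arr C P A e"
    using enough \<open>A \<in> Obj C\<close> unfolding enough_projectives_def by blast
  then have [simp]: "P \<in> Obj C" "e \<in> arrows C P A" by (auto simp: epi_arr_def)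
  have xP: "FAr F A P e x \<in> sections F P" using presheaf_closed[OF F' _ _ _ x] by simp
  have "projective_part C F X = generated_by C F P (FAr F A P e x) X" if X [simp]: "X \<in> Obj C" for X
  proof (intro equalityI subsetI)
    fix z assume "z \<in> generated_by C F P (FAr F A P e x) X"
    then show "z \<in> projective_part C F X" using P xP unfolding generated_by_def projective_part_def by blast
  next
    fix z assume "z \<in> projective_part C F X"
    then obtain Q h y where Q: "projective C Q" and h [simp]: "h \<in> arrows C X Q" and y: "y \<in> sections F Q" and z: "z = FAr F Q X h y"
      by (auto simp: projective_part_def)
    have QO [simp]: "Q \<in> Obj C" using Q by (simp add: projective_def)
    obtain k where k: "k \<in> arrows C Q A" "y = FAr F A Q k x" using gen[OF QO y] by blast
    obtain k' where k' [simp]: "k' \<in> arrows C Q P" "Cmp C Q P A e k' = k" using projective_lift[OF Q e k(1)] .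
    have "y = FAr F P Q k' (FAr F A P e x)"
      using presheaf_comp[OF F' QO _ _ k'(1) _ x, of e] k k' by simp
    then have "z = FAr F P X (Cmp C X Q P k' h) (FAr F A P e x)"
      using z presheaf_comp[OF F' X QO _ h k'(1) xP] by simp
    then show "z \<in> generated_by C F P (FAr F A P e x) X" by (auto simp: generated_by_def)
  qed
  then show ?thesis using that P xP by blast
qed

text \<open>
  A map into a functor that vanishes on projectives kills every section that is restricted from a
  projective, and the quotient by these sections does vanish on projectives.
\<close>

lemma projective_part_quotient:
  assumes fF: "finitely_presented C F"
  obtains R u where "R \<in> Obj (fp0 C)"
    "universal_arrow (fp C) (\<lambda>F. \<forall>P. projective C P \<longrightarrow> trivial_group (FOb F P)) F R u"
    "\<And>X z. \<lbrakk>X \<in> Obj C; z \<in> sections F X\<rbrakk> \<Longrightarrow> u X z = \<one>\<^bsub>FOb R X\<^esub> \<longleftrightarrow> z \<in> projective_part C F X"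
proof -
  note F = fp_presheaf[OF fF] and ad = fp_additive[OF fF]
  obtain P x where P: "projective C P" and x: "x \<in> sections F P"
    and pp: "\<And>X. X \<in> Obj C \<Longrightarrow> projective_part C F X = generated_by C F P x X"
    using projective_part_generated[OF fF] by blast
  have PO: "P \<in> Obj C" using P projective_obj by blast
  obtain R u where R: "R \<in> Obj (presheaf_cat C)" and u: "u \<in> arrows (presheaf_cat C) F R" and s: "presheaf_surj C F R u"
    and k: "\<And>X z. \<lbrakk>X \<in> Obj C; z \<in> sections F X\<rbrakk> \<Longrightarrow> u X z = \<one>\<^bsub>FOb R X\<^esub> \<longleftrightarrow> z \<in> generated_by C F P x X"
    using presheaf_quotient[OF F generated_by_sub[OF ad PO x]] by blast
  have fR: "finitely_presented C R" by (rule fp_quotient_generated[OF fF PO x R u s k])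
  have triv: "trivial_group (FOb R Q)" if Q: "projective C Q" for Q
  proof -
    have QO: "Q \<in> Obj C" using Q projective_obj by blast
    interpret comm_group "FOb R Q" using presheaf_group[OF R QO] .
    have "w = \<one>\<^bsub>FOb R Q\<^esub>" if w: "w \<in> sections R Q" for w
    proof -
      obtain z where z: "z \<in> sections F Q" "w = u Q z" using presheaf_surjE[OF s QO w] by blast
      have "z \<in> projective_part C F Q"
        unfolding projective_part_def using Q z(1) presheaf_id[OF F QO z(1)] ident_closed[OF QO] by force
      then show ?thesis using k[OF QO z(1)] pp[OF QO] z by simp
    qed
    then show ?thesis by (auto simp: trivial_group_subset)
  qed
  have "universal_arrow (fp C) (\<lambda>F. \<forall>P. projective C P \<longrightarrow> trivial_group (FOb F P)) F R u"
    unfolding universal_arrow_def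
  proof (intro conjI ballI impI)
    show "R \<in> Obj (fp C)" "\<forall>P. projective C P \<longrightarrow> trivial_group (FOb R P)" "u \<in> arrows (fp C) F R"
      using fR triv u by auto
    fix G f assume G: "G \<in> Obj (fp C)" and tG: "\<forall>P. projective C P \<longrightarrow> trivial_group (FOb G P)" and f: "f \<in> arrows (fp C) F G"
    have G': "G \<in> Obj (presheaf_cat C)" and f': "f \<in> arrows (presheaf_cat C) F G" using G f fp_presheaf by auto
    have "f X z = \<one>\<^bsub>FOb G X\<^esub>" if X: "X \<in> Obj C" and z: "z \<in> sections F X" and "u X z = \<one>\<^bsub>FOb R X\<^esub>" for X z
    proof (rule fp0_projective_part_zero[OF F G' _ f' X])
      show "trivial_group (FOb G P)" if "projective C P" for P using tG that by blast
      show "z \<in> projective_part C F X" using k[OF X z] pp[OF X] that(3) by simp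
    qed
    then obtain g where g: "g \<in> arrows (presheaf_cat C) R G" "Cmp (presheaf_cat C) F R G g u = f"
      using factor_through_surj[OF F R G' u s f'] by blast
    show "\<exists>!g. g \<in> arrows (fp C) R G \<and> Cmp (fp C) F R G g u = f"
      using g epi_if_surj[OF F R u s] G' unfolding epi_arr_def by auto
  qed
  then show ?thesis using that[of R u] k pp fR triv by simp
qed

lemma reflect0_left_adjoint: "left_adjoint (fp C) (fp0 C) (reflect0 C) inclusion_functor"
  unfolding reflect0_def fp0_def
proof (rule someI_ex, rule preadditive_category.left_adjoint_if_universal_arrows[OF preadditive_fp])
  fix F assume "F \<in> Obj (fp C)"
  then have "finitely_presented C F" by simp
  then show "\<exists>R u. universal_arrow (fp C) (\<lambda>F. \<forall>P. projective C P \<longrightarrow> trivial_group (FOb F P)) F R u"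
    by (rule projective_part_quotient) blast
qed

lemma reflect0_additive: "additive_functor (fp C) (fp0 C) (reflect0 C)"
  using reflect0_left_adjoint preadditive_category.left_adjoint_additive[OF preadditive_fp]
  unfolding fp0_def by blast

lemma reflect0_unit:
  assumes "finitely_presented C F"
  shows "\<exists>u. universal_arrow (fp C) (\<lambda>F. \<forall>P. projective C P \<longrightarrow> trivial_group (FOb F P)) F (FOb (reflect0 C) F) u"
proof (rule preadditive_category.left_adjoint_universal_arrows[OF preadditive_fp reflect0_left_adjoint[unfolded fp0_def]])
  fix u assume "\<And>F. F \<in> Obj (fp C) \<Longrightarrow>
    universal_arrow (fp C) (\<lambda>F. \<forall>P. projective C P \<longrightarrow> trivial_group (FOb F P)) F (FOb (reflect0 C) F) (u F)"
  from this[of F] assms show ?thesis by auto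
qed

text \<open>
  The quotient map that divides out the projective part factors through the unit, and the unit
  kills the projective part.
\<close>

lemma reflect0_zero_iff:
  assumes fF: "finitely_presented C F"
  shows "is_zero (fp0 C) (FOb (reflect0 C) F) \<longleftrightarrow> projectively_generated C F"
proof -
  note F = fp_presheaf[OF fF]
  let ?Q = "\<lambda>F. \<forall>P. projective C P \<longrightarrow> trivial_group (FOb F P)" and ?T = "FOb (reflect0 C) F"
  obtain u where u: "universal_arrow (fp C) ?Q F ?T u" using reflect0_unit[OF fF] by blast
  then have T: "finitely_presented C ?T" "?Q ?T" and uF: "u \<in> arrows (presheaf_cat C) F ?T"
    by (auto simp: universal_arrow_def)
  note T' = fp_presheaf[OF T(1)]
  interpret fp0: preadditive_category "fp0 C" by (rule preadditive_fp0)
  interpret psh: preadditive_category "presheaf_cat C" by (rule preadditive_presheaf_cat)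
  show ?thesis
  proof
    assume z: "is_zero (fp0 C) ?T"
    obtain R v where R: "R \<in> Obj (fp0 C)" and v: "universal_arrow (fp C) ?Q F R v"
      and k: "\<And>X z. \<lbrakk>X \<in> Obj C; z \<in> sections F X\<rbrakk> \<Longrightarrow> v X z = \<one>\<^bsub>FOb R X\<^esub> \<longleftrightarrow> z \<in> projective_part C F X"
      using projective_part_quotient[OF fF] by blast
    have R': "R \<in> Obj (presheaf_cat C)" using R fp_presheaf by simp
    have "v \<in> arrows (presheaf_cat C) F R" using v by (simp add: universal_arrow_def)
    then obtain g where g: "g \<in> arrows (presheaf_cat C) ?T R" "Cmp (presheaf_cat C) F ?T R g u = v"
      using u R unfolding universal_arrow_def by (metis (no_types, lifting) fp0_simps(1) fp_simps(1-3) mem_Collect_eq)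
    then have "g = zero_arr (presheaf_cat C) ?T R" using fp0.is_zero_from[OF z R] by simp
    then have "v = zero_arr (presheaf_cat C) F R" using g psh.comp_zero_left[OF F T' R' uF] by simp
    then show "projectively_generated C F"
      unfolding projectively_generated_def using k by auto
  next
    assume pg: "projectively_generated C F"
    have "u = zero_arr (presheaf_cat C) F ?T"
    proof (rule nat_eqI[OF F T' uF psh.zero_closed[OF F T']])
      fix X z assume X: "X \<in> Obj C" and z: "z \<in> sections F X"
      then have "z \<in> projective_part C F X" using pg by (auto simp: projectively_generated_def)
      then show "u X z = zero_arr (presheaf_cat C) F ?T X z"
        using fp0_projective_part_zero[OF F T' _ uF X, of z] T(2) X z by simp
    qed
    then have "Cmp (presheaf_cat C) F ?T ?T (zero_arr (presheaf_cat C) ?T ?T) u = u"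
      using psh.comp_zero_left[OF F T' T' uF] by simp
    then have "Ident (fp C) ?T = zero_arr (fp C) ?T ?T"
      using universal_arrow_eqI[OF u, of ?T "Ident (fp C) ?T" "zero_arr (fp C) ?T ?T" u]
        psh.ident_left[OF F T' uF] psh.ident_closed[OF T'] psh.zero_closed[OF T' T'] T uF
      by (simp only: fp_simps mem_Collect_eq)
    then show "is_zero (fp0 C) ?T" using T by (simp add: fp0.is_zero_iff_ident)
  qed
qed

end

section \<open>The first left derived functor of the reflection\<close>

definition projectively_presented :: "('o, 'u) acat \<Rightarrow> ('o, 'u) presheaf \<Rightarrow> bool" where
  "projectively_presented C F \<longleftrightarrow>
     (\<exists>P1 P0 d x. projective C P1 \<and> projective C P0 \<and> presented_by C F P1 P0 d x)"

context abelian_category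
begin

text \<open>
  Epimorphisms are pointwise surjective, so the section of \<open>H\<close> that corresponds to \<open>f\<close> lifts.
\<close>

lemma yoneda_projective:
  assumes B: "B \<in> Obj C"
  shows "projective (fp C) (yoneda_ob C B)"
  unfolding projective_def
proof (intro conjI allI impI ballI)
  fix G H e f assume e: "epi_arr (fp C) G H e" and f: "f \<in> arrows (fp C) (yoneda_ob C B) H"
  then have G: "finitely_presented C G" and H: "finitely_presented C H" and e': "e \<in> arrows (presheaf_cat C) G H"
    and s: "presheaf_surj C G H e" and f': "f \<in> arrows (presheaf_cat C) (yoneda_ob C B) H"
    using fp_epi_iff by auto
  note G' = fp_presheaf[OF G] and H' = fp_presheaf[OF H] and Y = yoneda_presheaf[OF B]
  have "f B (Ident C B) \<in> sections H B" using nat_closed[OF Y H' f' B] B by simp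
  then obtain x where x: "x \<in> sections G B" "e B x = f B (Ident C B)"
    using s B by (metis imageE presheaf_surj_def)
  note g = yoneda_el_arrow[OF fp_additive[OF G] B x(1)]
  have "Cmp (presheaf_cat C) (yoneda_ob C B) G H e (yoneda_el C G B x) = f"
  proof (rule nat_eqI[OF Y H' psh_comp_closed[OF Y G' H' g e'] f'])
    fix X h assume X: "X \<in> Obj C" and h: "h \<in> sections (yoneda_ob C B) X"
    then show "Cmp (presheaf_cat C) (yoneda_ob C B) G H e (yoneda_el C G B x) X h = f X h"
      using nat_natural[OF G' H' e' X B _ x(1)] yoneda_nat_apply[OF H' B f' X] x(2) by simp
  qed
  then show "\<exists>g\<in>arrows (fp C) (yoneda_ob C B) G. Cmp (fp C) (yoneda_ob C B) G H e g = f" using g by auto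
qed (use B in simp)

lemma yoneda_exactI:
  assumes [simp]: "B \<in> Obj C" "D \<in> Obj C" "E \<in> Obj C" "f \<in> arrows C B D" "g \<in> arrows C D E"
    and ex: "\<And>X h. \<lbrakk>X \<in> Obj C; h \<in> arrows C X D\<rbrakk> \<Longrightarrow> Cmp C X D E g h = zero_arr C X E \<longleftrightarrow> (\<exists>u\<in>arrows C X B. h = Cmp C X B D f u)"
  shows "exact_at (fp C) (yoneda_ob C B) (yoneda_ob C D) (yoneda_ob C E) (yoneda_ar C B D f) (yoneda_ar C D E g)"
proof (rule fp_exactI)
  show "presheaf_exact C (yoneda_ob C B) (yoneda_ob C D) (yoneda_ob C E) (yoneda_ar C B D f) (yoneda_ar C D E g)"
    unfolding presheaf_exact_def kernel_def using ex by (auto simp: image_iff)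
qed auto

lemma kernel_factor_iff:
  assumes "is_kernel C K X Y k f" "W \<in> Obj C" "h \<in> arrows C W X"
  shows "Cmp C W X Y f h = zero_arr C W Y \<longleftrightarrow> (\<exists>u\<in>arrows C W K. h = Cmp C W K X k u)"
proof
  assume "Cmp C W X Y f h = zero_arr C W Y"
  then show "\<exists>u\<in>arrows C W K. h = Cmp C W K X k u" using assms unfolding is_kernel_def by metis
next
  assume "\<exists>u\<in>arrows C W K. h = Cmp C W K X k u"
  then obtain u where "u \<in> arrows C W K" "h = Cmp C W K X k u" by blast
  then show "Cmp C W X Y f h = zero_arr C W Y"
    using assms by (simp add: is_kernel_def comp_assoc)
qed

text \<open>
  The kernel of a map of representables is representable, so a presentation prolongs to a
  resolution of length two by representables, continued by the zero object.
\<close>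

lemma presentation_resolution:
  assumes pr: "presented_by C F B A b x" and k: "is_kernel C K B A k b" and Z: "is_zero C Z"
  defines "Q \<equiv> \<lambda>n. if n = 0 then A else if n = 1 then B else if n = 2 then K else Z"
    and "m \<equiv> \<lambda>n. if n = 0 then b else if n = 1 then k else if n = 2 then zero_arr C Z K else zero_arr C Z Z"
  shows "projective_resolution (fp C) F (\<lambda>n. yoneda_ob C (Q n)) (\<lambda>n. yoneda_ar C (Q (Suc n)) (Q n) (m n)) (yoneda_el C F A x)"
proof -
  note p = pr[unfolded presented_by_def]
  have ad: "additive_presheaf C F" and x: "x \<in> sections F A" using p by auto
  have [simp]: "A \<in> Obj C" "B \<in> Obj C" "b \<in> arrows C B A" "K \<in> Obj C" "Z \<in> Obj C" "k \<in> arrows C K B"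
    using p k Z by (auto simp: is_kernel_def is_zero_def)
  have fF: "finitely_presented C F" using pr by (rule presented_by_imp_fp)
  have Qm: "Q n \<in> Obj C" "m n \<in> arrows C (Q (Suc n)) (Q n)" for n by (auto simp: Q_def m_def)
  note e = yoneda_el_arrow[OF ad \<open>A \<in> Obj C\<close> x] and F = fp_presheaf[OF fF]
  have surj: "presheaf_surj C (yoneda_ob C A) F (yoneda_el C F A x)"
    unfolding presheaf_surj_def using p presheaf_closed[OF F] by (auto simp: image_iff)
  have ex: "presheaf_exact C (yoneda_ob C B) (yoneda_ob C A) F (yoneda_ar C B A b) (yoneda_el C F A x)"
    unfolding presheaf_exact_def kernel_def using p by (auto simp: image_iff)
  have kz: "(Cmp C X K B k h = zero_arr C X B) = (\<exists>u\<in>arrows C X Z. h = Cmp C X Z K (zero_arr C Z K) u)"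
    if [simp]: "X \<in> Obj C" "h \<in> arrows C X K" for X h
    using mono_zeroD[OF kernel_mono[OF k], of X h] by (auto intro!: exI[of _ "zero_arr C X Z"])
  have zz: "(Cmp C X Z W (zero_arr C Z W) h = zero_arr C X W) = (\<exists>u\<in>arrows C X Z. h = Cmp C X Z Z (zero_arr C Z Z) u)"
    if [simp]: "X \<in> Obj C" "h \<in> arrows C X Z" "W \<in> Obj C" for X h W
    using is_zero_to[OF Z, of X h] by (auto intro!: exI[of _ "zero_arr C X Z"])
  have "exact_at (fp C) (yoneda_ob C (Q (Suc (Suc n)))) (yoneda_ob C (Q (Suc n))) (yoneda_ob C (Q n))
      (yoneda_ar C (Q (Suc (Suc n))) (Q (Suc n)) (m (Suc n))) (yoneda_ar C (Q (Suc n)) (Q n) (m n))" for n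
  proof (rule yoneda_exactI)
    fix X h assume X: "X \<in> Obj C" "h \<in> arrows C X (Q (Suc n))"
    consider "n = 0" | "n = 1" | "n = 2" | "n > 2" by linarith
    then show "(Cmp C X (Q (Suc n)) (Q n) (m n) h = zero_arr C X (Q n)) =
        (\<exists>u\<in>arrows C X (Q (Suc (Suc n))). h = Cmp C X (Q (Suc (Suc n))) (Q (Suc n)) (m (Suc n)) u)"
      by cases (use X kernel_factor_iff[OF k] kz zz in \<open>auto simp: Q_def m_def numeral_2_eq_2\<close>)
  qed (use Qm in auto)
  moreover have "exact_at (fp C) (yoneda_ob C B) (yoneda_ob C A) F (yoneda_ar C B A b) (yoneda_el C F A x)"
    by (rule fp_exactI[OF _ _ fF _ e ex]) auto
  moreover have "epi_arr (fp C) (yoneda_ob C A) F (yoneda_el C F A x)"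
    unfolding fp_epi_iff using fF e surj by simp
  ultimately show ?thesis
    unfolding projective_resolution_def using yoneda_projective Qm by (auto simp: Q_def m_def)
qed

end

context abelian_enough_projectives
begin

lemma projectively_generated_if_surj:
  assumes P: "projective C P" and G: "G \<in> Obj (presheaf_cat C)"
    and e: "e \<in> arrows (presheaf_cat C) (yoneda_ob C P) G" and s: "presheaf_surj C (yoneda_ob C P) G e"
  shows "projectively_generated C G"
  unfolding projectively_generated_def
proof (intro ballI subsetI)
  fix X w assume X: "X \<in> Obj C" and w: "w \<in> sections G X"
  note PO = projective_obj[OF P]
  obtain h where h: "h \<in> arrows C X P" "w = e X h"
    using s X w unfolding presheaf_surj_def by fastforce
  have "e P (Ident C P) \<in> sections G P" using nat_closed[OF yoneda_presheaf[OF PO] G e PO] PO by simp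
  moreover have "w = FAr G P X h (e P (Ident C P))" using h yoneda_nat_apply[OF G PO e X h(1)] by simp
  ultimately show "w \<in> projective_part C G X" unfolding projective_part_def using P h(1) by blast
qed

text \<open>
  Here \<open>I\<close> is the syzygy of \<open>F\<close>, the image of \<open>Hom(-, B)\<close> in \<open>Hom(-, P)\<close>.  As \<open>P\<close> is projective,
  the reflection \<open>T\<close> kills \<open>Hom(-, P)\<close>.  The first homology of the reflected resolution is therefore
  the cokernel of \<open>T Hom(-, K) \<rightarrow> T Hom(-, B)\<close>, which is \<open>T I\<close> since \<open>T\<close> preserves cokernels.
  The derived functor is evaluated on an unspecified resolution; the comparison of resolutions
  relates it to this one.
\<close>

lemma left_derived1_zero_iff:
  assumes pr: "presented_by C F B P b x" and P: "projective C P"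
    and fI: "finitely_presented C I" and i: "\<iota> \<in> arrows (presheaf_cat C) I (yoneda_ob C P)" and j: "presheaf_inj C I \<iota>"
    and e: "epi_arr (fp C) (yoneda_ob C B) I e" and ie: "Cmp (presheaf_cat C) (yoneda_ob C B) I (yoneda_ob C P) \<iota> e = yoneda_ar C B P b"
  shows "is_zero (fp0 C) (left_derived1 (fp C) (fp0 C) (reflect0 C) F) \<longleftrightarrow> projectively_generated C I"
proof -
  have [simp]: "B \<in> Obj C" "P \<in> Obj C" "b \<in> arrows C B P" using pr by (auto simp: presented_by_def)
  obtain K k where k: "is_kernel C K B P k b" using ex_kernel[of B P b] by auto
  then have [simp]: "K \<in> Obj C" "k \<in> arrows C K B" by (auto simp: is_kernel_def)
  obtain Z where Z: "is_zero C Z" using ex_zero by blast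
  define Q where "Q n = (if n = 0 then P else if n = 1 then B else if n = 2 then K else Z)" for n :: nat
  define m where "m n = (if n = 0 then b else if n = 1 then k else if n = 2 then zero_arr C Z K else zero_arr C Z Z)" for n :: nat
  let ?Q = "\<lambda>n. yoneda_ob C (Q n)" and ?q = "\<lambda>n. yoneda_ar C (Q (Suc n)) (Q n) (m n)" and ?T = "reflect0 C"
  have res: "projective_resolution (fp C) F ?Q ?q (yoneda_el C F P x)"
    using presentation_resolution[OF pr k Z] unfolding Q_def m_def .
  let ?TP = "FOb ?T (yoneda_ob C P)" and ?TB = "FOb ?T (yoneda_ob C B)" and ?TK = "FOb ?T (yoneda_ob C K)"
  let ?Tb = "FAr ?T (yoneda_ob C B) (yoneda_ob C P) (yoneda_ar C B P b)"
    and ?Tk = "FAr ?T (yoneda_ob C K) (yoneda_ob C B) (yoneda_ar C K B k)"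
    and ?Te = "FAr ?T (yoneda_ob C B) I e"
  have Qs: "Q 0 = P" "Q 1 = B" "Q (Suc 0) = B" "Q 2 = K" "Q (Suc 1) = K" "m 0 = b" "m 1 = k"
    by (auto simp: Q_def m_def)
  interpret fp: preadditive_category "fp C" by (rule preadditive_fp)
  interpret fp0: preadditive_category "fp0 C" by (rule preadditive_fp0)
  note T = reflect0_additive
  have TO: "FOb ?T G \<in> Obj (fp0 C)" if "finitely_presented C G" for G
    using T that by (auto simp: additive_functor_def is_functor_def)
  have TA: "FAr ?T G H f \<in> arrows (fp0 C) (FOb ?T G) (FOb ?T H)"
    if "finitely_presented C G" "finitely_presented C H" "f \<in> arrows (presheaf_cat C) G H" for G H f
    using T that unfolding additive_functor_def is_functor_def by simp
  have o [simp]: "?TP \<in> Obj (fp0 C)" "?TB \<in> Obj (fp0 C)" "?TK \<in> Obj (fp0 C)" using TO yoneda_fp by simp_all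
  have a [simp]: "?Tb \<in> arrows (fp0 C) ?TB ?TP" "?Tk \<in> arrows (fp0 C) ?TK ?TB" using TA by simp_all
  have "presheaf_surj C (yoneda_ob C P) (yoneda_ob C P) (Ident (presheaf_cat C) (yoneda_ob C P))"
    by (simp add: presheaf_surj_def image_iff)
  then have "projectively_generated C (yoneda_ob C P)"
    using projectively_generated_if_surj[OF P _ psh_ident_closed] by simp
  then have zP: "is_zero (fp0 C) ?TP" using reflect0_zero_iff by simp
  \<comment> \<open>As \<open>T Hom(-, P)\<close> is zero, all of \<open>T Hom(-, B)\<close> consists of cycles.\<close>
  have kid: "is_kernel (fp0 C) ?TB ?TB ?TP (Ident (fp0 C) ?TB) ?Tb"
    unfolding is_kernel_def
  proof (intro conjI ballI impI)
    show "Cmp (fp0 C) ?TB ?TB ?TP ?Tb (Ident (fp0 C) ?TB) = zero_arr (fp0 C) ?TB ?TP"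
      using fp0.is_zero_to[OF zP o(2)] fp0.comp_closed[OF o(2,2,1) fp0.ident_closed[OF o(2)] a(1)] by blast
    fix W h assume W: "W \<in> Obj (fp0 C)" and h: "h \<in> arrows (fp0 C) W ?TB"
    then show "\<exists>!u. u \<in> arrows (fp0 C) W ?TB \<and> Cmp (fp0 C) W ?TB ?TB (Ident (fp0 C) ?TB) u = h"
      using fp0.ident_left[OF W o(2)] by (intro ex1I[of _ h]) auto
  qed (rule o a fp0.ident_closed[OF o(2)])+
  have Tk': "?Tk = Cmp (fp0 C) ?TK ?TB ?TB (Ident (fp0 C) ?TB) ?Tk"
    using fp0.ident_left[OF o(3,2) a(2)] by simp
  have coker: "is_cokernel (fp0 C) ?TK ?TB (FOb ?T I) ?Tk ?Te"
    unfolding fp0_def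
  proof (rule left_adjoint_preserves_cokernel[OF preadditive_fp reflect0_left_adjoint[unfolded fp0_def]])
    have eI: "e \<in> arrows (presheaf_cat C) (yoneda_ob C B) I" and es: "presheaf_surj C (yoneda_ob C B) I e"
      using e fp_epi_iff by auto
    note I = fp_presheaf[OF fI]
    have "presheaf_exact C (yoneda_ob C K) (yoneda_ob C B) I (yoneda_ar C K B k) e"
      unfolding presheaf_exact_def kernel_def
    proof (intro ballI)
      fix X assume X [simp]: "X \<in> Obj C"
      interpret i: group_hom "FOb I X" "HomGrp C X P" "\<iota> X"
        using nat_hom[OF I yoneda_presheaf[OF \<open>P \<in> Obj C\<close>] i X] by simp
      have "e X h = \<one>\<^bsub>FOb I X\<^esub> \<longleftrightarrow> (\<exists>u\<in>arrows C X K. h = Cmp C X K B k u)" if h: "h \<in> arrows C X B" for h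
      proof -
        have eh: "e X h \<in> sections I X" using nat_closed[OF yoneda_presheaf I eI X] h by simp
        have "e X h = \<one>\<^bsub>FOb I X\<^esub> \<longleftrightarrow> \<iota> X (e X h) = zero_arr C X P"
          using j X eh i.G.one_closed i.hom_one unfolding presheaf_inj_def inj_on_def by metis
        also have "\<iota> X (e X h) = Cmp C X B P b h"
          using fun_cong[OF fun_cong[OF ie], of X h] h by simp
        finally show ?thesis using kernel_factor_iff[OF k X h] by simp
      qed
      then show "yoneda_ar C K B k X ` sections (yoneda_ob C K) X = {z \<in> sections (yoneda_ob C B) X. e X z = \<one>\<^bsub>FOb I X\<^esub>}"
        by (auto simp: image_iff)
    qed
    then show "is_cokernel (fp C) (yoneda_ob C K) (yoneda_ob C B) I (yoneda_ar C K B k) e"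
      unfolding fp_def using fI I eI es by (intro cokernel_full_subcat cokernel_if_pointwise) auto
  qed
  have hom: "is_homology (fp0 C) (FOb ?T (?Q 2)) (FOb ?T (?Q 1)) (FOb ?T (?Q 0))
      (FAr ?T (?Q 2) (?Q 1) (?q 1)) (FAr ?T (?Q 1) (?Q 0) (?q 0)) (FOb ?T I)"
    unfolding is_homology_def Qs using kid Tk' coker by blast
  define H where "H = left_derived1 (fp C) (fp0 C) ?T F"
  have "\<exists>R d \<epsilon>. projective_resolution (fp C) F R d \<epsilon> \<and> is_homology (fp0 C) (FOb ?T (R 2)) (FOb ?T (R 1)) (FOb ?T (R 0))
      (FAr ?T (R 2) (R 1) (d 1)) (FAr ?T (R 1) (R 0) (d 0)) H"
    unfolding H_def left_derived1_def by (rule someI[of _ "FOb ?T I"]) (use res hom in blast)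
  then obtain R d \<epsilon> where R: "projective_resolution (fp C) F R d \<epsilon>"
    and RH: "is_homology (fp0 C) (FOb ?T (R 2)) (FOb ?T (R 1)) (FOb ?T (R 0))
      (FAr ?T (R 2) (R 1) (d 1)) (FAr ?T (R 1) (R 0) (d 0)) H" by blast
  have "is_zero (fp0 C) H \<longleftrightarrow> is_zero (fp0 C) (FOb ?T I)"
  proof
    assume zH: "is_zero (fp0 C) H"
    have "epi_arr (fp0 C) (FOb ?T (?Q 2)) ?TB ?Tk"
      by (rule first_homology_transfer[OF preadditive_fp preadditive_fp0 T R res RH zH])
        (use kid Tk' a in \<open>simp_all only: Qs\<close>)
    then show "is_zero (fp0 C) (FOb ?T I)" using fp0.cokernel_zero_iff_epi[OF coker] by (simp only: Qs)
  next
    assume zI: "is_zero (fp0 C) (FOb ?T I)"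
    obtain L l f' q where L: "is_kernel (fp0 C) L (FOb ?T (R 1)) (FOb ?T (R 0)) l (FAr ?T (R 1) (R 0) (d 0))"
      and f': "FAr ?T (R 2) (R 1) (d 1) = Cmp (fp0 C) (FOb ?T (R 2)) L (FOb ?T (R 1)) l f'"
      and q: "is_cokernel (fp0 C) (FOb ?T (R 2)) L H f' q"
      using RH unfolding is_homology_def by blast
    have "f' \<in> arrows (fp0 C) (FOb ?T (R 2)) L" using q by (simp add: is_cokernel_def)
    then have "epi_arr (fp0 C) (FOb ?T (R 2)) L f'"
      by (rule first_homology_transfer[OF preadditive_fp preadditive_fp0 T res R hom zI L f'])
    then show "is_zero (fp0 C) H" using fp0.cokernel_zero_iff_epi[OF q] by simp
  qed
  then show ?thesis using reflect0_zero_iff[OF fI] by (simp add: H_def)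
qed

text \<open>
  If \<open>F\<^sup>0 = 0\<close>, a generator of \<open>F\<close> is the restriction of a section over some projective \<open>P0\<close>, which
  then generates \<open>F\<close> as well.  For the presentation that starts with \<open>P0\<close>, the second condition says
  that the syzygy is projectively generated, so by the same argument its generator comes from a
  projective \<open>P1\<close>.
\<close>

lemma fp_shriek_iff_projectively_presented:
  assumes fF: "finitely_presented C F"
  shows "F \<in> fp_shriek C \<longleftrightarrow> projectively_presented C F"
proof
  note F = fp_presheaf[OF fF]
  assume "projectively_presented C F"
  then obtain P1 P0 d x where P1: "projective C P1" and P0: "projective C P0" and pr: "presented_by C F P1 P0 d x"
    by (auto simp: projectively_presented_def)
  have d: "P1 \<in> Obj C" "P0 \<in> Obj C" "d \<in> arrows C P1 P0" and x: "x \<in> sections F P0" and ad: "additive_presheaf C F"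
    using pr by (auto simp: presented_by_def)
  obtain I \<iota> e where I: "finitely_presented C I" "\<iota> \<in> arrows (presheaf_cat C) I (yoneda_ob C P0)" "presheaf_inj C I \<iota>"
    "epi_arr (fp C) (yoneda_ob C P1) I e" "Cmp (presheaf_cat C) (yoneda_ob C P1) I (yoneda_ob C P0) \<iota> e = yoneda_ar C P1 P0 d"
    using fp_image[OF yoneda_fp[OF d(1)] yoneda_fp[OF d(2)] yoneda_ar_arrow[OF d]] by metis
  have "projectively_generated C I"
    using projectively_generated_if_surj[OF P1] I(1,4) fp_epi_iff fp_presheaf by blast
  moreover have "projectively_generated C F"
  proof (rule projectively_generated_if_surj[OF P0 F yoneda_el_arrow[OF ad d(2) x]])
    show "presheaf_surj C (yoneda_ob C P0) F (yoneda_el C F P0 x)"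
      using pr presheaf_closed[OF F] by (auto simp: presheaf_surj_def presented_by_def image_iff)
  qed
  ultimately show "F \<in> fp_shriek C"
    using left_derived1_zero_iff[OF pr P0 I] reflect0_zero_iff[OF fF] fF by (simp add: fp_shriek_def)
next
  note F = fp_presheaf[OF fF]
  assume s: "F \<in> fp_shriek C"
  then have pg: "projectively_generated C F" using reflect0_zero_iff[OF fF] by (simp add: fp_shriek_def)
  obtain B A b x where "presented_by C F B A b x" using fF fp_iff_presented by blast
  then have A [simp]: "A \<in> Obj C" and x: "x \<in> sections F A" and ad: "additive_presheaf C F"
    and gen: "\<And>X z. \<lbrakk>X \<in> Obj C; z \<in> sections F X\<rbrakk> \<Longrightarrow> \<exists>h\<in>arrows C X A. z = FAr F A X h x"
    by (auto simp: presented_by_def)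
  obtain P0 h y where P0: "projective C P0" and h [simp]: "h \<in> arrows C A P0" and y: "y \<in> sections F P0" and xy: "x = FAr F P0 A h y"
    using pg A x unfolding projectively_generated_def projective_part_def by blast
  note P0O [simp] = projective_obj[OF P0]
  obtain S r where S [simp]: "S \<in> Obj C" "r \<in> arrows C S P0"
    and r: "\<And>X g. \<lbrakk>X \<in> Obj C; g \<in> arrows C X P0\<rbrakk> \<Longrightarrow> FAr F P0 X g y = \<one>\<^bsub>FOb F X\<^esub> \<longleftrightarrow> (\<exists>u\<in>arrows C X S. g = Cmp C X S P0 r u)"
    using section_relations[OF fF P0O y] by blast
  have gen': "\<exists>g\<in>arrows C X P0. z = FAr F P0 X g y" if X [simp]: "X \<in> Obj C" and z: "z \<in> sections F X" for X z
  proof -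
    obtain g where g: "g \<in> arrows C X A" "z = FAr F A X g x" using gen[OF X z] by blast
    then have "z = FAr F P0 X (Cmp C X A P0 h g) y" using presheaf_comp[OF F X A P0O g(1) h y] xy by simp
    then show ?thesis using g(1) by (intro bexI[of _ "Cmp C X A P0 h g"]) auto
  qed
  have pr: "presented_by C F S P0 r y" unfolding presented_by_def using ad y gen' r by simp
  obtain I \<iota> e where I: "finitely_presented C I" "\<iota> \<in> arrows (presheaf_cat C) I (yoneda_ob C P0)" "presheaf_inj C I \<iota>"
    "epi_arr (fp C) (yoneda_ob C S) I e" "Cmp (presheaf_cat C) (yoneda_ob C S) I (yoneda_ob C P0) \<iota> e = yoneda_ar C S P0 r"
    using fp_image[OF yoneda_fp[OF S(1)] yoneda_fp[OF P0O] yoneda_ar_arrow[OF S(1) P0O S(2)]] by metis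
  note I' = fp_presheaf[OF I(1)]
  have e: "e \<in> arrows (presheaf_cat C) (yoneda_ob C S) I" and es: "presheaf_surj C (yoneda_ob C S) I e"
    using I(4) fp_epi_iff by auto
  have ie: "\<iota> X (e X g) = Cmp C X S P0 r g" if "X \<in> Obj C" "g \<in> arrows C X S" for X g
    using fun_cong[OF fun_cong[OF I(5)], of X g] that by simp
  have "projectively_generated C I"
    using left_derived1_zero_iff[OF pr P0 I] s by (simp add: fp_shriek_def)
  moreover have eS: "e S (Ident C S) \<in> sections I S" using nat_closed[OF yoneda_presheaf[OF S(1)] I' e S(1)] by simp
  ultimately obtain P1 g w where P1: "projective C P1" and g [simp]: "g \<in> arrows C S P1" and w: "w \<in> sections I P1"
    and gw: "e S (Ident C S) = FAr I P1 S g w"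
    unfolding projectively_generated_def projective_part_def using S(1) by blast
  note P1O [simp] = projective_obj[OF P1]
  define d where "d = \<iota> P1 w"
  have d [simp]: "d \<in> arrows C P1 P0" using nat_closed[OF I' yoneda_presheaf[OF P0O] I(2) P1O w] by (simp add: d_def)
  \<comment> \<open>The arrows \<open>r\<close> and \<open>d\<close> factor through each other, so they have the same image.\<close>
  have rd: "r = Cmp C S P1 P0 d g"
  proof -
    have "r = \<iota> S (FAr I P1 S g w)" using ie[OF S(1), of "Ident C S"] gw by simp
    then show ?thesis using nat_natural[OF I' yoneda_presheaf[OF P0O] I(2) S(1) P1O g w] d unfolding d_def by simp
  qed
  obtain v where v [simp]: "v \<in> arrows C P1 S" "w = e P1 v" using es w P1O unfolding presheaf_surj_def by fastforce
  have dr: "d = Cmp C P1 S P0 r v" using ie[OF P1O v(1)] v(2) by (simp add: d_def)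
  have "(\<exists>u\<in>arrows C X S. f = Cmp C X S P0 r u) \<longleftrightarrow> (\<exists>u\<in>arrows C X P1. f = Cmp C X P1 P0 d u)" if [simp]: "X \<in> Obj C" for X f
  proof
    assume "\<exists>u\<in>arrows C X S. f = Cmp C X S P0 r u"
    then obtain u where u: "u \<in> arrows C X S" "f = Cmp C X S P0 r u" by blast
    then show "\<exists>u\<in>arrows C X P1. f = Cmp C X P1 P0 d u"
      by (intro bexI[of _ "Cmp C X S P1 g u"]) (simp_all add: rd comp_assoc)
  next
    assume "\<exists>u\<in>arrows C X P1. f = Cmp C X P1 P0 d u"
    then obtain u where u: "u \<in> arrows C X P1" "f = Cmp C X P1 P0 d u" by blast
    have "f = Cmp C X S P0 r (Cmp C X P1 S v u)" unfolding u(2) by (subst dr, subst comp_assoc[symmetric]) (use u in auto)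
    then show "\<exists>u\<in>arrows C X S. f = Cmp C X S P0 r u" using u(1) by (intro bexI[of _ "Cmp C X P1 S v u"]) auto
  qed
  then have "presented_by C F P1 P0 d y" unfolding presented_by_def using ad y gen' r by simp
  then show "projectively_presented C F" unfolding projectively_presented_def using P1 P0 by blast
qed

end

section \<open>Natural isomorphisms\<close>

lemma naturally_isomorphicI:
  assumes D: "preadditive_category D" and S: "is_functor C D S" and T: "is_functor C D T"
    and t: "\<And>X. X \<in> Obj C \<Longrightarrow> \<theta> X \<in> arrows D (FOb S X) (FOb T X)"
    and p: "\<And>X. X \<in> Obj C \<Longrightarrow> \<psi> X \<in> arrows D (FOb T X) (FOb S X)"
    and pt: "\<And>X. X \<in> Obj C \<Longrightarrow> Cmp D (FOb S X) (FOb T X) (FOb S X) (\<psi> X) (\<theta> X) = Ident D (FOb S X)"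
    and tp: "\<And>X. X \<in> Obj C \<Longrightarrow> Cmp D (FOb T X) (FOb S X) (FOb T X) (\<theta> X) (\<psi> X) = Ident D (FOb T X)"
    and n: "\<And>X Y f. \<lbrakk>X \<in> Obj C; Y \<in> Obj C; f \<in> arrows C X Y\<rbrakk> \<Longrightarrow>
      Cmp D (FOb S X) (FOb S Y) (FOb T Y) (\<theta> Y) (FAr S X Y f) = Cmp D (FOb S X) (FOb T X) (FOb T Y) (FAr T X Y f) (\<theta> X)"
  shows "naturally_isomorphic C D S T"
proof -
  interpret D: preadditive_category D by fact
  have O [simp]: "FOb S X \<in> Obj D" "FOb T X \<in> Obj D" if "X \<in> Obj C" for X using S T that by (auto simp: is_functor_def)
  have A [simp]: "FAr S X Y f \<in> arrows D (FOb S X) (FOb S Y)" "FAr T X Y f \<in> arrows D (FOb T X) (FOb T Y)"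
    if "X \<in> Obj C" "Y \<in> Obj C" "f \<in> arrows C X Y" for X Y f using S T that by (auto simp: is_functor_def)
  note [simp] = t p
  have n': "Cmp D (FOb T X) (FOb T Y) (FOb S Y) (\<psi> Y) (FAr T X Y f) = Cmp D (FOb T X) (FOb S X) (FOb S Y) (FAr S X Y f) (\<psi> X)"
    if [simp]: "X \<in> Obj C" "Y \<in> Obj C" "f \<in> arrows C X Y" for X Y f
  proof -
    have "Cmp D (FOb T X) (FOb T Y) (FOb S Y) (\<psi> Y) (FAr T X Y f)
        = Cmp D (FOb T X) (FOb T Y) (FOb S Y) (\<psi> Y) (Cmp D (FOb T X) (FOb T X) (FOb T Y) (FAr T X Y f) (Cmp D (FOb T X) (FOb S X) (FOb T X) (\<theta> X) (\<psi> X)))"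
      by (simp add: tp)
    also have "\<dots> = Cmp D (FOb T X) (FOb T Y) (FOb S Y) (\<psi> Y) (Cmp D (FOb T X) (FOb S X) (FOb T Y) (Cmp D (FOb S X) (FOb S Y) (FOb T Y) (\<theta> Y) (FAr S X Y f)) (\<psi> X))"
      by (simp add: n D.comp_assoc)
    also have "\<dots> = Cmp D (FOb T X) (FOb S X) (FOb S Y) (Cmp D (FOb S X) (FOb S Y) (FOb S Y) (Cmp D (FOb S Y) (FOb T Y) (FOb S Y) (\<psi> Y) (\<theta> Y)) (FAr S X Y f)) (\<psi> X)"
      by (simp add: D.comp_assoc)
    finally show ?thesis by (simp add: pt)
  qed
  have "restrict \<theta> (Obj C) \<in> nat_trans C D S T" "restrict \<psi> (Obj C) \<in> nat_trans C D T S"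
    using n n' by (auto simp: nat_trans_def)
  moreover have "Cmp (functor_cat C D) S T S (restrict \<psi> (Obj C)) (restrict \<theta> (Obj C)) = Ident (functor_cat C D) S"
    "Cmp (functor_cat C D) T S T (restrict \<theta> (Obj C)) (restrict \<psi> (Obj C)) = Ident (functor_cat C D) T"
    by (simp_all add: pt tp fun_eq_iff)
  ultimately show ?thesis
    unfolding naturally_isomorphic_def isomorphic_def using S T
    by (intro conjI bexI[of _ "restrict \<theta> (Obj C)"] bexI[of _ "restrict \<psi> (Obj C)"]) simp_all
qed

lemma naturally_isomorphicE:
  assumes "naturally_isomorphic C D S T"
  obtains \<theta> \<psi> where "\<And>X. X \<in> Obj C \<Longrightarrow> \<theta> X \<in> arrows D (FOb S X) (FOb T X)"
    "\<And>X. X \<in> Obj C \<Longrightarrow> \<psi> X \<in> arrows D (FOb T X) (FOb S X)"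
    "\<And>X. X \<in> Obj C \<Longrightarrow> Cmp D (FOb S X) (FOb T X) (FOb S X) (\<psi> X) (\<theta> X) = Ident D (FOb S X)"
    "\<And>X. X \<in> Obj C \<Longrightarrow> Cmp D (FOb T X) (FOb S X) (FOb T X) (\<theta> X) (\<psi> X) = Ident D (FOb T X)"
    "\<And>X Y f. \<lbrakk>X \<in> Obj C; Y \<in> Obj C; f \<in> arrows C X Y\<rbrakk> \<Longrightarrow>
      Cmp D (FOb S X) (FOb S Y) (FOb T Y) (\<theta> Y) (FAr S X Y f) = Cmp D (FOb S X) (FOb T X) (FOb T Y) (FAr T X Y f) (\<theta> X)"
proof -
  obtain \<theta> \<psi> where t: "\<theta> \<in> nat_trans C D S T" and p: "\<psi> \<in> nat_trans C D T S"
    and pt: "Cmp (functor_cat C D) S T S \<psi> \<theta> = Ident (functor_cat C D) S"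
    and tp: "Cmp (functor_cat C D) T S T \<theta> \<psi> = Ident (functor_cat C D) T"
    using assms unfolding naturally_isomorphic_def isomorphic_def functor_cat_simps(2) by blast
  show ?thesis
  proof (rule that[of \<theta> \<psi>])
    fix X assume X: "X \<in> Obj C"
    show "\<theta> X \<in> arrows D (FOb S X) (FOb T X)" "\<psi> X \<in> arrows D (FOb T X) (FOb S X)"
      using t p X by (auto simp: nat_trans_def)
    show "Cmp D (FOb S X) (FOb T X) (FOb S X) (\<psi> X) (\<theta> X) = Ident D (FOb S X)"
      using fun_cong[OF pt, of X] X by simp
    show "Cmp D (FOb T X) (FOb S X) (FOb T X) (\<theta> X) (\<psi> X) = Ident D (FOb T X)"
      using fun_cong[OF tp, of X] X by simp
  next
    fix X Y f assume "X \<in> Obj C" "Y \<in> Obj C" "f \<in> arrows C X Y"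
    then show "Cmp D (FOb S X) (FOb S Y) (FOb T Y) (\<theta> Y) (FAr S X Y f) = Cmp D (FOb S X) (FOb T X) (FOb T Y) (FAr T X Y f) (\<theta> X)"
      using t by (simp add: nat_trans_def)
  qed
qed

lemma full_subcat_is_functor: "is_functor C D T \<Longrightarrow> is_functor (full_subcat C Q) D T"
  by (simp add: is_functor_def)

section \<open>The right exact extension of the Yoneda embedding\<close>

text \<open>
  For an epimorphism \<open>e : P \<rightarrow> X\<close> with projective \<open>P\<close>, the quotient of \<open>Hom(-, P)\<close> by the null arrows
  is the value at \<open>X\<close> of the zeroth left derived functor of the Yoneda embedding.  They coincide with
  the arrows that factor through \<open>d\<close> for any projective presentation \<open>P' \<rightarrow> P \<rightarrow> X\<close>; this
  description refers to \<open>e\<close> only, so that arrows between the values need lifts in degree zero only.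
\<close>

definition null_arrows :: "('o, 'm) acat \<Rightarrow> 'o \<Rightarrow> 'o \<Rightarrow> 'm \<Rightarrow> 'o \<Rightarrow> 'm set" where
  "null_arrows C P X e Z = {Cmp C Z Q P u v | Q u v. projective C Q \<and> v \<in> arrows C Z Q \<and> u \<in> arrows C Q P \<and>
     Cmp C Q P X e u = zero_arr C Q X}"

lemma null_arrowsI:
  "\<lbrakk>projective C Q; v \<in> arrows C Z Q; u \<in> arrows C Q P; Cmp C Q P X e u = zero_arr C Q X\<rbrakk>
    \<Longrightarrow> Cmp C Z Q P u v \<in> null_arrows C P X e Z"
  unfolding null_arrows_def by blast

context abelian_enough_projectives
begin

lemma projective_presentation_exists:
  assumes [simp]: "P \<in> Obj C" "X \<in> Obj C" "e \<in> arrows C P X"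
  obtains P' d where "projective C P'" "exact_at C P' P X d e"
proof -
  obtain K k where k: "is_kernel C K P X k e" using ex_kernel[of P X e] by auto
  then have "K \<in> Obj C" by (simp add: is_kernel_def)
  then obtain P' e' where P': "projective C P'" "epi_arr C P' K e'"
    using enough unfolding enough_projectives_def by blast
  then have "exact_at C P' P X (Cmp C P' K P k e') e" unfolding exact_at_def using k by blast
  then show ?thesis using that P' by blast
qed

lemma null_arrows_generated:
  assumes P': "projective C P'" and ex: "exact_at C P' P X d e" and Z [simp]: "Z \<in> Obj C"
  shows "null_arrows C P X e Z = generated_by C (yoneda_ob C P) P' d Z"
proof -
  note x [simp] = exact_comp_zero[OF ex]
  show ?thesis
  proof (intro equalityI subsetI)
    fix h assume "h \<in> null_arrows C P X e Z"
    then obtain Q u v where Q: "projective C Q" and v [simp]: "v \<in> arrows C Z Q" and u: "u \<in> arrows C Q P"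
      "Cmp C Q P X e u = zero_arr C Q X" and h: "h = Cmp C Z Q P u v" by (auto simp: null_arrows_def)
    note [simp] = projective_obj[OF Q]
    obtain w where w [simp]: "w \<in> arrows C Q P'" "Cmp C Q P' P d w = u" using projective_lift_exact[OF Q ex u] .
    have "h = Cmp C Z P' P d (Cmp C Z Q P' w v)" unfolding h by (simp add: comp_assoc)
    then show "h \<in> generated_by C (yoneda_ob C P) P' d Z" unfolding generated_by_def by auto
  next
    fix h assume "h \<in> generated_by C (yoneda_ob C P) P' d Z"
    then obtain w where "w \<in> arrows C Z P'" "h = Cmp C Z P' P d w" by (auto simp: generated_by_def)
    then show "h \<in> null_arrows C P X e Z" unfolding null_arrows_def using P' x(4,6) by blast
  qed
qed

lemma null_quotient:
  assumes P: "projective C P" and e: "epi_arr C P X e"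
  shows "\<exists>L \<pi>. finitely_presented C L \<and> \<pi> \<in> arrows (presheaf_cat C) (yoneda_ob C P) L \<and> presheaf_surj C (yoneda_ob C P) L \<pi> \<and>
    (\<forall>Z\<in>Obj C. \<forall>h\<in>arrows C Z P. \<pi> Z h = \<one>\<^bsub>FOb L Z\<^esub> \<longleftrightarrow> h \<in> null_arrows C P X e Z)"
proof -
  have o: "P \<in> Obj C" "X \<in> Obj C" "e \<in> arrows C P X" using e by (auto simp: epi_arr_def)
  obtain P' d where P': "projective C P'" and ex: "exact_at C P' P X d e" using projective_presentation_exists[OF o] .
  note x = exact_comp_zero[OF ex]
  have d: "d \<in> sections (yoneda_ob C P) P'" using x(4) by simp
  obtain L \<pi> where L: "L \<in> Obj (presheaf_cat C)" "\<pi> \<in> arrows (presheaf_cat C) (yoneda_ob C P) L" "presheaf_surj C (yoneda_ob C P) L \<pi>"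
    and k: "\<And>Z h. \<lbrakk>Z \<in> Obj C; h \<in> sections (yoneda_ob C P) Z\<rbrakk> \<Longrightarrow> \<pi> Z h = \<one>\<^bsub>FOb L Z\<^esub> \<longleftrightarrow> h \<in> generated_by C (yoneda_ob C P) P' d Z"
    using presheaf_quotient[OF yoneda_presheaf[OF o(1)] generated_by_sub[OF yoneda_additive[OF o(1)] x(1) d]] by blast
  have "finitely_presented C L" by (rule fp_quotient_generated[OF yoneda_fp[OF o(1)] x(1) d L k])
  moreover have "\<pi> Z h = \<one>\<^bsub>FOb L Z\<^esub> \<longleftrightarrow> h \<in> null_arrows C P X e Z" if "Z \<in> Obj C" "h \<in> arrows C Z P" for Z h
    using k[of Z h] null_arrows_generated[OF P' ex that(1)] that by simp
  ultimately show ?thesis using L by blast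
qed

text \<open>
  From here on, every object \<open>X\<close> comes with a chosen epimorphism \<open>e X : P X \<rightarrow> X\<close> from a projective and a
  chosen quotient \<open>\<pi> X : Hom(-, P X) \<rightarrow> L X\<close> by the null arrows; \<open>L\<close> is the object part of the extension.
\<close>

context
  fixes P :: "'o \<Rightarrow> 'o" and e :: "'o \<Rightarrow> 'm" and L :: "'o \<Rightarrow> ('o, 'm) presheaf" and \<pi> :: "'o \<Rightarrow> 'o \<Rightarrow> 'm \<Rightarrow> 'm"
  assumes P: "X \<in> Obj C \<Longrightarrow> projective C (P X)" and e: "X \<in> Obj C \<Longrightarrow> epi_arr C (P X) X (e X)"
    and L: "X \<in> Obj C \<Longrightarrow> finitely_presented C (L X)"
    and pr: "X \<in> Obj C \<Longrightarrow> \<pi> X \<in> arrows (presheaf_cat C) (yoneda_ob C (P X)) (L X)"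
    and ps: "X \<in> Obj C \<Longrightarrow> presheaf_surj C (yoneda_ob C (P X)) (L X) (\<pi> X)"
    and pk: "\<lbrakk>X \<in> Obj C; Z \<in> Obj C; h \<in> arrows C Z (P X)\<rbrakk> \<Longrightarrow> \<pi> X Z h = \<one>\<^bsub>FOb (L X) Z\<^esub> \<longleftrightarrow> h \<in> null_arrows C (P X) X (e X) Z"
begin

lemma cover_obj [simp]: "X \<in> Obj C \<Longrightarrow> P X \<in> Obj C"
  using P projective_obj by blast

lemma cover_arrow [simp]: "X \<in> Obj C \<Longrightarrow> e X \<in> arrows C (P X) X"
  using e by (simp add: epi_arr_def)

lemma quotient_obj: "X \<in> Obj C \<Longrightarrow> L X \<in> Obj (presheaf_cat C)"
  using L fp_presheaf by blast

lemma quotient_hom: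
  assumes "X \<in> Obj C" "Z \<in> Obj C"
  shows "group_hom (HomGrp C Z (P X)) (FOb (L X) Z) (\<pi> X Z)"
  using nat_hom[OF yoneda_presheaf[OF cover_obj] quotient_obj pr assms(2), of X] assms by simp

lemma quotient_closed:
  assumes "X \<in> Obj C" "Z \<in> Obj C" "h \<in> arrows C Z (P X)"
  shows "\<pi> X Z h \<in> sections (L X) Z"
  using group_hom.hom_closed[OF quotient_hom] assms by blast

lemma quotient_surjE:
  assumes "X \<in> Obj C" "Z \<in> Obj C" "w \<in> sections (L X) Z"
  obtains h where "h \<in> arrows C Z (P X)" "w = \<pi> X Z h"
  using presheaf_surjE[OF ps[OF assms(1)] assms(2,3)] by (metis yoneda_ob_simps(1))

text \<open>
  The difference of \<open>a\<close> and \<open>b\<close> is killed by \<open>e X\<close> and starts in a projective, so composites with it are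
  null.  This makes everything below independent of the choice of lifts.
\<close>

lemma quotient_eqI:
  assumes X [simp]: "X \<in> Obj C" and Z [simp]: "Z \<in> Obj C" and Q: "projective C Q" and h [simp]: "h \<in> arrows C Z Q"
    and a [simp]: "a \<in> arrows C Q (P X)" "b \<in> arrows C Q (P X)" and eq: "Cmp C Q (P X) X (e X) a = Cmp C Q (P X) X (e X) b"
  shows "\<pi> X Z (Cmp C Z Q (P X) a h) = \<pi> X Z (Cmp C Z Q (P X) b h)"
proof -
  note [simp] = projective_obj[OF Q]
  interpret group_hom "HomGrp C Z (P X)" "FOb (L X) Z" "\<pi> X Z" using quotient_hom by simp
  let ?s = "sub_arr C Q (P X) a b"
  have "Cmp C Q (P X) X (e X) ?s = zero_arr C Q X" using eq by (simp add: comp_sub_right sub_zero_iff)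
  then have "Cmp C Z Q (P X) ?s h \<in> null_arrows C (P X) X (e X) Z"
    using Q by (intro null_arrowsI) simp_all
  then have "\<pi> X Z (Cmp C Z Q (P X) ?s h) = \<one>\<^bsub>FOb (L X) Z\<^esub>" using pk by simp
  moreover have "Cmp C Z Q (P X) ?s h = sub_arr C Z (P X) (Cmp C Z Q (P X) a h) (Cmp C Z Q (P X) b h)"
    by (simp add: comp_sub_left)
  ultimately have "\<pi> X Z (Cmp C Z Q (P X) a h) \<otimes>\<^bsub>FOb (L X) Z\<^esub> inv\<^bsub>FOb (L X) Z\<^esub> \<pi> X Z (Cmp C Z Q (P X) b h) = \<one>\<^bsub>FOb (L X) Z\<^esub>"
    by (simp add: sub_arr_def)
  then show ?thesis using comm_group_diff_one_iff[OF presheaf_group[OF quotient_obj[OF X] Z]] by simp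
qed

definition lifted :: "'o \<Rightarrow> 'o \<Rightarrow> 'm \<Rightarrow> 'm \<Rightarrow> bool" where
  "lifted X Y f f0 \<longleftrightarrow> f0 \<in> arrows C (P X) (P Y) \<and> Cmp C (P X) (P Y) Y (e Y) f0 = Cmp C (P X) X Y f (e X)"

definition induced :: "'o \<Rightarrow> 'o \<Rightarrow> 'm \<Rightarrow> 'o \<Rightarrow> 'm \<Rightarrow> 'm" where
  "induced X Y f = (SOME g. g \<in> arrows (presheaf_cat C) (L X) (L Y) \<and>
     (\<exists>f0. lifted X Y f f0 \<and> (\<forall>Z\<in>Obj C. \<forall>h\<in>arrows C Z (P X). g Z (\<pi> X Z h) = \<pi> Y Z (Cmp C Z (P X) (P Y) f0 h))))"

lemma lifted_ex:
  assumes [simp]: "X \<in> Obj C" "Y \<in> Obj C" "f \<in> arrows C X Y"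
  shows "\<exists>f0. lifted X Y f f0"
proof -
  obtain f0 where "f0 \<in> arrows C (P X) (P Y)" "Cmp C (P X) (P Y) Y (e Y) f0 = Cmp C (P X) X Y f (e X)"
    using projective_lift[OF P[OF assms(1)] e[OF assms(2)], of "Cmp C (P X) X Y f (e X)"] by auto
  then show ?thesis unfolding lifted_def by blast
qed

text \<open>
  A lift \<open>f0\<close> of \<open>f\<close> carries null arrows to null arrows and so induces a map of the quotients, which by
  \<open>quotient_eqI\<close> is the same for all lifts.
\<close>

lemma induced:
  assumes X [simp]: "X \<in> Obj C" and Y [simp]: "Y \<in> Obj C" and f [simp]: "f \<in> arrows C X Y"
  shows induced_arrow: "induced X Y f \<in> arrows (presheaf_cat C) (L X) (L Y)"
    and induced_apply: "\<lbrakk>lifted X Y f f0; Z \<in> Obj C; h \<in> arrows C Z (P X)\<rbrakk>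
      \<Longrightarrow> induced X Y f Z (\<pi> X Z h) = \<pi> Y Z (Cmp C Z (P X) (P Y) f0 h)"
proof -
  obtain f0 where l: "lifted X Y f f0" using lifted_ex[OF assms] by blast
  then have f0 [simp]: "f0 \<in> arrows C (P X) (P Y)" and ef: "Cmp C (P X) (P Y) Y (e Y) f0 = Cmp C (P X) X Y f (e X)"
    by (auto simp: lifted_def)
  note YX = yoneda_presheaf[OF cover_obj[OF X]] and YY = yoneda_presheaf[OF cover_obj[OF Y]]
  let ?a = "Cmp (presheaf_cat C) (yoneda_ob C (P X)) (yoneda_ob C (P Y)) (L Y) (\<pi> Y) (yoneda_ar C (P X) (P Y) f0)"
  have a: "?a \<in> arrows (presheaf_cat C) (yoneda_ob C (P X)) (L Y)"
    by (rule psh_comp_closed[OF YX YY quotient_obj[OF Y] _ pr[OF Y]]) simp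
  have "?a Z h = \<one>\<^bsub>FOb (L Y) Z\<^esub>" if Z [simp]: "Z \<in> Obj C" and h: "h \<in> sections (yoneda_ob C (P X)) Z" and z: "\<pi> X Z h = \<one>\<^bsub>FOb (L X) Z\<^esub>" for Z h
  proof -
    have h' [simp]: "h \<in> arrows C Z (P X)" using h by simp
    obtain Q u v where Q: "projective C Q" and v [simp]: "v \<in> arrows C Z Q" and u [simp]: "u \<in> arrows C Q (P X)"
      and eu: "Cmp C Q (P X) X (e X) u = zero_arr C Q X" and hu: "h = Cmp C Z Q (P X) u v"
      using pk[OF X Z h'] z by (auto simp: null_arrows_def)
    note [simp] = projective_obj[OF Q]
    have "Cmp C Q (P Y) Y (e Y) (Cmp C Q (P X) (P Y) f0 u) = Cmp C Q (P X) Y (Cmp C (P X) X Y f (e X)) u"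
      by (subst comp_assoc) (simp_all add: ef)
    also have "\<dots> = zero_arr C Q Y" by (subst comp_assoc[symmetric]) (simp_all add: eu)
    finally have "Cmp C Z Q (P Y) (Cmp C Q (P X) (P Y) f0 u) v \<in> null_arrows C (P Y) Y (e Y) Z"
      using Q by (intro null_arrowsI) simp_all
    moreover have "Cmp C Z (P X) (P Y) f0 h = Cmp C Z Q (P Y) (Cmp C Q (P X) (P Y) f0 u) v"
      unfolding hu by (rule comp_assoc) auto
    ultimately show ?thesis using pk[OF Y Z, of "Cmp C Z (P X) (P Y) f0 h"] by simp
  qed
  then obtain g where g: "g \<in> arrows (presheaf_cat C) (L X) (L Y)"
    "\<And>Z h. \<lbrakk>Z \<in> Obj C; h \<in> sections (yoneda_ob C (P X)) Z\<rbrakk> \<Longrightarrow> g Z (\<pi> X Z h) = ?a Z h"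
    using factor_through_surj[OF YX quotient_obj[OF X] quotient_obj[OF Y] pr[OF X] ps[OF X] a] by blast
  have "g Z (\<pi> X Z h) = \<pi> Y Z (Cmp C Z (P X) (P Y) f0 h)" if "Z \<in> Obj C" "h \<in> arrows C Z (P X)" for Z h
    using g(2)[of Z h] that by simp
  then have ex: "\<exists>g. g \<in> arrows (presheaf_cat C) (L X) (L Y) \<and>
     (\<exists>f0. lifted X Y f f0 \<and> (\<forall>Z\<in>Obj C. \<forall>h\<in>arrows C Z (P X). g Z (\<pi> X Z h) = \<pi> Y Z (Cmp C Z (P X) (P Y) f0 h)))"
    using g(1) l by blast
  have ind: "induced X Y f \<in> arrows (presheaf_cat C) (L X) (L Y) \<and>
     (\<exists>f0. lifted X Y f f0 \<and> (\<forall>Z\<in>Obj C. \<forall>h\<in>arrows C Z (P X). induced X Y f Z (\<pi> X Z h) = \<pi> Y Z (Cmp C Z (P X) (P Y) f0 h)))"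
    unfolding induced_def by (rule someI_ex[OF ex])
  then show "induced X Y f \<in> arrows (presheaf_cat C) (L X) (L Y)" by blast
  obtain f1 where l1: "lifted X Y f f1" and i1: "\<And>Z h. \<lbrakk>Z \<in> Obj C; h \<in> arrows C Z (P X)\<rbrakk> \<Longrightarrow> induced X Y f Z (\<pi> X Z h) = \<pi> Y Z (Cmp C Z (P X) (P Y) f1 h)"
    using ind by blast
  show "induced X Y f Z (\<pi> X Z h) = \<pi> Y Z (Cmp C Z (P X) (P Y) f0 h)"
    if l: "lifted X Y f f0" and Z: "Z \<in> Obj C" and h: "h \<in> arrows C Z (P X)" for f0 Z h
    unfolding i1[OF Z h] by (rule quotient_eqI[OF Y Z P[OF X] h]) (use l l1 in \<open>auto simp: lifted_def\<close>)
qed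

lemma lifted_comp:
  assumes [simp]: "X \<in> Obj C" "Y \<in> Obj C" "Z \<in> Obj C" "f \<in> arrows C X Y" "g \<in> arrows C Y Z" and f: "lifted X Y f f0" and g: "lifted Y Z g g0"
  shows "lifted X Z (Cmp C X Y Z g f) (Cmp C (P X) (P Y) (P Z) g0 f0)"
proof -
  have [simp]: "f0 \<in> arrows C (P X) (P Y)" "g0 \<in> arrows C (P Y) (P Z)"
    and ef: "Cmp C (P X) (P Y) Y (e Y) f0 = Cmp C (P X) X Y f (e X)" and eg: "Cmp C (P Y) (P Z) Z (e Z) g0 = Cmp C (P Y) Y Z g (e Y)"
    using f g by (auto simp: lifted_def)
  have "Cmp C (P X) (P Z) Z (e Z) (Cmp C (P X) (P Y) (P Z) g0 f0) = Cmp C (P X) (P Y) Z (Cmp C (P Y) Y Z g (e Y)) f0"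
    by (subst comp_assoc) (simp_all add: eg)
  also have "\<dots> = Cmp C (P X) Y Z g (Cmp C (P X) X Y f (e X))" by (subst comp_assoc[symmetric]) (simp_all add: ef)
  also have "\<dots> = Cmp C (P X) X Z (Cmp C X Y Z g f) (e X)" by (rule comp_assoc) auto
  finally show ?thesis by (simp add: lifted_def)
qed

lemma quotient_arrow_eqI:
  assumes X: "X \<in> Obj C" and G: "G \<in> Obj (presheaf_cat C)" and a: "\<alpha> \<in> arrows (presheaf_cat C) (L X) G" and b: "\<beta> \<in> arrows (presheaf_cat C) (L X) G"
    and eq: "\<And>Z h. \<lbrakk>Z \<in> Obj C; h \<in> arrows C Z (P X)\<rbrakk> \<Longrightarrow> \<alpha> Z (\<pi> X Z h) = \<beta> Z (\<pi> X Z h)"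
  shows "\<alpha> = \<beta>"
proof (rule nat_eqI[OF quotient_obj[OF X] G a b])
  fix Z w assume Z: "Z \<in> Obj C" and w: "w \<in> sections (L X) Z"
  obtain h where "h \<in> arrows C Z (P X)" "w = \<pi> X Z h" using quotient_surjE[OF X Z w] .
  then show "\<alpha> Z w = \<beta> Z w" using eq[OF Z] by simp
qed

lemma induced_functor: "is_functor C (fp C) \<lparr>FOb = L, FAr = induced\<rparr>"
proof -
  have "induced X X (Ident C X) = Ident (presheaf_cat C) (L X)" if X [simp]: "X \<in> Obj C" for X
  proof (rule quotient_arrow_eqI[OF X quotient_obj[OF X] induced_arrow psh_ident_closed[OF quotient_obj[OF X]]])
    fix Z h assume Z [simp]: "Z \<in> Obj C" and h [simp]: "h \<in> arrows C Z (P X)"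
    have l: "lifted X X (Ident C X) (Ident C (P X))" by (simp add: lifted_def)
    show "induced X X (Ident C X) Z (\<pi> X Z h) = Ident (presheaf_cat C) (L X) Z (\<pi> X Z h)"
      using induced_apply[OF X X _ l Z h] quotient_closed[OF X Z h] by simp
  qed auto
  moreover have "induced X Z (Cmp C X Y Z g f) = Cmp (presheaf_cat C) (L X) (L Y) (L Z) (induced Y Z g) (induced X Y f)"
    if o [simp]: "X \<in> Obj C" "Y \<in> Obj C" "Z \<in> Obj C" and f [simp]: "f \<in> arrows C X Y" and g [simp]: "g \<in> arrows C Y Z" for X Y Z f g
  proof (rule quotient_arrow_eqI[OF o(1) quotient_obj[OF o(3)] induced_arrow psh_comp_closed[OF quotient_obj[OF o(1)] quotient_obj[OF o(2)] quotient_obj[OF o(3)] induced_arrow induced_arrow]])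
    fix V h assume V [simp]: "V \<in> Obj C" and h [simp]: "h \<in> arrows C V (P X)"
    obtain f0 where f0: "lifted X Y f f0" using lifted_ex[OF o(1,2) f] by blast
    obtain g0 where g0: "lifted Y Z g g0" using lifted_ex[OF o(2,3) g] by blast
    have [simp]: "f0 \<in> arrows C (P X) (P Y)" "g0 \<in> arrows C (P Y) (P Z)" using f0 g0 by (auto simp: lifted_def)
    note l = lifted_comp[OF o f g f0 g0]
    have "induced Y Z g V (induced X Y f V (\<pi> X V h)) = \<pi> Z V (Cmp C V (P Y) (P Z) g0 (Cmp C V (P X) (P Y) f0 h))"
      using induced_apply[OF o(1,2) f f0 V h] induced_apply[OF o(2,3) g g0 V, of "Cmp C V (P X) (P Y) f0 h"] by simp
    also have "\<dots> = induced X Z (Cmp C X Y Z g f) V (\<pi> X V h)"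
      using induced_apply[OF o(1,3) _ l V h] by (simp add: comp_assoc)
    finally show "induced X Z (Cmp C X Y Z g f) V (\<pi> X V h) = Cmp (presheaf_cat C) (L X) (L Y) (L Z) (induced Y Z g) (induced X Y f) V (\<pi> X V h)"
      using quotient_closed[OF o(1) V h] by simp
  qed auto
  ultimately show ?thesis using L induced_arrow by (simp add: is_functor_def)
qed

lemma induced_additive: "additive_functor C (fp C) \<lparr>FOb = L, FAr = induced\<rparr>"
proof -
  interpret psh: preadditive_category "presheaf_cat C" by (rule preadditive_presheaf_cat)
  have "induced X Y (f \<otimes>\<^bsub>HomGrp C X Y\<^esub> g) = induced X Y f \<otimes>\<^bsub>HomGrp (presheaf_cat C) (L X) (L Y)\<^esub> induced X Y g"
    if o [simp]: "X \<in> Obj C" "Y \<in> Obj C" and f [simp]: "f \<in> arrows C X Y" and g [simp]: "g \<in> arrows C X Y" for X Y f g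
  proof (rule quotient_arrow_eqI[OF o(1) quotient_obj[OF o(2)] induced_arrow psh.add_closed[OF quotient_obj[OF o(1)] quotient_obj[OF o(2)] induced_arrow induced_arrow]])
    fix V h assume V [simp]: "V \<in> Obj C" and h [simp]: "h \<in> arrows C V (P X)"
    obtain f0 where f0: "lifted X Y f f0" using lifted_ex[OF o f] by blast
    obtain g0 where g0: "lifted X Y g g0" using lifted_ex[OF o g] by blast
    have [simp]: "f0 \<in> arrows C (P X) (P Y)" "g0 \<in> arrows C (P X) (P Y)" using f0 g0 by (auto simp: lifted_def)
    have l: "lifted X Y (f \<otimes>\<^bsub>HomGrp C X Y\<^esub> g) (f0 \<otimes>\<^bsub>HomGrp C (P X) (P Y)\<^esub> g0)"
      using f0 g0 by (simp add: lifted_def comp_add_left comp_add_right)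
    interpret p: group_hom "HomGrp C V (P Y)" "FOb (L Y) V" "\<pi> Y V" using quotient_hom by simp
    show "induced X Y (f \<otimes>\<^bsub>HomGrp C X Y\<^esub> g) V (\<pi> X V h) = (induced X Y f \<otimes>\<^bsub>HomGrp (presheaf_cat C) (L X) (L Y)\<^esub> induced X Y g) V (\<pi> X V h)"
      using induced_apply[OF o _ l V h] induced_apply[OF o f f0 V h] induced_apply[OF o g g0 V h] quotient_closed[OF o(1) V h]
      by (simp add: comp_add_left)
  qed auto
  then show ?thesis using induced_functor induced_arrow by (simp add: additive_functor_def hom_def)
qed

text \<open>
  Both parts use an arrow \<open>s : P Z \<rightarrow> P Y\<close> over \<open>Z\<close>.  It gives surjectivity at once.  If \<open>h\<close> represents a
  section of \<open>L Y\<close> that dies in \<open>L Z\<close>, then \<open>g0 h = u v\<close> is null, and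
  \<open>h = (1 - s g0) h + (s u) v\<close>.  The arrows \<open>1 - s g0\<close> and \<open>s u\<close> start in projectives and become zero
  in \<open>Z\<close>, so by exactness they agree, up to null arrows, with arrows that factor through \<open>f0\<close>.
\<close>

lemma induced_right_exact: "right_exact_functor C (fp C) \<lparr>FOb = L, FAr = induced\<rparr>"
  unfolding right_exact_functor_def
proof (intro conjI induced_additive ballI impI)
  fix X Y Z f g
  assume X [simp]: "X \<in> Obj C" and Y [simp]: "Y \<in> Obj C" and Z [simp]: "Z \<in> Obj C" and f [simp]: "f \<in> arrows C X Y" and g [simp]: "g \<in> arrows C Y Z"
    and "exact_at C X Y Z f g \<and> epi_arr C Y Z g"
  then have ex: "exact_at C X Y Z f g" and eg: "epi_arr C Y Z g" by auto
  obtain f0 where f0: "lifted X Y f f0" using lifted_ex[OF X Y f] by blast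
  obtain g0 where g0: "lifted Y Z g g0" using lifted_ex[OF Y Z g] by blast
  have fg [simp]: "f0 \<in> arrows C (P X) (P Y)" "g0 \<in> arrows C (P Y) (P Z)" using f0 g0 by (auto simp: lifted_def)
  have ef: "Cmp C (P X) (P Y) Y (e Y) f0 = Cmp C (P X) X Y f (e X)" and eg0: "Cmp C (P Y) (P Z) Z (e Z) g0 = Cmp C (P Y) Y Z g (e Y)"
    using f0 g0 by (auto simp: lifted_def)
  note If = induced_arrow[OF X Y f] and Ig = induced_arrow[OF Y Z g]
  obtain t where t [simp]: "t \<in> arrows C (P Z) Y" "Cmp C (P Z) Y Z g t = e Z" using projective_lift[OF P[OF Z] eg cover_arrow[OF Z]] .
  obtain s where s [simp]: "s \<in> arrows C (P Z) (P Y)" "Cmp C (P Z) (P Y) Y (e Y) s = t" using projective_lift[OF P[OF Z] e[OF Y] t(1)] .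
  have surj: "presheaf_surj C (L Y) (L Z) (induced Y Z g)"
    unfolding presheaf_surj_def
  proof (intro ballI equalityI subsetI)
    fix V w assume V [simp]: "V \<in> Obj C"
    { assume "w \<in> induced Y Z g V ` sections (L Y) V"
      then show "w \<in> sections (L Z) V" using nat_closed[OF quotient_obj[OF Y] quotient_obj[OF Z] Ig V] by blast }
    { assume w: "w \<in> sections (L Z) V"
      obtain h where h [simp]: "h \<in> arrows C V (P Z)" and wh: "w = \<pi> Z V h" using quotient_surjE[OF Z V w] .
      let ?sh = "Cmp C V (P Z) (P Y) s h"
      have "Cmp C (P Z) (P Z) Z (e Z) (Cmp C (P Z) (P Y) (P Z) g0 s) = Cmp C (P Z) (P Y) Z (Cmp C (P Y) Y Z g (e Y)) s"
        by (subst comp_assoc) (simp_all add: eg0)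
      also have "\<dots> = e Z" by (subst comp_assoc[symmetric]) simp_all
      finally have "\<pi> Z V (Cmp C V (P Z) (P Z) (Cmp C (P Z) (P Y) (P Z) g0 s) h) = \<pi> Z V (Cmp C V (P Z) (P Z) (Ident C (P Z)) h)"
        by (intro quotient_eqI[OF Z V P[OF Z] h]) auto
      then have "induced Y Z g V (\<pi> Y V ?sh) = w"
        using induced_apply[OF Y Z g g0 V, of ?sh] wh by (simp add: comp_assoc)
      then show "w \<in> induced Y Z g V ` sections (L Y) V" using quotient_closed[OF Y V, of ?sh] by (intro image_eqI[of _ _ "\<pi> Y V ?sh"]) auto }
  qed
  have thr: "\<exists>r\<in>arrows C Q (P X). \<forall>V\<in>Obj C. \<forall>h\<in>arrows C V Q. \<pi> Y V (Cmp C V Q (P Y) b h) = induced X Y f V (\<pi> X V (Cmp C V Q (P X) r h))"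
    if Q: "projective C Q" and b [simp]: "b \<in> arrows C Q (P Y)" and gb: "Cmp C Q Y Z g (Cmp C Q (P Y) Y (e Y) b) = zero_arr C Q Z" for Q b
  proof -
    note [simp] = projective_obj[OF Q]
    have "Cmp C Q (P Y) Y (e Y) b \<in> arrows C Q Y" by simp
    then obtain r' where r': "r' \<in> arrows C Q X" "Cmp C Q X Y f r' = Cmp C Q (P Y) Y (e Y) b"
      using projective_lift_exact[OF Q ex _ gb] by blast
    obtain r where r [simp]: "r \<in> arrows C Q (P X)" "Cmp C Q (P X) X (e X) r = r'" using projective_lift[OF Q e[OF X] r'(1)] .
    have "Cmp C Q (P Y) Y (e Y) (Cmp C Q (P X) (P Y) f0 r) = Cmp C Q (P X) Y (Cmp C (P X) X Y f (e X)) r"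
      by (subst comp_assoc) (simp_all add: ef)
    also have "\<dots> = Cmp C Q (P Y) Y (e Y) b" by (subst comp_assoc[symmetric]) (simp_all add: r')
    finally have eq: "Cmp C Q (P Y) Y (e Y) b = Cmp C Q (P Y) Y (e Y) (Cmp C Q (P X) (P Y) f0 r)" ..
    have "\<pi> Y V (Cmp C V Q (P Y) b h) = induced X Y f V (\<pi> X V (Cmp C V Q (P X) r h))" if V [simp]: "V \<in> Obj C" and h [simp]: "h \<in> arrows C V Q" for V h
      using quotient_eqI[OF Y V Q h b _ eq] induced_apply[OF X Y f f0 V, of "Cmp C V Q (P X) r h"] by (simp add: comp_assoc)
    then show ?thesis using r(1) by blast
  qed
  have exact: "presheaf_exact C (L X) (L Y) (L Z) (induced X Y f) (induced Y Z g)"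
    unfolding presheaf_exact_def
  proof (intro ballI equalityI subsetI)
    fix V w assume V [simp]: "V \<in> Obj C"
    interpret pY: group_hom "HomGrp C V (P Y)" "FOb (L Y) V" "\<pi> Y V" using quotient_hom by simp
    interpret pZ: group_hom "HomGrp C V (P Z)" "FOb (L Z) V" "\<pi> Z V" using quotient_hom by simp
    { assume "w \<in> induced X Y f V ` sections (L X) V"
      then obtain x where x: "x \<in> sections (L X) V" "w = induced X Y f V x" by blast
      obtain h where h [simp]: "h \<in> arrows C V (P X)" and xh: "x = \<pi> X V h" using quotient_surjE[OF X V x(1)] .
      have wh: "w = \<pi> Y V (Cmp C V (P X) (P Y) f0 h)" using x(2) xh induced_apply[OF X Y f f0 V h] by simp
      have l: "lifted X Z (Cmp C X Y Z g f) (Cmp C (P X) (P Y) (P Z) g0 f0)" by (rule lifted_comp[OF X Y Z f g f0 g0])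
      then have "Cmp C (P X) (P Z) Z (e Z) (Cmp C (P X) (P Y) (P Z) g0 f0) = Cmp C (P X) (P Z) Z (e Z) (zero_arr C (P X) (P Z))"
        using exact_comp_zero(6)[OF ex] by (simp add: lifted_def)
      then have "\<pi> Z V (Cmp C V (P X) (P Z) (Cmp C (P X) (P Y) (P Z) g0 f0) h) = \<pi> Z V (Cmp C V (P X) (P Z) (zero_arr C (P X) (P Z)) h)"
        by (intro quotient_eqI[OF Z V P[OF X] h]) auto
      then have "induced Y Z g V w = \<one>\<^bsub>FOb (L Z) V\<^esub>"
        unfolding wh using induced_apply[OF Y Z g g0 V, of "Cmp C V (P X) (P Y) f0 h"] pZ.hom_one by (simp add: comp_assoc)
      then show "w \<in> kernel (FOb (L Y) V) (FOb (L Z) V) (induced Y Z g V)"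
        using quotient_closed[OF Y V, of "Cmp C V (P X) (P Y) f0 h"] wh by (simp add: kernel_def) }
    { assume "w \<in> kernel (FOb (L Y) V) (FOb (L Z) V) (induced Y Z g V)"
      then have w: "w \<in> sections (L Y) V" and wz: "induced Y Z g V w = \<one>\<^bsub>FOb (L Z) V\<^esub>" by (auto simp: kernel_def)
      obtain h where h [simp]: "h \<in> arrows C V (P Y)" and wh: "w = \<pi> Y V h" using quotient_surjE[OF Y V w] .
      have "\<pi> Z V (Cmp C V (P Y) (P Z) g0 h) = \<one>\<^bsub>FOb (L Z) V\<^esub>" using wz wh induced_apply[OF Y Z g g0 V h] by simp
      then obtain Q u v where Q: "projective C Q" and v [simp]: "v \<in> arrows C V Q" and u [simp]: "u \<in> arrows C Q (P Z)"
        and eu: "Cmp C Q (P Z) Z (e Z) u = zero_arr C Q Z" and gh: "Cmp C V (P Y) (P Z) g0 h = Cmp C V Q (P Z) u v"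
        using pk[OF Z V, of "Cmp C V (P Y) (P Z) g0 h"] by (auto simp: null_arrows_def)
      note [simp] = projective_obj[OF Q]
      let ?sg = "Cmp C (P Y) (P Z) (P Y) s g0" and ?su = "Cmp C Q (P Z) (P Y) s u"
      let ?a = "sub_arr C (P Y) (P Y) (Ident C (P Y)) ?sg"
      have ges: "Cmp C W Y Z g (Cmp C W (P Y) Y (e Y) (Cmp C W (P Z) (P Y) s b)) = Cmp C W (P Z) Z (e Z) b"
        if [simp]: "W \<in> Obj C" "b \<in> arrows C W (P Z)" for W b
      proof -
        have "Cmp C W (P Y) Y (e Y) (Cmp C W (P Z) (P Y) s b) = Cmp C W (P Z) Y t b" by (subst comp_assoc) simp_all
        then show ?thesis by (simp add: comp_assoc)
      qed
      have "Cmp C (P Y) Y Z g (Cmp C (P Y) (P Y) Y (e Y) ?a) = zero_arr C (P Y) Z"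
        using ges[of "P Y" g0] by (simp add: comp_sub_right eg0 sub_zero_iff)
      then obtain r where r [simp]: "r \<in> arrows C (P Y) (P X)"
        and r': "\<And>V h. \<lbrakk>V \<in> Obj C; h \<in> arrows C V (P Y)\<rbrakk> \<Longrightarrow> \<pi> Y V (Cmp C V (P Y) (P Y) ?a h) = induced X Y f V (\<pi> X V (Cmp C V (P Y) (P X) r h))"
        using thr[OF P[OF Y], of ?a] by auto
      have "Cmp C Q Y Z g (Cmp C Q (P Y) Y (e Y) ?su) = zero_arr C Q Z" using ges[of Q u] eu by simp
      then obtain q where q [simp]: "q \<in> arrows C Q (P X)"
        and q': "\<And>V h. \<lbrakk>V \<in> Obj C; h \<in> arrows C V Q\<rbrakk> \<Longrightarrow> \<pi> Y V (Cmp C V Q (P Y) ?su h) = induced X Y f V (\<pi> X V (Cmp C V Q (P X) q h))"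
        using thr[OF Q, of ?su] by auto
      have 1: "Cmp C V (P Y) (P Y) ?a h = sub_arr C V (P Y) h (Cmp C V Q (P Y) ?su v)"
        by (simp add: comp_sub_left comp_assoc[symmetric] gh)
      have "h = Cmp C V (P Y) (P Y) ?a h \<otimes>\<^bsub>HomGrp C V (P Y)\<^esub> Cmp C V Q (P Y) ?su v"
        by (rule sub_eq_iff_add[THEN iffD1, OF _ _ _ _ _ 1[symmetric]]) auto
      then have "w = \<pi> Y V (Cmp C V (P Y) (P Y) ?a h) \<otimes>\<^bsub>FOb (L Y) V\<^esub> \<pi> Y V (Cmp C V Q (P Y) ?su v)"
        unfolding wh using pY.hom_mult[of "Cmp C V (P Y) (P Y) ?a h" "Cmp C V Q (P Y) ?su v"] by simp
      moreover have "Cmp C V (P Y) (P X) r h \<in> arrows C V (P X)" "Cmp C V Q (P X) q v \<in> arrows C V (P X)" by auto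
      note cl = this[THEN quotient_closed[OF X V]]
      interpret If: group_hom "FOb (L X) V" "FOb (L Y) V" "induced X Y f V" using nat_hom[OF quotient_obj[OF X] quotient_obj[OF Y] If V] .
      have "w = induced X Y f V (\<pi> X V (Cmp C V (P Y) (P X) r h) \<otimes>\<^bsub>FOb (L X) V\<^esub> \<pi> X V (Cmp C V Q (P X) q v))"
        unfolding If.hom_mult[OF cl] using calculation r'[OF V h] q'[OF V v] by simp
      then show "w \<in> induced X Y f V ` sections (L X) V" using If.m_closed[OF cl] by blast }
  qed
  have "exact_at (fp C) (L X) (L Y) (L Z) (induced X Y f) (induced Y Z g)"
    by (rule fp_exactI[OF L[OF X] L[OF Y] L[OF Z] If Ig exact])
  moreover have "epi_arr (fp C) (L Y) (L Z) (induced Y Z g)" using fp_epi_iff L Y Z Ig surj by simp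
  ultimately show "exact_at (fp C) (FOb \<lparr>FOb = L, FAr = induced\<rparr> X) (FOb \<lparr>FOb = L, FAr = induced\<rparr> Y) (FOb \<lparr>FOb = L, FAr = induced\<rparr> Z)
      (FAr \<lparr>FOb = L, FAr = induced\<rparr> X Y f) (FAr \<lparr>FOb = L, FAr = induced\<rparr> Y Z g)"
    "epi_arr (fp C) (FOb \<lparr>FOb = L, FAr = induced\<rparr> Y) (FOb \<lparr>FOb = L, FAr = induced\<rparr> Z) (FAr \<lparr>FOb = L, FAr = induced\<rparr> Y Z g)"
    by simp_all
qed

lemma yoneda_functor: "is_functor C (fp C) (yoneda C)"
  unfolding is_functor_def
proof (intro conjI ballI)
  fix X assume X [simp]: "X \<in> Obj C"
  show "FOb (yoneda C) X \<in> Obj (fp C)" by (simp add: yoneda_def)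
  show "FAr (yoneda C) X X (Ident C X) = Ident (fp C) (FOb (yoneda C) X)"
    unfolding yoneda_def fctr.simps fp_simps
    by (rule nat_eqI[OF yoneda_presheaf[OF X] yoneda_presheaf[OF X] yoneda_ar_arrow psh_ident_closed[OF yoneda_presheaf[OF X]]]) simp_all
  fix Y f assume Y [simp]: "Y \<in> Obj C" and f [simp]: "f \<in> arrows C X Y"
  show "FAr (yoneda C) X Y f \<in> arrows (fp C) (FOb (yoneda C) X) (FOb (yoneda C) Y)" by (simp add: yoneda_def)
next
  fix X Y Z f g assume o [simp]: "X \<in> Obj C" "Y \<in> Obj C" "Z \<in> Obj C" and f [simp]: "f \<in> arrows C X Y" and g [simp]: "g \<in> arrows C Y Z"
  show "FAr (yoneda C) X Z (Cmp C X Y Z g f)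
      = Cmp (fp C) (FOb (yoneda C) X) (FOb (yoneda C) Y) (FOb (yoneda C) Z) (FAr (yoneda C) Y Z g) (FAr (yoneda C) X Y f)"
    unfolding yoneda_def fctr.simps fp_simps
    by (rule nat_eqI[OF yoneda_presheaf[OF o(1)] yoneda_presheaf[OF o(3)] yoneda_ar_arrow
          psh_comp_closed[OF yoneda_presheaf[OF o(1)] yoneda_presheaf[OF o(2)] yoneda_presheaf[OF o(3)] yoneda_ar_arrow yoneda_ar_arrow]])
      (simp_all add: comp_assoc)
qed

text \<open>
  If \<open>X\<close> is projective, then \<open>e X\<close> has a section \<open>s\<close>.  An arrow \<open>h\<close> with \<open>e h = 0\<close> equals
  \<open>(1 - s e) h\<close> and is therefore null, so the quotient of \<open>Hom(-, P X)\<close> is \<open>Hom(-, X)\<close>.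
\<close>

lemma induced_agrees:
  "naturally_isomorphic (full_subcat C (projective C)) (fp C) \<lparr>FOb = L, FAr = induced\<rparr> (yoneda C)"
proof -
  have "\<exists>\<theta> \<psi>. \<theta> \<in> arrows (presheaf_cat C) (L X) (yoneda_ob C X) \<and> \<psi> \<in> arrows (presheaf_cat C) (yoneda_ob C X) (L X) \<and>
      Cmp (presheaf_cat C) (L X) (yoneda_ob C X) (L X) \<psi> \<theta> = Ident (presheaf_cat C) (L X) \<and>
      Cmp (presheaf_cat C) (yoneda_ob C X) (L X) (yoneda_ob C X) \<theta> \<psi> = Ident (presheaf_cat C) (yoneda_ob C X) \<and>
      (\<forall>Z\<in>Obj C. \<forall>h\<in>arrows C Z (P X). \<theta> Z (\<pi> X Z h) = Cmp C Z (P X) X (e X) h)" if X: "projective C X" for X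
  proof -
    have XO [simp]: "X \<in> Obj C" using projective_obj[OF X] .
    note YX = yoneda_presheaf[OF XO] and YP = yoneda_presheaf[OF cover_obj[OF XO]]
    obtain s where s [simp]: "s \<in> arrows C X (P X)" "Cmp C X (P X) X (e X) s = Ident C X"
      using projective_lift[OF X e[OF XO] ident_closed[OF XO]] .
    have null: "h \<in> null_arrows C (P X) X (e X) Z \<longleftrightarrow> Cmp C Z (P X) X (e X) h = zero_arr C Z X"
      if [simp]: "Z \<in> Obj C" "h \<in> arrows C Z (P X)" for Z h
    proof
      assume "h \<in> null_arrows C (P X) X (e X) Z"
      then obtain Q u v where Q: "projective C Q" and v: "v \<in> arrows C Z Q" and u: "u \<in> arrows C Q (P X)"
        and eu: "Cmp C Q (P X) X (e X) u = zero_arr C Q X" and hu: "h = Cmp C Z Q (P X) u v" by (auto simp: null_arrows_def)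
      show "Cmp C Z (P X) X (e X) h = zero_arr C Z X"
        unfolding hu using projective_obj[OF Q] u v eu by (simp add: comp_assoc)
    next
      assume z: "Cmp C Z (P X) X (e X) h = zero_arr C Z X"
      let ?u = "sub_arr C (P X) (P X) (Ident C (P X)) (Cmp C (P X) X (P X) s (e X))"
      have "Cmp C (P X) (P X) X (e X) (Cmp C (P X) X (P X) s (e X)) = e X" by (subst comp_assoc) simp_all
      then have "Cmp C (P X) (P X) X (e X) ?u = zero_arr C (P X) X" by (simp add: comp_sub_right sub_zero_iff)
      moreover have "h = Cmp C Z (P X) (P X) ?u h" by (simp add: comp_sub_left comp_assoc[symmetric] z)
      moreover have "?u \<in> arrows C (P X) (P X)" by simp
      ultimately show "h \<in> null_arrows C (P X) X (e X) Z"
        unfolding null_arrows_def using P[OF XO] \<open>h \<in> arrows C Z (P X)\<close> by blast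
    qed
    have ya: "yoneda_ar C (P X) X (e X) \<in> arrows (presheaf_cat C) (yoneda_ob C (P X)) (yoneda_ob C X)" by simp
    have "yoneda_ar C (P X) X (e X) Z h = \<one>\<^bsub>FOb (yoneda_ob C X) Z\<^esub>"
      if "Z \<in> Obj C" "h \<in> sections (yoneda_ob C (P X)) Z" "\<pi> X Z h = \<one>\<^bsub>FOb (L X) Z\<^esub>" for Z h
      using that null[of Z h] pk[OF XO, of Z h] by simp
    then obtain \<theta> where t: "\<theta> \<in> arrows (presheaf_cat C) (L X) (yoneda_ob C X)"
      and t': "\<And>Z h. \<lbrakk>Z \<in> Obj C; h \<in> sections (yoneda_ob C (P X)) Z\<rbrakk> \<Longrightarrow> \<theta> Z (\<pi> X Z h) = yoneda_ar C (P X) X (e X) Z h"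
      using factor_through_surj[OF YP quotient_obj[OF XO] YX pr[OF XO] ps[OF XO] ya] by blast
    have tp: "\<theta> Z (\<pi> X Z h) = Cmp C Z (P X) X (e X) h" if "Z \<in> Obj C" "h \<in> arrows C Z (P X)" for Z h
      using t'[of Z h] that by simp
    have "presheaf_inj C (L X) \<theta>" unfolding presheaf_inj_def
    proof
      fix Z assume Z: "Z \<in> Obj C"
      interpret t: group_hom "FOb (L X) Z" "HomGrp C Z X" "\<theta> Z" using nat_hom[OF quotient_obj[OF XO] YX t Z] by simp
      show "inj_on (\<theta> Z) (sections (L X) Z)"
      proof (rule t.inj_on_one_iff[THEN iffD2], intro allI impI)
        fix w assume w: "w \<in> sections (L X) Z" and z: "\<theta> Z w = zero_arr C Z X"
        obtain h where h: "h \<in> arrows C Z (P X)" "w = \<pi> X Z h" using quotient_surjE[OF XO Z w] .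
        then show "w = \<one>\<^bsub>FOb (L X) Z\<^esub>" using z tp[OF Z h(1)] null[OF Z h(1)] pk[OF XO Z h(1)] by simp
      qed
    qed
    moreover have "presheaf_surj C (L X) (yoneda_ob C X) \<theta>" unfolding presheaf_surj_def
    proof (intro ballI equalityI subsetI)
      fix Z w assume Z [simp]: "Z \<in> Obj C"
      { assume "w \<in> \<theta> Z ` sections (L X) Z"
        then show "w \<in> sections (yoneda_ob C X) Z" using nat_closed[OF quotient_obj[OF XO] YX t Z] by blast }
      { assume "w \<in> sections (yoneda_ob C X) Z"
        then have w [simp]: "w \<in> arrows C Z X" by simp
        have "\<theta> Z (\<pi> X Z (Cmp C Z X (P X) s w)) = w" using tp[of Z "Cmp C Z X (P X) s w"] by (simp add: comp_assoc)
        then show "w \<in> \<theta> Z ` sections (L X) Z" using quotient_closed[OF XO Z, of "Cmp C Z X (P X) s w"]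
          by (intro image_eqI[of _ _ "\<pi> X Z (Cmp C Z X (P X) s w)"]) auto }
    qed
    ultimately obtain \<psi> where "\<psi> \<in> arrows (presheaf_cat C) (yoneda_ob C X) (L X)"
      "Cmp (presheaf_cat C) (L X) (yoneda_ob C X) (L X) \<psi> \<theta> = Ident (presheaf_cat C) (L X)"
      "Cmp (presheaf_cat C) (yoneda_ob C X) (L X) (yoneda_ob C X) \<theta> \<psi> = Ident (presheaf_cat C) (yoneda_ob C X)"
      by (rule isomorphic_pointwise[OF quotient_obj[OF XO] YX t])
    then show ?thesis using t tp by blast
  qed
  then obtain \<theta> \<psi> where *: "\<And>X. projective C X \<Longrightarrow> \<theta> X \<in> arrows (presheaf_cat C) (L X) (yoneda_ob C X) \<and> \<psi> X \<in> arrows (presheaf_cat C) (yoneda_ob C X) (L X) \<and>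
      Cmp (presheaf_cat C) (L X) (yoneda_ob C X) (L X) (\<psi> X) (\<theta> X) = Ident (presheaf_cat C) (L X) \<and>
      Cmp (presheaf_cat C) (yoneda_ob C X) (L X) (yoneda_ob C X) (\<theta> X) (\<psi> X) = Ident (presheaf_cat C) (yoneda_ob C X) \<and>
      (\<forall>Z\<in>Obj C. \<forall>h\<in>arrows C Z (P X). \<theta> X Z (\<pi> X Z h) = Cmp C Z (P X) X (e X) h)" by metis
  show ?thesis
  proof (rule naturally_isomorphicI[OF preadditive_fp full_subcat_is_functor[OF induced_functor] full_subcat_is_functor[OF yoneda_functor], of _ \<theta> \<psi>])
    fix X Y f assume "X \<in> Obj (full_subcat C (projective C))" "Y \<in> Obj (full_subcat C (projective C))" "f \<in> arrows (full_subcat C (projective C)) X Y"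
    then have X [simp]: "X \<in> Obj C" and Y [simp]: "Y \<in> Obj C" and f [simp]: "f \<in> arrows C X Y" and pX: "projective C X" and pY: "projective C Y" by auto
    have tX: "\<theta> X \<in> arrows (presheaf_cat C) (L X) (yoneda_ob C X)" and tY: "\<theta> Y \<in> arrows (presheaf_cat C) (L Y) (yoneda_ob C Y)"
      using *[OF pX] *[OF pY] by auto
    have "Cmp (presheaf_cat C) (L X) (L Y) (yoneda_ob C Y) (\<theta> Y) (induced X Y f)
        = Cmp (presheaf_cat C) (L X) (yoneda_ob C X) (yoneda_ob C Y) (yoneda_ar C X Y f) (\<theta> X)"
    proof (rule quotient_arrow_eqI[OF X yoneda_presheaf[OF Y] psh_comp_closed[OF quotient_obj[OF X] quotient_obj[OF Y] yoneda_presheaf[OF Y] induced_arrow[OF X Y f] tY]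
          psh_comp_closed[OF quotient_obj[OF X] yoneda_presheaf[OF X] yoneda_presheaf[OF Y] tX yoneda_ar_arrow[OF X Y f]]])
      fix V h assume V [simp]: "V \<in> Obj C" and h [simp]: "h \<in> arrows C V (P X)"
      obtain f0 where f0: "lifted X Y f f0" using lifted_ex[OF X Y f] by blast
      then have [simp]: "f0 \<in> arrows C (P X) (P Y)" and ef: "Cmp C (P X) (P Y) Y (e Y) f0 = Cmp C (P X) X Y f (e X)" by (auto simp: lifted_def)
      have a: "\<theta> Y V (\<pi> Y V (Cmp C V (P X) (P Y) f0 h)) = Cmp C V (P Y) Y (e Y) (Cmp C V (P X) (P Y) f0 h)"
        using *[OF pY] by simp
      have b: "\<theta> X V (\<pi> X V h) = Cmp C V (P X) X (e X) h" using *[OF pX] by simp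
      show "Cmp (presheaf_cat C) (L X) (L Y) (yoneda_ob C Y) (\<theta> Y) (induced X Y f) V (\<pi> X V h)
          = Cmp (presheaf_cat C) (L X) (yoneda_ob C X) (yoneda_ob C Y) (yoneda_ar C X Y f) (\<theta> X) V (\<pi> X V h)"
        using quotient_closed[OF X V h] by (simp add: induced_apply[OF X Y f f0 V h] a b) (simp add: comp_assoc ef)
    qed
    then show "Cmp (fp C) (FOb \<lparr>FOb = L, FAr = induced\<rparr> X) (FOb \<lparr>FOb = L, FAr = induced\<rparr> Y) (FOb (yoneda C) Y) (\<theta> Y) (FAr \<lparr>FOb = L, FAr = induced\<rparr> X Y f)
        = Cmp (fp C) (FOb \<lparr>FOb = L, FAr = induced\<rparr> X) (FOb (yoneda C) X) (FOb (yoneda C) Y) (FAr (yoneda C) X Y f) (\<theta> X)"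
      by (simp add: yoneda_def)
  qed (use * in \<open>simp_all add: yoneda_def\<close>)
qed

end

lemma L0Y_exists:
  "\<exists>T. right_exact_functor C (fp C) T \<and> naturally_isomorphic (full_subcat C (projective C)) (fp C) T (yoneda C)"
proof -
  have "\<exists>P e. X \<in> Obj C \<longrightarrow> projective C P \<and> epi_arr C P X e" for X
    using enough unfolding enough_projectives_def by blast
  then obtain P e where Pe: "\<And>X. X \<in> Obj C \<Longrightarrow> projective C (P X)" "\<And>X. X \<in> Obj C \<Longrightarrow> epi_arr C (P X) X (e X)"
    by metis
  have "\<exists>L \<pi>. X \<in> Obj C \<longrightarrow> finitely_presented C L \<and> \<pi> \<in> arrows (presheaf_cat C) (yoneda_ob C (P X)) L \<and> presheaf_surj C (yoneda_ob C (P X)) L \<pi> \<and>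
    (\<forall>Z\<in>Obj C. \<forall>h\<in>arrows C Z (P X). \<pi> Z h = \<one>\<^bsub>FOb L Z\<^esub> \<longleftrightarrow> h \<in> null_arrows C (P X) X (e X) Z)" for X
    using null_quotient[OF Pe(1) Pe(2), of X] by blast
  then obtain L \<pi> where L: "\<And>X. X \<in> Obj C \<Longrightarrow> finitely_presented C (L X) \<and> \<pi> X \<in> arrows (presheaf_cat C) (yoneda_ob C (P X)) (L X) \<and>
    presheaf_surj C (yoneda_ob C (P X)) (L X) (\<pi> X) \<and>
    (\<forall>Z\<in>Obj C. \<forall>h\<in>arrows C Z (P X). \<pi> X Z h = \<one>\<^bsub>FOb (L X) Z\<^esub> \<longleftrightarrow> h \<in> null_arrows C (P X) X (e X) Z)"
    by metis
  show ?thesis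
    using induced_right_exact[of P e L \<pi>] induced_agrees[of P e L \<pi>] Pe L by blast
qed

end

section \<open>Functors determined by a presentation\<close>

context abelian_category
begin

lemma presented_by_unique:
  assumes F: "presented_by C F R B r x" and G: "presented_by C G R B r y"
  shows "isomorphic (fp C) F G"
proof -
  note f = F[unfolded presented_by_def] and g = G[unfolded presented_by_def]
  have B [simp]: "B \<in> Obj C" and x: "x \<in> sections F B" and y: "y \<in> sections G B"
    and aF: "additive_presheaf C F" and aG: "additive_presheaf C G" using f g by auto
  have fF: "finitely_presented C F" and fG: "finitely_presented C G" using F G presented_by_imp_fp by auto
  note F' = fp_presheaf[OF fF] and G' = fp_presheaf[OF fG] and YB = yoneda_presheaf[OF B]
  note pF = yoneda_el_arrow[OF aF B x] and pG = yoneda_el_arrow[OF aG B y]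
  have sF: "presheaf_surj C (yoneda_ob C B) F (yoneda_el C F B x)"
    unfolding presheaf_surj_def using f presheaf_closed[OF F'] by (auto simp: image_iff)
  have sG: "presheaf_surj C (yoneda_ob C B) G (yoneda_el C G B y)"
    unfolding presheaf_surj_def using g presheaf_closed[OF G'] by (auto simp: image_iff)
  have k: "FAr F B X h x = \<one>\<^bsub>FOb F X\<^esub> \<longleftrightarrow> FAr G B X h y = \<one>\<^bsub>FOb G X\<^esub>" if "X \<in> Obj C" "h \<in> arrows C X B" for X h
    using f g that by simp
  have "yoneda_el C G B y X h = \<one>\<^bsub>FOb G X\<^esub>"
    if "X \<in> Obj C" "h \<in> sections (yoneda_ob C B) X" "yoneda_el C F B x X h = \<one>\<^bsub>FOb F X\<^esub>" for X h
    using k[of X h] that by simp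
  then obtain \<beta> where b: "\<beta> \<in> arrows (presheaf_cat C) F G"
    and be: "\<And>X h. \<lbrakk>X \<in> Obj C; h \<in> sections (yoneda_ob C B) X\<rbrakk> \<Longrightarrow> \<beta> X (yoneda_el C F B x X h) = yoneda_el C G B y X h"
    using factor_through_surj[OF YB F' G' pF sF pG] by blast
  have bf: "\<beta> X (FAr F B X h x) = FAr G B X h y" if "X \<in> Obj C" "h \<in> arrows C X B" for X h
    using be[of X h] that by simp
  have "presheaf_inj C F \<beta>" unfolding presheaf_inj_def
  proof
    fix X assume X: "X \<in> Obj C"
    interpret b: group_hom "FOb F X" "FOb G X" "\<beta> X" using nat_hom[OF F' G' b X] .
    show "inj_on (\<beta> X) (sections F X)"
    proof (rule b.inj_on_one_iff[THEN iffD2], intro allI impI)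
      fix w assume w: "w \<in> sections F X" and z: "\<beta> X w = \<one>\<^bsub>FOb G X\<^esub>"
      obtain h where h: "h \<in> arrows C X B" "w = FAr F B X h x" using f X w by blast
      then show "w = \<one>\<^bsub>FOb F X\<^esub>" using z bf[OF X h(1)] k[OF X h(1)] by simp
    qed
  qed
  moreover have "presheaf_surj C F G \<beta>" unfolding presheaf_surj_def
  proof (intro ballI equalityI subsetI)
    fix X w assume X: "X \<in> Obj C"
    { assume "w \<in> \<beta> X ` sections F X" then show "w \<in> sections G X" using nat_closed[OF F' G' b X] by blast }
    { assume w: "w \<in> sections G X"
      obtain h where h: "h \<in> arrows C X B" "w = FAr G B X h y" using g X w by blast
      show "w \<in> \<beta> X ` sections F X"
        by (rule image_eqI[of _ _ "FAr F B X h x"]) (use h bf[OF X h(1)] presheaf_closed[OF F' X B h(1) x] in auto) }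
  qed
  ultimately obtain \<gamma> where "\<gamma> \<in> arrows (presheaf_cat C) G F"
    "Cmp (presheaf_cat C) F G F \<gamma> \<beta> = Ident (presheaf_cat C) F" "Cmp (presheaf_cat C) G F G \<beta> \<gamma> = Ident (presheaf_cat C) G"
    by (rule isomorphic_pointwise[OF F' G' b])
  then show ?thesis unfolding isomorphic_def using fF fG b by auto
qed

lemma presented_by_iso:
  assumes i: "isomorphic (fp C) F G" and G: "presented_by C G R B r y"
  shows "\<exists>x. presented_by C F R B r x"
proof -
  obtain \<alpha> \<beta> where a: "\<alpha> \<in> arrows (presheaf_cat C) F G" and b: "\<beta> \<in> arrows (presheaf_cat C) G F"
    and ba: "Cmp (presheaf_cat C) F G F \<beta> \<alpha> = Ident (presheaf_cat C) F" and ab: "Cmp (presheaf_cat C) G F G \<alpha> \<beta> = Ident (presheaf_cat C) G"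
    and fF: "finitely_presented C F" and fG: "finitely_presented C G"
    using i unfolding isomorphic_def by auto
  note F' = fp_presheaf[OF fF] and G' = fp_presheaf[OF fG]
  note g = G[unfolded presented_by_def]
  have B: "B \<in> Obj C" and y: "y \<in> sections G B" using g by auto
  have ba': "\<beta> X (\<alpha> X z) = z" if "X \<in> Obj C" "z \<in> sections F X" for X z using fun_cong[OF fun_cong[OF ba], of X z] that by simp
  have ab': "\<alpha> X (\<beta> X z) = z" if "X \<in> Obj C" "z \<in> sections G X" for X z using fun_cong[OF fun_cong[OF ab], of X z] that by simp
  have n: "FAr F B X h (\<beta> B y) = \<beta> X (FAr G B X h y)" if "X \<in> Obj C" "h \<in> arrows C X B" for X h
    using nat_natural[OF G' F' b that(1) B that(2) y] by simp
  have "presented_by C F R B r (\<beta> B y)"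
    unfolding presented_by_def
  proof (intro conjI ballI)
    show "additive_presheaf C F" using fp_additive[OF fF] .
    show "\<beta> B y \<in> sections F B" using nat_closed[OF G' F' b B y] .
  next
    fix X z assume X: "X \<in> Obj C" and z: "z \<in> sections F X"
    have "\<alpha> X z \<in> sections G X" using nat_closed[OF F' G' a X z] .
    then obtain h where h: "h \<in> arrows C X B" "\<alpha> X z = FAr G B X h y" using g X by blast
    then have "z = FAr F B X h (\<beta> B y)" using n[OF X h(1)] ba'[OF X z] by simp
    then show "\<exists>h\<in>arrows C X B. z = FAr F B X h (\<beta> B y)" using h(1) by blast
  next
    fix X h assume X: "X \<in> Obj C" and h: "h \<in> arrows C X B"
    interpret a: group_hom "FOb F X" "FOb G X" "\<alpha> X" using nat_hom[OF F' G' a X] .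
    interpret b: group_hom "FOb G X" "FOb F X" "\<beta> X" using nat_hom[OF G' F' b X] .
    have gh: "FAr G B X h y \<in> sections G X" using presheaf_closed[OF G' X B h y] .
    have "\<beta> X (FAr G B X h y) = \<one>\<^bsub>FOb F X\<^esub> \<longleftrightarrow> FAr G B X h y = \<one>\<^bsub>FOb G X\<^esub>"
      using ab'[OF X gh] a.hom_one b.hom_one by metis
    then show "FAr F B X h (\<beta> B y) = \<one>\<^bsub>FOb F X\<^esub> \<longleftrightarrow> (\<exists>u\<in>arrows C X R. h = Cmp C X R B r u)"
      using n[OF X h] g X h by simp
  qed (use g in auto)
  then show ?thesis ..
qed

text \<open>
  It has to be shown that the factor \<open>f'\<close> of \<open>f\<close> through the kernel \<open>k\<close> of \<open>q\<close> is epi.  Let \<open>u\<close> kill \<open>f'\<close>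
  and let \<open>m\<close> be a kernel of \<open>u\<close>.  The monomorphism \<open>k m\<close> is a kernel of some \<open>g\<close>; as \<open>g\<close> kills \<open>f\<close>, it
  factors through \<open>q\<close> and so kills \<open>k\<close>.  Hence \<open>k\<close> factors through \<open>k m\<close>, which splits \<open>m\<close> and forces
  \<open>u = 0\<close>.
\<close>

lemma cokernel_exact:
  assumes q: "is_cokernel C X Y Q f q"
  shows "exact_at C X Y Q f q"
proof -
  have o [simp]: "X \<in> Obj C" "Y \<in> Obj C" "Q \<in> Obj C" "f \<in> arrows C X Y" "q \<in> arrows C Y Q" and qf: "Cmp C X Y Q q f = zero_arr C X Q"
    using q by (auto simp: is_cokernel_def)
  obtain K k where k: "is_kernel C K Y Q k q" using ex_kernel[OF o(2,3,5)] by blast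
  then have K [simp]: "K \<in> Obj C" "k \<in> arrows C K Y" and qk: "Cmp C K Y Q q k = zero_arr C K Q" by (auto simp: is_kernel_def)
  note mk = kernel_mono[OF k]
  obtain f' where f' [simp]: "f' \<in> arrows C X K" and kf: "f = Cmp C X K Y k f'"
    using kernel_factor_iff[OF k o(1,4)] qf by blast
  have "epi_arr C X K f'"
  proof (rule epi_zeroI)
    fix W u assume W [simp]: "W \<in> Obj C" and u [simp]: "u \<in> arrows C K W" and uf: "Cmp C X K W u f' = zero_arr C X W"
    obtain M m where m: "is_kernel C M K W m u" using ex_kernel[of K W u] by auto
    then have M [simp]: "M \<in> Obj C" "m \<in> arrows C M K" and um: "Cmp C M K W u m = zero_arr C M W" by (auto simp: is_kernel_def)
    obtain f'' where f'' [simp]: "f'' \<in> arrows C X M" and mf: "f' = Cmp C X M K m f''"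
      using kernel_factor_iff[OF m o(1) f'] uf by blast
    have "mono_arr C M Y (Cmp C M K Y k m)"
    proof (rule mono_zeroI)
      fix V v assume V [simp]: "V \<in> Obj C" and v [simp]: "v \<in> arrows C V M" and "Cmp C V M Y (Cmp C M K Y k m) v = zero_arr C V Y"
      then have "Cmp C V K Y k (Cmp C V M K m v) = zero_arr C V Y" by (simp add: comp_assoc)
      then have "Cmp C V M K m v = zero_arr C V K" using mono_zeroD[OF mk V] by simp
      then show "v = zero_arr C V M" using mono_zeroD[OF kernel_mono[OF m] V v] by simp
    qed auto
    then obtain Z g where g: "is_kernel C M Y Z (Cmp C M K Y k m) g" using mono_normal by blast
    then have [simp]: "Z \<in> Obj C" "g \<in> arrows C Y Z" by (auto simp: is_kernel_def)
    have "f = Cmp C X M Y (Cmp C M K Y k m) f''" unfolding kf mf by (rule comp_assoc) auto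
    then have "Cmp C X Y Z g f = zero_arr C X Z" using kernel_factor_iff[OF g o(1,4)] f'' by blast
    then obtain g' where g' [simp]: "g' \<in> arrows C Q Z" and gq: "Cmp C Y Q Z g' q = g"
      using q unfolding is_cokernel_def by (metis \<open>Z \<in> Obj C\<close> \<open>g \<in> arrows C Y Z\<close>)
    have "Cmp C K Y Z g k = Cmp C K Q Z g' (Cmp C K Y Q q k)" unfolding gq[symmetric] by (rule comp_assoc[symmetric]) auto
    then have "Cmp C K Y Z g k = zero_arr C K Z" by (simp add: qk)
    then obtain n where n [simp]: "n \<in> arrows C K M" and kn: "k = Cmp C K M Y (Cmp C M K Y k m) n"
      using kernel_factor_iff[OF g K] by blast
    have "Cmp C K K Y k (Cmp C K M K m n) = Cmp C K K Y k (Ident C K)"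
      using kn by (simp add: comp_assoc)
    moreover have "Cmp C K M K m n \<in> arrows C K K" "Ident C K \<in> arrows C K K" by simp_all
    ultimately have mn: "Cmp C K M K m n = Ident C K" using mk K(1) unfolding mono_arr_def by blast
    have "u = Cmp C K K W u (Cmp C K M K m n)" by (simp add: mn)
    also have "\<dots> = Cmp C K M W (Cmp C M K W u m) n" by (rule comp_assoc) auto
    finally show "u = zero_arr C K W" by (simp add: um)
  qed auto
  then show ?thesis unfolding exact_at_def using k kf by blast
qed

end

context abelian_enough_projectives
begin

text \<open>
  Right exactness presents \<open>T X\<close> by \<open>T P1 \<rightarrow> T P0\<close>, which is naturally isomorphic to
  \<open>Hom(-, P1) \<rightarrow> Hom(-, P0)\<close>.  So \<open>T X\<close> is determined by a projective presentation of \<open>X\<close>.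
\<close>

lemma right_exact_presented:
  assumes T: "right_exact_functor C (fp C) T" and ni: "naturally_isomorphic (full_subcat C (projective C)) (fp C) T (yoneda C)"
    and P1: "projective C P1" and P0: "projective C P0" and ex: "exact_at C P1 P0 X d q" and q: "epi_arr C P0 X q"
  shows "\<exists>x. presented_by C (FOb T X) P1 P0 d x"
proof -
  note o = exact_comp_zero[OF ex]
  note o(1-5) [simp]
  have TO: "finitely_presented C (FOb T Y)" if "Y \<in> Obj C" for Y
    using T that by (simp add: right_exact_functor_def additive_functor_def is_functor_def)
  have TA: "FAr T Y Z f \<in> arrows (presheaf_cat C) (FOb T Y) (FOb T Z)" if "Y \<in> Obj C" "Z \<in> Obj C" "f \<in> arrows C Y Z" for Y Z f
    using T that by (simp add: right_exact_functor_def additive_functor_def is_functor_def)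
  note T' = TO[THEN fp_presheaf]
  have "exact_at (fp C) (FOb T P1) (FOb T P0) (FOb T X) (FAr T P1 P0 d) (FAr T P0 X q)"
    and Tq: "epi_arr (fp C) (FOb T P0) (FOb T X) (FAr T P0 X q)"
    using T ex q o(1-5) unfolding right_exact_functor_def by blast+
  then have pe: "presheaf_exact C (FOb T P1) (FOb T P0) (FOb T X) (FAr T P1 P0 d) (FAr T P0 X q)" using fp_exact_pointwise by blast
  note ps = fp_epi_surj[OF Tq]
  obtain \<theta> \<psi> where th: "\<And>Y. Y \<in> Obj (full_subcat C (projective C)) \<Longrightarrow> \<theta> Y \<in> arrows (fp C) (FOb T Y) (FOb (yoneda C) Y)"
    and ps': "\<And>Y. Y \<in> Obj (full_subcat C (projective C)) \<Longrightarrow> \<psi> Y \<in> arrows (fp C) (FOb (yoneda C) Y) (FOb T Y)"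
    and pt: "\<And>Y. Y \<in> Obj (full_subcat C (projective C)) \<Longrightarrow> Cmp (fp C) (FOb T Y) (FOb (yoneda C) Y) (FOb T Y) (\<psi> Y) (\<theta> Y) = Ident (fp C) (FOb T Y)"
    and tp: "\<And>Y. Y \<in> Obj (full_subcat C (projective C)) \<Longrightarrow> Cmp (fp C) (FOb (yoneda C) Y) (FOb T Y) (FOb (yoneda C) Y) (\<theta> Y) (\<psi> Y) = Ident (fp C) (FOb (yoneda C) Y)"
    and nat: "\<And>Y Z f. \<lbrakk>Y \<in> Obj (full_subcat C (projective C)); Z \<in> Obj (full_subcat C (projective C)); f \<in> arrows (full_subcat C (projective C)) Y Z\<rbrakk> \<Longrightarrow>
      Cmp (fp C) (FOb T Y) (FOb T Z) (FOb (yoneda C) Z) (\<theta> Z) (FAr T Y Z f) = Cmp (fp C) (FOb T Y) (FOb (yoneda C) Y) (FOb (yoneda C) Z) (FAr (yoneda C) Y Z f) (\<theta> Y)"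
    using naturally_isomorphicE[OF ni] by blast
  have fs: "P1 \<in> Obj (full_subcat C (projective C))" "P0 \<in> Obj (full_subcat C (projective C))" using P1 P0 by simp_all
  have t1: "\<theta> P1 \<in> arrows (presheaf_cat C) (FOb T P1) (yoneda_ob C P1)" and t0: "\<theta> P0 \<in> arrows (presheaf_cat C) (FOb T P0) (yoneda_ob C P0)"
    using th[OF fs(1)] th[OF fs(2)] by (simp_all add: yoneda_def)
  have s1: "\<psi> P1 \<in> arrows (presheaf_cat C) (yoneda_ob C P1) (FOb T P1)" and s0: "\<psi> P0 \<in> arrows (presheaf_cat C) (yoneda_ob C P0) (FOb T P0)"
    using ps'[OF fs(1)] ps'[OF fs(2)] by (simp_all add: yoneda_def)
  note Y1 = yoneda_presheaf[OF o(1)] and Y0 = yoneda_presheaf[OF o(2)]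
  note T1 = T'[OF o(1)] and T0 = T'[OF o(2)] and TX = T'[OF o(3)]
  have st0: "\<psi> P0 Z (\<theta> P0 Z w) = w" if "Z \<in> Obj C" "w \<in> sections (FOb T P0) Z" for Z w
    using fun_cong[OF fun_cong[OF pt[OF fs(2)]], of Z w] that by simp
  have ts: "\<theta> P0 Z (\<psi> P0 Z h) = h" if "Z \<in> Obj C" "h \<in> arrows C Z P0" for Z h
    using fun_cong[OF fun_cong[OF tp[OF fs(2)]], of Z h] that by (simp add: yoneda_def)
  have ts1: "\<theta> P1 Z (\<psi> P1 Z h) = h" if "Z \<in> Obj C" "h \<in> arrows C Z P1" for Z h
    using fun_cong[OF fun_cong[OF tp[OF fs(1)]], of Z h] that by (simp add: yoneda_def)
  have n: "\<theta> P0 Z (FAr T P1 P0 d Z w) = Cmp C Z P1 P0 d (\<theta> P1 Z w)" if Z: "Z \<in> Obj C" and w: "w \<in> sections (FOb T P1) Z" for Z w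
    using fun_cong[OF fun_cong[OF nat[OF fs]], of d Z w] nat_closed[OF T1 Y1 t1 Z w] Z w by (simp add: yoneda_def)
  let ?p = "Cmp (presheaf_cat C) (yoneda_ob C P0) (FOb T P0) (FOb T X) (FAr T P0 X q) (\<psi> P0)"
  note Tq' = TA[OF o(2,3,5)] and Td = TA[OF o(1,2,4)]
  have p: "?p \<in> arrows (presheaf_cat C) (yoneda_ob C P0) (FOb T X)" by (rule psh_comp_closed[OF Y0 T0 TX s0 Tq'])
  have pz: "?p Z h = FAr T P0 X q Z (\<psi> P0 Z h)" if "Z \<in> Obj C" "h \<in> arrows C Z P0" for Z h using that by simp
  have s0c: "\<psi> P0 Z h \<in> sections (FOb T P0) Z" if "Z \<in> Obj C" "h \<in> arrows C Z P0" for Z h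
    using nat_closed[OF Y0 T0 s0 that(1)] that(2) by simp
  have pex: "presheaf_exact C (yoneda_ob C P1) (yoneda_ob C P0) (FOb T X) (yoneda_ar C P1 P0 d) ?p"
    unfolding presheaf_exact_def
  proof (intro ballI equalityI subsetI)
    fix Z h assume Z [simp]: "Z \<in> Obj C"
    have im: "FAr T P1 P0 d Z ` sections (FOb T P1) Z = {w \<in> sections (FOb T P0) Z. FAr T P0 X q Z w = \<one>\<^bsub>FOb (FOb T X) Z\<^esub>}"
      using pe by (simp add: presheaf_exact_def kernel_def)
    { assume "h \<in> yoneda_ar C P1 P0 d Z ` sections (yoneda_ob C P1) Z"
      then obtain u where u [simp]: "u \<in> arrows C Z P1" and h: "h = Cmp C Z P1 P0 d u" by auto
      have h' [simp]: "h \<in> arrows C Z P0" unfolding h by simp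
      let ?w = "\<psi> P1 Z u"
      have w: "?w \<in> sections (FOb T P1) Z" using nat_closed[OF Y1 T1 s1 Z] by simp
      have "h = \<theta> P0 Z (FAr T P1 P0 d Z ?w)" using n[OF Z w] ts1[OF Z u] h by simp
      then have "\<psi> P0 Z h = FAr T P1 P0 d Z ?w" using st0[OF Z nat_closed[OF T1 T0 Td Z w]] by simp
      moreover have "FAr T P1 P0 d Z ?w \<in> FAr T P1 P0 d Z ` sections (FOb T P1) Z" using w by blast
      ultimately have "?p Z h = \<one>\<^bsub>FOb (FOb T X) Z\<^esub>" unfolding im using pz[OF Z h'] by simp
      then show "h \<in> kernel (FOb (yoneda_ob C P0) Z) (FOb (FOb T X) Z) (?p Z)" by (simp add: kernel_def) }
    { assume "h \<in> kernel (FOb (yoneda_ob C P0) Z) (FOb (FOb T X) Z) (?p Z)"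
      then have h [simp]: "h \<in> arrows C Z P0" and hz: "?p Z h = \<one>\<^bsub>FOb (FOb T X) Z\<^esub>" by (auto simp: kernel_def)
      have "\<psi> P0 Z h \<in> FAr T P1 P0 d Z ` sections (FOb T P1) Z" using im s0c[OF Z h] hz pz[OF Z h] by simp
      then obtain w where w: "w \<in> sections (FOb T P1) Z" "\<psi> P0 Z h = FAr T P1 P0 d Z w" by blast
      have "h = Cmp C Z P1 P0 d (\<theta> P1 Z w)" using ts[OF Z h] n[OF Z w(1)] w(2) by simp
      moreover have "\<theta> P1 Z w \<in> arrows C Z P1" using nat_closed[OF T1 Y1 t1 Z w(1)] by simp
      ultimately show "h \<in> yoneda_ar C P1 P0 d Z ` sections (yoneda_ob C P1) Z" by (intro image_eqI[of _ _ "\<theta> P1 Z w"]) auto }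
  qed
  have psu: "presheaf_surj C (yoneda_ob C P0) (FOb T X) ?p"
    unfolding presheaf_surj_def
  proof (intro ballI equalityI subsetI)
    fix Z w assume Z [simp]: "Z \<in> Obj C"
    { assume "w \<in> ?p Z ` sections (yoneda_ob C P0) Z" then show "w \<in> sections (FOb T X) Z" using nat_closed[OF Y0 TX p Z] by blast }
    { assume w: "w \<in> sections (FOb T X) Z"
      obtain v where v: "v \<in> sections (FOb T P0) Z" "w = FAr T P0 X q Z v" using presheaf_surjE[OF ps Z w] .
      have t: "\<theta> P0 Z v \<in> arrows C Z P0" using nat_closed[OF T0 Y0 t0 Z v(1)] by simp
      have "w = ?p Z (\<theta> P0 Z v)" using pz[OF Z t] st0[OF Z v(1)] v(2) by simp
      then show "w \<in> ?p Z ` sections (yoneda_ob C P0) Z" using t by (intro image_eqI[of _ _ "\<theta> P0 Z v"]) simp_all }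
  qed
  have "presented_by C (FOb T X) P1 P0 (yoneda_ar C P1 P0 d P1 (Ident C P1)) (?p P0 (Ident C P0))"
    by (rule presented_byI[OF TX o(1,2) _ p pex psu]) simp
  then show ?thesis by auto
qed

text \<open>
  A projective presentation of \<open>X\<close> presents the value at \<open>X\<close>; conversely, a functor presented by an
  arrow \<open>d\<close> between projectives is the value at the cokernel of \<open>d\<close>.
\<close>

lemma L0Y_image_iff_projectively_presented:
  "(\<exists>X\<in>Obj C. isomorphic (fp C) F (FOb (L0Y C) X)) \<longleftrightarrow> projectively_presented C F"
proof -
  have T: "right_exact_functor C (fp C) (L0Y C)" and ni: "naturally_isomorphic (full_subcat C (projective C)) (fp C) (L0Y C) (yoneda C)"
    using someI_ex[OF L0Y_exists] unfolding L0Y_def by blast+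
  show ?thesis
  proof
    assume "\<exists>X\<in>Obj C. isomorphic (fp C) F (FOb (L0Y C) X)"
    then obtain X where X: "X \<in> Obj C" and i: "isomorphic (fp C) F (FOb (L0Y C) X)" by blast
    obtain P0 q where P0: "projective C P0" and q: "epi_arr C P0 X q" using enough X unfolding enough_projectives_def by blast
    have "P0 \<in> Obj C" "q \<in> arrows C P0 X" using q by (auto simp: epi_arr_def)
    then obtain P1 d where P1: "projective C P1" and ex: "exact_at C P1 P0 X d q" using projective_presentation_exists[OF _ X] by blast
    obtain x where "presented_by C (FOb (L0Y C) X) P1 P0 d x" using right_exact_presented[OF T ni P1 P0 ex q] by blast
    then have "\<exists>y. presented_by C F P1 P0 d y" by (rule presented_by_iso[OF i])
    then show "projectively_presented C F" unfolding projectively_presented_def using P1 P0 by blast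
  next
    assume "projectively_presented C F"
    then obtain P1 P0 d x where P1: "projective C P1" and P0: "projective C P0" and pr: "presented_by C F P1 P0 d x"
      unfolding projectively_presented_def by blast
    then have "P1 \<in> Obj C" "P0 \<in> Obj C" "d \<in> arrows C P1 P0" by (auto simp: presented_by_def)
    then obtain X q where q: "is_cokernel C P1 P0 X d q" using ex_cokernel by blast
    obtain y where "presented_by C (FOb (L0Y C) X) P1 P0 d y"
      using right_exact_presented[OF T ni P1 P0 cokernel_exact[OF q] cokernel_epi[OF q]] by blast
    then have "isomorphic (fp C) F (FOb (L0Y C) X)" by (rule presented_by_unique[OF pr])
    moreover have "X \<in> Obj C" using q by (simp add: is_cokernel_def)
    ultimately show "\<exists>X\<in>Obj C. isomorphic (fp C) F (FOb (L0Y C) X)" by blast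
  qed
qed

lemma projectively_presented_iff_resolution:
  assumes fF: "finitely_presented C F"
  shows "projectively_presented C F \<longleftrightarrow>
       (\<exists>K P1 P0 k d \<pi>.
          mono_arr C K P1 k \<and> exact_at C K P1 P0 k d \<and>
          projective C P1 \<and> projective C P0 \<and>
          \<pi> \<in> arrows (fp C) (yoneda_ob C P0) F \<and>
          presheaf_inj C (yoneda_ob C K) (yoneda_ar C K P1 k) \<and>
          presheaf_exact C (yoneda_ob C K) (yoneda_ob C P1) (yoneda_ob C P0)
            (yoneda_ar C K P1 k) (yoneda_ar C P1 P0 d) \<and>
          presheaf_exact C (yoneda_ob C P1) (yoneda_ob C P0) F (yoneda_ar C P1 P0 d) \<pi> \<and>
          presheaf_surj C (yoneda_ob C P0) F \<pi>)" (is "_ \<longleftrightarrow> ?R")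
proof
  note F = fp_presheaf[OF fF]
  assume "projectively_presented C F"
  then obtain P1 P0 d x where P1: "projective C P1" and P0: "projective C P0" and pr: "presented_by C F P1 P0 d x"
    unfolding projectively_presented_def by blast
  then have o [simp]: "P1 \<in> Obj C" "P0 \<in> Obj C" "d \<in> arrows C P1 P0" and x: "x \<in> sections F P0" by (auto simp: presented_by_def)
  note p = pr[unfolded presented_by_def]
  obtain K k where k: "is_kernel C K P1 P0 k d" using ex_kernel[OF o] by blast
  then have K [simp]: "K \<in> Obj C" "k \<in> arrows C K P1" by (auto simp: is_kernel_def)
  note m = kernel_mono[OF k]
  have "epi_arr C K K (Ident C K)" by (rule epi_zeroI) auto
  then have ex: "exact_at C K P1 P0 k d"
    unfolding exact_at_def using k by (intro exI[of _ K] exI[of _ k] exI[of _ "Ident C K"]) simp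
  have inj: "presheaf_inj C (yoneda_ob C K) (yoneda_ar C K P1 k)"
    using m unfolding presheaf_inj_def inj_on_def mono_arr_def by simp
  have e1: "presheaf_exact C (yoneda_ob C K) (yoneda_ob C P1) (yoneda_ob C P0) (yoneda_ar C K P1 k) (yoneda_ar C P1 P0 d)"
    unfolding presheaf_exact_def kernel_def using kernel_factor_iff[OF k] by (auto simp: image_iff)
  have e2: "presheaf_exact C (yoneda_ob C P1) (yoneda_ob C P0) F (yoneda_ar C P1 P0 d) (yoneda_el C F P0 x)"
    unfolding presheaf_exact_def kernel_def using p by (auto simp: image_iff)
  have s: "presheaf_surj C (yoneda_ob C P0) F (yoneda_el C F P0 x)"
    unfolding presheaf_surj_def using p presheaf_closed[OF F] by (auto simp: image_iff)
  have "yoneda_el C F P0 x \<in> arrows (fp C) (yoneda_ob C P0) F"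
    using yoneda_el_arrow[OF fp_additive[OF fF] o(2) x] by simp
  then show ?R
    using m ex P1 P0 inj e1 e2 s by blast
next
  note F = fp_presheaf[OF fF]
  assume ?R
  then obtain K P1 P0 k d \<pi> where ex: "exact_at C K P1 P0 k d" and P1: "projective C P1" and P0: "projective C P0"
    and p: "\<pi> \<in> arrows (presheaf_cat C) (yoneda_ob C P0) F"
    and e: "presheaf_exact C (yoneda_ob C P1) (yoneda_ob C P0) F (yoneda_ar C P1 P0 d) \<pi>" and s: "presheaf_surj C (yoneda_ob C P0) F \<pi>"
    unfolding fp_simps by blast
  note o = exact_comp_zero[OF ex]
  have "presented_by C F P1 P0 (yoneda_ar C P1 P0 d P1 (Ident C P1)) (\<pi> P0 (Ident C P0))"
    by (rule presented_byI[OF F o(2,3) yoneda_ar_arrow[OF o(2,3,5)] p e s])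
  then show "projectively_presented C F" unfolding projectively_presented_def using P1 P0 by blast
qed

end

section \<open>The equivalence\<close>

theorem theorem3p3:
  fixes A :: "('o, 'u) acat" and F :: "('o, 'u) presheaf"
  assumes "abelian_category A"
    and "enough_projectives A"
    and "F \<in> Obj (fp A)"
  shows "(F \<in> fp_shriek A \<longleftrightarrow> (\<exists>X\<in>Obj A. isomorphic (fp A) F (FOb (L0Y A) X)))
    \<and> ((\<exists>X\<in>Obj A. isomorphic (fp A) F (FOb (L0Y A) X)) \<longleftrightarrow>
       (\<exists>K P1 P0 k d \<pi>.
          mono_arr A K P1 k \<and> exact_at A K P1 P0 k d \<and>
          projective A P1 \<and> projective A P0 \<and>
          \<pi> \<in> arrows (fp A) (yoneda_ob A P0) F \<and>
          presheaf_inj A (yoneda_ob A K) (yoneda_ar A K P1 k) \<and>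
          presheaf_exact A (yoneda_ob A K) (yoneda_ob A P1) (yoneda_ob A P0)
            (yoneda_ar A K P1 k) (yoneda_ar A P1 P0 d) \<and>
          presheaf_exact A (yoneda_ob A P1) (yoneda_ob A P0) F (yoneda_ar A P1 P0 d) \<pi> \<and>
          presheaf_surj A (yoneda_ob A P0) F \<pi>))"
proof -
  interpret abelian_enough_projectives A
    using assms(1,2) by (simp add: abelian_enough_projectives_def abelian_enough_projectives_axioms_def)
  have "finitely_presented A F" using assms(3) by simp
  then show ?thesis
    using fp_shriek_iff_projectively_presented[of F] L0Y_image_iff_projectively_presented[of F]
      projectively_presented_iff_resolution[of F] by (simp only: simp_thms)
qed

end
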